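(* Let $1<p<\infty$, let $X$ be a separable infinite dimensional $\mathcal L_p$-space, and let $E$ be a Schwartz locally convex space having a system of seminorms $(p_\alpha)_{\alpha\in A}$ defining its topology such that $E_{p_\alpha}\cong X$ for all $\alpha\in A$. Then for any separable infinite dimensional $\mathcal L_p$-space $Y$ the space $E$ has a system of local Banach spaces isomorphic to $Y$.
   Context: Spaces are over the same field, $\mathbb R$ or $\mathbb C$. For a continuous seminorm $p$ on a locally convex space $E$, the local Banach space $E_p$ is the completion of $(E/\ker p,p)$. A system of local Banach spaces of $E$ is a family $(E_{p_\alpha})_{\alpha\in A}$ where $(p_\alpha)_{\alpha\in A}$ is a system of continuous seminorms defining the topology of $E$, in the sense that every continuous seminorm on $E$ is dominated by a multiple of some $p_\alpha$; it is isomorphic to $Y$ if every $E_{p_\alpha}$ is linearly homeomorphic to $Y$. $E$ is a Schwartz space if for every continuous seminorm $p$ there is a continuous seminorm $q\ge p$ such that the canonical map $E_q\to E_p$ is compact. A Banach space $X$ is an $\mathcal L_p$-space if there is $\lambda\ge1$ such that every finite dimensional subspace $M\subset X$ is contained in a finite dimensional subspace $N\subset X$ with Banach--Mazur distance $d(N,\ell_p^{\dim N})\le\lambda$. *)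

theory Defs
  imports "HOL-Analysis.Analysis"
begin

subsection \<open>The scalar field\<close>

class real_or_complex = real_normed_field +
  assumes real_or_complex:
    "(\<exists>\<phi>::'a \<Rightarrow> real. bij \<phi> \<and> (\<forall>x y. \<phi> (x + y) = \<phi> x + \<phi> y) \<and>
        (\<forall>x y. \<phi> (x * y) = \<phi> x * \<phi> y) \<and> (\<forall>x. \<bar>\<phi> x\<bar> = norm x)) \<or>
     (\<exists>\<phi>::'a \<Rightarrow> complex. bij \<phi> \<and> (\<forall>x y. \<phi> (x + y) = \<phi> x + \<phi> y) \<and>
        (\<forall>x y. \<phi> (x * y) = \<phi> x * \<phi> y) \<and> (\<forall>x. cmod (\<phi> x) = norm x))"

instance real :: real_or_complex
  by standard (rule disjI1, rule exI[of _ id], simp)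

instance complex :: real_or_complex
  by standard (rule disjI2, rule exI[of _ id], simp)

subsection \<open>Normed and locally convex spaces over the scalar field\<close>

text \<open>
  The real structure and, for normed spaces, the norm come from the type classes; the parameter
  \<open>s\<close> is a compatible multiplication by scalars from \<open>'k\<close>. If \<open>'k\<close> is the
  real field, \<open>s\<close> is just \<open>scaleR\<close>.
\<close>

locale scalar_normed_space = vector_space s
  for s :: "'k::real_or_complex \<Rightarrow> 'x::real_normed_vector \<Rightarrow> 'x" +
  assumes scale_of_real: "s (of_real r) x = r *\<^sub>R x"
    and norm_scale: "norm (s a x) = norm a * norm x"

text \<open>The Hausdorff property is not required of a locally convex space.\<close>

locale locally_convex_space = vector_space s
  for s :: "'k::real_or_complex \<Rightarrow> 'e::{real_vector, topological_ab_group_add} \<Rightarrow> 'e" +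
  assumes scale_of_real: "s (of_real r) x = r *\<^sub>R x"
    and continuous_scale: "continuous_on UNIV (\<lambda>(a, x). s a x)"
    and convex_nhds: "open (U :: 'e set) \<Longrightarrow> 0 \<in> U \<Longrightarrow> \<exists>V. open V \<and> convex V \<and> 0 \<in> V \<and> V \<subseteq> U"

definition finite_dimensional :: "('k::field \<Rightarrow> 'x::ab_group_add \<Rightarrow> 'x) \<Rightarrow> 'x set \<Rightarrow> bool" where
  "finite_dimensional s V \<longleftrightarrow> (\<exists>B. finite B \<and> module.span s B = V)"

subsection \<open>Normed spaces with a carrier set\<close>

text \<open>
  Finite dimensional subspaces, the spaces \<open>\<ell>\<^sub>p\<^sup>n\<close> and the local Banach spaces are
  not types, so they are presented by a carrier together with the operations and the norm.
\<close>

record ('k, 'a) normed_structure =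
  carr :: "'a set"
  nadd :: "'a \<Rightarrow> 'a \<Rightarrow> 'a"
  nscale :: "'k \<Rightarrow> 'a \<Rightarrow> 'a"
  nnorm :: "'a \<Rightarrow> real"

definition subspace_structure ::
    "('k \<Rightarrow> 'x::real_normed_vector \<Rightarrow> 'x) \<Rightarrow> 'x set \<Rightarrow> ('k, 'x) normed_structure" where
  "subspace_structure s V = \<lparr>carr = V, nadd = (+), nscale = s, nnorm = norm\<rparr>"

definition ell :: "real \<Rightarrow> nat \<Rightarrow> ('k::real_or_complex, nat \<Rightarrow> 'k) normed_structure" where
  "ell p n = \<lparr>carr = {f. \<forall>i\<ge>n. f i = 0}, nadd = (\<lambda>f g i. f i + g i), nscale = (\<lambda>c f i. c * f i),
     nnorm = (\<lambda>f. (\<Sum>i<n. norm (f i) powr p) powr (1 / p))\<rparr>"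

text \<open>The distance is set to \<open>0\<close> off the carrier because \<^locale>\<open>Metric_space\<close> demands
  nonnegativity and symmetry on the whole type.\<close>

definition ndist :: "('k::real_or_complex, 'a) normed_structure \<Rightarrow> 'a \<Rightarrow> 'a \<Rightarrow> real" where
  "ndist M x y = (if x \<in> carr M \<and> y \<in> carr M then nnorm M (nadd M x (nscale M (- 1) y)) else 0)"

definition ntopology :: "('k::real_or_complex, 'a) normed_structure \<Rightarrow> 'a topology" where
  "ntopology M = Metric_space.mtopology (carr M) (ndist M)"

definition linear_between ::
    "('k, 'a) normed_structure \<Rightarrow> ('k, 'b) normed_structure \<Rightarrow> ('a \<Rightarrow> 'b) \<Rightarrow> bool" where
  "linear_between M N T \<longleftrightarrow> T \<in> carr M \<rightarrow> carr N \<and>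
     (\<forall>x\<in>carr M. \<forall>y\<in>carr M. T (nadd M x y) = nadd N (T x) (T y)) \<and>
     (\<forall>c. \<forall>x\<in>carr M. T (nscale M c x) = nscale N c (T x))"

definition linear_homeomorphism ::
    "('k::real_or_complex, 'a) normed_structure \<Rightarrow> ('k, 'b) normed_structure \<Rightarrow> ('a \<Rightarrow> 'b) \<Rightarrow> bool" where
  "linear_homeomorphism M N T \<longleftrightarrow>
     linear_between M N T \<and> homeomorphic_map (ntopology M) (ntopology N) T"

definition linearly_homeomorphic ::
    "('k::real_or_complex, 'a) normed_structure \<Rightarrow> ('k, 'b) normed_structure \<Rightarrow> bool" where
  "linearly_homeomorphic M N \<longleftrightarrow> (\<exists>T. linear_homeomorphism M N T)"

definition compact_operator ::
    "('k::real_or_complex, 'a) normed_structure \<Rightarrow> ('k, 'b) normed_structure \<Rightarrow> ('a \<Rightarrow> 'b) \<Rightarrow> bool" where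
  "compact_operator M N T \<longleftrightarrow> linear_between M N T \<and>
     (\<exists>K. compactin (ntopology N) K \<and> T ` {x \<in> carr M. nnorm M x \<le> 1} \<subseteq> K)"

definition operator_norm ::
    "('k, 'a) normed_structure \<Rightarrow> ('k, 'b) normed_structure \<Rightarrow> ('a \<Rightarrow> 'b) \<Rightarrow> ennreal" where
  "operator_norm M N T = (SUP x\<in>{x \<in> carr M. nnorm M x \<le> 1}. ennreal (nnorm N (T x)))"

text \<open>The Banach--Mazur distance; it is \<open>\<infinity>\<close> for spaces that are not isomorphic.\<close>

definition banach_mazur ::
    "('k::real_or_complex, 'a) normed_structure \<Rightarrow> ('k, 'b) normed_structure \<Rightarrow> ennreal" where
  "banach_mazur M N = (INF T\<in>{T. linear_homeomorphism M N T}.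
     operator_norm M N T * operator_norm N M (inv_into (carr M) T))"

definition script_L_space ::
    "real \<Rightarrow> ('k::real_or_complex \<Rightarrow> 'x::real_normed_vector \<Rightarrow> 'x) \<Rightarrow> bool" where
  "script_L_space p s \<longleftrightarrow> (\<exists>l::real. l \<ge> 1 \<and>
     (\<forall>M. module.subspace s M \<and> finite_dimensional s M \<longrightarrow>
       (\<exists>N. module.subspace s N \<and> finite_dimensional s N \<and> M \<subseteq> N \<and>
         banach_mazur (subspace_structure s N)
           (ell p (vector_space.dim s N) :: ('k, nat \<Rightarrow> 'k) normed_structure) \<le> ennreal l)))"

subsection \<open>Local Banach spaces\<close>

definition seminorm :: "('k::real_or_complex \<Rightarrow> 'e::ab_group_add \<Rightarrow> 'e) \<Rightarrow> ('e \<Rightarrow> real) \<Rightarrow> bool" where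
  "seminorm s p \<longleftrightarrow> (\<forall>x y. p (x + y) \<le> p x + p y) \<and> (\<forall>a x. p (s a x) = norm a * p x)"

definition continuous_seminorm ::
    "('k::real_or_complex \<Rightarrow> 'e::{ab_group_add, topological_space} \<Rightarrow> 'e) \<Rightarrow> ('e \<Rightarrow> real) \<Rightarrow> bool" where
  "continuous_seminorm s p \<longleftrightarrow> seminorm s p \<and> continuous_on UNIV p"

definition seminorm_Cauchy :: "('e::ab_group_add \<Rightarrow> real) \<Rightarrow> (nat \<Rightarrow> 'e) \<Rightarrow> bool" where
  "seminorm_Cauchy p x \<longleftrightarrow> (\<forall>e>0. \<exists>N. \<forall>m\<ge>N. \<forall>n\<ge>N. p (x m - x n) < e)"

definition null_rel :: "('e::ab_group_add \<Rightarrow> real) \<Rightarrow> ((nat \<Rightarrow> 'e) \<times> (nat \<Rightarrow> 'e)) set" where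
  "null_rel p = {(x, y). seminorm_Cauchy p x \<and> seminorm_Cauchy p y \<and> (\<lambda>n. p (x n - y n)) \<longlonglongrightarrow> 0}"

text \<open>
  The completion of the quotient of \<open>E\<close> by the kernel of \<open>p\<close>, as the space of Cauchy sequences
  modulo null sequences. The sequences are taken in \<open>E\<close> rather than in the quotient, since both
  being Cauchy and being null depend only on the cosets of the terms; the constant sequences
  of \<open>x\<close> and \<open>y\<close> define the same element iff \<open>p (x - y) = 0\<close>. That this is the
  completion is verified below.
\<close>

definition local_banach ::
    "('k::real_or_complex \<Rightarrow> 'e::ab_group_add \<Rightarrow> 'e) \<Rightarrow> ('e \<Rightarrow> real) \<Rightarrow>
     ('k, (nat \<Rightarrow> 'e) set) normed_structure" where
  "local_banach s p = \<lparr>carr = {x. seminorm_Cauchy p x} // null_rel p,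
     nadd = (\<lambda>A B. \<Union>x\<in>A. \<Union>y\<in>B. null_rel p `` {\<lambda>n. x n + y n}),
     nscale = (\<lambda>c A. \<Union>x\<in>A. null_rel p `` {\<lambda>n. s c (x n)}),
     nnorm = (\<lambda>A. the_elem (\<Union>x\<in>A. {lim (\<lambda>n. p (x n))}))\<rparr>"

definition local_embedding :: "('e::ab_group_add \<Rightarrow> real) \<Rightarrow> 'e \<Rightarrow> (nat \<Rightarrow> 'e) set" where
  "local_embedding p x = null_rel p `` {\<lambda>_. x}"

text \<open>The canonical map from the local Banach space of some \<open>q \<ge> p\<close> to the one of \<open>p\<close>.\<close>

definition canonical_map ::
    "('e::ab_group_add \<Rightarrow> real) \<Rightarrow> (nat \<Rightarrow> 'e) set \<Rightarrow> (nat \<Rightarrow> 'e) set" where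
  "canonical_map p A = (\<Union>x\<in>A. null_rel p `` {x})"

definition schwartz_space ::
    "('k::real_or_complex \<Rightarrow> 'e::{ab_group_add, topological_space} \<Rightarrow> 'e) \<Rightarrow> bool" where
  "schwartz_space s \<longleftrightarrow> (\<forall>p. continuous_seminorm s p \<longrightarrow>
     (\<exists>q. continuous_seminorm s q \<and> (\<forall>x. p x \<le> q x) \<and>
       compact_operator (local_banach s q) (local_banach s p) (canonical_map p)))"

definition defining_system ::
    "('k::real_or_complex \<Rightarrow> 'e::{ab_group_add, topological_space} \<Rightarrow> 'e) \<Rightarrow>
     'i set \<Rightarrow> ('i \<Rightarrow> 'e \<Rightarrow> real) \<Rightarrow> bool" where
  "defining_system s A P \<longleftrightarrow> (\<forall>\<alpha>\<in>A. continuous_seminorm s (P \<alpha>)) \<and>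
     (\<forall>q. continuous_seminorm s q \<longrightarrow> (\<exists>\<alpha>\<in>A. \<exists>C. \<forall>x. q x \<le> C * P \<alpha> x))"

subsection \<open>The local Banach space is the completion of the quotient\<close>

locale seminormed = vector_space s
  for s :: "'k::real_or_complex \<Rightarrow> 'e::ab_group_add \<Rightarrow> 'e" +
  fixes p :: "'e \<Rightarrow> real"
  assumes seminorm: "seminorm s p"
begin

lemma p_add: "p (x + y) \<le> p x + p y"
  and p_scale: "p (s a x) = norm a * p x"
  using seminorm by (auto simp: seminorm_def)

lemma p_zero [simp]: "p 0 = 0"
  using p_scale[of 0 0] by simp

lemma p_minus [simp]: "p (- x) = p x"
  using p_scale[of "- 1" x] by (simp add: scale_minus_left)

lemma p_nonneg: "0 \<le> p x"
  using p_add[of x "- x"] by simp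

lemma p_minus_commute: "p (x - y) = p (y - x)"
  using p_minus[of "x - y"] by simp

lemma p_triangle: "p (x - z) \<le> p (x - y) + p (y - z)"
  using p_add[of "x - y" "y - z"] by simp

lemma p_diff: "\<bar>p x - p y\<bar> \<le> p (x - y)"
  using p_triangle[of x 0 y] p_triangle[of y 0 x] p_minus_commute[of x y] by simp

lemma Cauchy_const: "seminorm_Cauchy p (\<lambda>_. x)"
  by (simp add: seminorm_Cauchy_def)

lemma Cauchy_add:
  assumes "seminorm_Cauchy p x" "seminorm_Cauchy p y"
  shows "seminorm_Cauchy p (\<lambda>n. x n + y n)"
  unfolding seminorm_Cauchy_def
proof (intro allI impI)
  fix e :: real assume "e > 0"
  then obtain N1 N2 where N: "\<forall>m\<ge>N1. \<forall>n\<ge>N1. p (x m - x n) < e/2" "\<forall>m\<ge>N2. \<forall>n\<ge>N2. p (y m - y n) < e/2"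
    using assms unfolding seminorm_Cauchy_def by (meson half_gt_zero)
  have "p (x m + y m - (x n + y n)) < e" if "m \<ge> max N1 N2" "n \<ge> max N1 N2" for m n
  proof -
    have "p (x m - x n) < e/2" "p (y m - y n) < e/2" using N that by auto
    then show ?thesis using p_add[of "x m - x n" "y m - y n"] by (simp add: algebra_simps)
  qed
  then show "\<exists>N. \<forall>m\<ge>N. \<forall>n\<ge>N. p (x m + y m - (x n + y n)) < e" by blast
qed

lemma Cauchy_scale:
  assumes "seminorm_Cauchy p x"
  shows "seminorm_Cauchy p (\<lambda>n. s c (x n))"
  unfolding seminorm_Cauchy_def
proof (intro allI impI)
  fix e :: real assume e: "e > 0"
  have pos: "norm c + 1 > 0" by (simp add: add_nonneg_pos)
  then obtain N where N: "\<forall>m\<ge>N. \<forall>n\<ge>N. p (x m - x n) < e / (norm c + 1)"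
    using assms e unfolding seminorm_Cauchy_def by (meson divide_pos_pos)
  have "p (s c (x m) - s c (x n)) < e" if "m \<ge> N" "n \<ge> N" for m n
  proof -
    have "p (s c (x m) - s c (x n)) = norm c * p (x m - x n)"
      by (metis p_scale scale_right_diff_distrib)
    also have "\<dots> \<le> (norm c + 1) * p (x m - x n)" by (simp add: mult_right_mono p_nonneg)
    also have "\<dots> < e" using N that pos by (simp add: field_simps)
    finally show ?thesis .
  qed
  then show "\<exists>N. \<forall>m\<ge>N. \<forall>n\<ge>N. p (s c (x m) - s c (x n)) < e" by blast
qed

lemma null_rel_iff: "(x, y) \<in> null_rel p \<longleftrightarrow>
    seminorm_Cauchy p x \<and> seminorm_Cauchy p y \<and> (\<lambda>n. p (x n - y n)) \<longlonglongrightarrow> 0"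
  by (simp add: null_rel_def)

lemma tendsto_p_le:
  assumes "\<And>n. p (z n) \<le> f n" "f \<longlonglongrightarrow> 0"
  shows "(\<lambda>n. p (z n)) \<longlonglongrightarrow> 0"
  by (rule tendsto_sandwich[OF _ _ tendsto_const assms(2)]) (auto simp: assms p_nonneg)

lemma equiv_null_rel: "equiv {x. seminorm_Cauchy p x} (null_rel p)"
proof (rule equivI)
  show "refl_on {x. seminorm_Cauchy p x} (null_rel p)"
    by (auto simp: refl_on_def null_rel_def)
  show "sym (null_rel p)"
    by (auto simp: sym_def null_rel_def p_minus_commute)
  show "trans (null_rel p)"
  proof (rule transI)
    fix x y z assume xy: "(x, y) \<in> null_rel p" and yz: "(y, z) \<in> null_rel p"
    have "(\<lambda>n. p (x n - z n)) \<longlonglongrightarrow> 0"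
      using xy yz p_triangle
      by (intro tendsto_p_le[of _ "\<lambda>n. p (x n - y n) + p (y n - z n)"])
        (auto simp: null_rel_iff intro: tendsto_eq_intros)
    then show "(x, z) \<in> null_rel p" using xy yz by (simp add: null_rel_iff)
  qed
qed (auto simp: null_rel_def)

abbreviation "Ep \<equiv> local_banach s p"
abbreviation cls where "cls x \<equiv> null_rel p `` {x}"

lemma carr_local_banach: "carr Ep = {x. seminorm_Cauchy p x} // null_rel p"
  by (simp add: local_banach_def)

lemma cls_in_carr: "seminorm_Cauchy p x \<Longrightarrow> cls x \<in> carr Ep"
  by (simp add: carr_local_banach quotientI)

lemma carr_cases:
  assumes "A \<in> carr Ep"
  obtains x where "seminorm_Cauchy p x" "A = cls x"
  using assms by (auto simp: carr_local_banach elim: quotientE)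

lemma cls_eq_iff:
  assumes "seminorm_Cauchy p x" "seminorm_Cauchy p y"
  shows "cls x = cls y \<longleftrightarrow> (\<lambda>n. p (x n - y n)) \<longlonglongrightarrow> 0"
  using eq_equiv_class_iff[OF equiv_null_rel, of x y] assms by (simp add: null_rel_iff)

lemma nadd_cls:
  assumes "seminorm_Cauchy p x" "seminorm_Cauchy p y"
  shows "nadd Ep (cls x) (cls y) = cls (\<lambda>n. x n + y n)"
proof -
  have "cls (\<lambda>n. x' n + y' n) = cls (\<lambda>n. x'' n + y'' n)"
    if "(x', x'') \<in> null_rel p" "(y', y'') \<in> null_rel p" for x' y' x'' y''
  proof -
    have "p (x' n + y' n - (x'' n + y'' n)) \<le> p (x' n - x'' n) + p (y' n - y'' n)" for n
      using p_add[of "x' n - x'' n" "y' n - y'' n"] by (simp add: algebra_simps)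
    then have "(\<lambda>n. p (x' n + y' n - (x'' n + y'' n))) \<longlonglongrightarrow> 0"
      using that by (intro tendsto_p_le[of _ "\<lambda>n. p (x' n - x'' n) + p (y' n - y'' n)"])
        (auto simp: null_rel_iff intro: tendsto_eq_intros)
    then show ?thesis using that by (subst cls_eq_iff) (auto simp: null_rel_iff Cauchy_add)
  qed
  then have "congruent2 (null_rel p) (null_rel p) (\<lambda>x y. cls (\<lambda>n. x n + y n))"
    by (intro congruent2I')
  from UN_equiv_class2[OF equiv_null_rel equiv_null_rel this, of x y] assms
  show ?thesis by (simp add: local_banach_def)
qed

lemma nscale_cls:
  assumes "seminorm_Cauchy p x"
  shows "nscale Ep c (cls x) = cls (\<lambda>n. s c (x n))"
proof -
  have "cls (\<lambda>n. s c (x' n)) = cls (\<lambda>n. s c (x'' n))" if "(x', x'') \<in> null_rel p" for x' x''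
  proof -
    have "p (s c (x' n) - s c (x'' n)) = norm c * p (x' n - x'' n)" for n
      by (metis p_scale scale_right_diff_distrib)
    then have "(\<lambda>n. p (s c (x' n) - s c (x'' n))) \<longlonglongrightarrow> 0"
      using that by (auto simp: null_rel_iff intro: tendsto_eq_intros)
    then show ?thesis using that by (subst cls_eq_iff) (auto simp: null_rel_iff Cauchy_scale)
  qed
  then have "congruent (null_rel p) (\<lambda>x. cls (\<lambda>n. s c (x n)))" by (auto simp: congruent_def)
  from UN_equiv_class[OF equiv_null_rel this, of x] assms
  show ?thesis by (simp add: local_banach_def)
qed

lemma convergent_p:
  assumes "seminorm_Cauchy p x"
  shows "convergent (\<lambda>n. p (x n))"
proof -
  have "Cauchy (\<lambda>n. p (x n))"
    unfolding Cauchy_def dist_real_def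
  proof (intro allI impI)
    fix e :: real assume "e > 0"
    then obtain N where "\<forall>m\<ge>N. \<forall>n\<ge>N. p (x m - x n) < e"
      using assms unfolding seminorm_Cauchy_def by meson
    then show "\<exists>M. \<forall>m\<ge>M. \<forall>n\<ge>M. \<bar>p (x m) - p (x n)\<bar> < e" by (meson p_diff le_less_trans)
  qed
  then show ?thesis by (rule real_Cauchy_convergent)
qed

lemma nnorm_cls:
  assumes "seminorm_Cauchy p x"
  shows "(\<lambda>n. p (x n)) \<longlonglongrightarrow> nnorm Ep (cls x)"
proof -
  have "lim (\<lambda>n. p (x' n)) = lim (\<lambda>n. p (x'' n))" if "(x', x'') \<in> null_rel p" for x' x''
  proof -
    have "(\<lambda>n. p (x' n) - p (x'' n)) \<longlonglongrightarrow> 0"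
      by (rule Lim_null_comparison[of _ "\<lambda>n. p (x' n - x'' n)"]) (use that p_diff in \<open>auto simp: null_rel_iff\<close>)
    moreover have "(\<lambda>n. p (x'' n)) \<longlonglongrightarrow> lim (\<lambda>n. p (x'' n))"
      using that convergent_p by (simp add: null_rel_iff convergent_LIMSEQ_iff)
    ultimately have "(\<lambda>n. p (x' n)) \<longlonglongrightarrow> lim (\<lambda>n. p (x'' n))"
      using tendsto_add by fastforce
    then show ?thesis by (rule limI)
  qed
  then have "congruent (null_rel p) (\<lambda>x. {lim (\<lambda>n. p (x n))})" by (auto simp: congruent_def)
  from UN_equiv_class[OF equiv_null_rel this, of x] assms
  have "nnorm Ep (cls x) = lim (\<lambda>n. p (x n))" by (simp add: local_banach_def)
  then show ?thesis using convergent_p[OF assms] by (simp add: convergent_LIMSEQ_iff)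
qed

lemma ndist_cls:
  assumes "seminorm_Cauchy p x" "seminorm_Cauchy p y"
  shows "(\<lambda>n. p (x n - y n)) \<longlonglongrightarrow> ndist Ep (cls x) (cls y)"
proof -
  have m: "seminorm_Cauchy p (\<lambda>n. - y n)"
    using Cauchy_scale[OF assms(2), of "- 1"] by (simp add: scale_minus_left)
  have "ndist Ep (cls x) (cls y) = nnorm Ep (cls (\<lambda>n. x n - y n))"
    using assms m by (simp add: ndist_def cls_in_carr nscale_cls nadd_cls scale_minus_left)
  then show ?thesis using nnorm_cls[OF Cauchy_add[OF assms(1) m]] by simp
qed

lemma local_embedding_in_carr: "local_embedding p x \<in> carr Ep"
  by (simp add: local_embedding_def cls_in_carr Cauchy_const)

lemma local_embedding_linear:
  "local_embedding p (x + y) = nadd Ep (local_embedding p x) (local_embedding p y)"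
  "local_embedding p (s c x) = nscale Ep c (local_embedding p x)"
  by (simp_all add: local_embedding_def nadd_cls nscale_cls Cauchy_const)

lemma local_embedding_isometric: "nnorm Ep (local_embedding p x) = p x"
  using nnorm_cls[OF Cauchy_const, of x] by (simp add: local_embedding_def LIMSEQ_const_iff)

lemma local_embedding_eq_iff: "local_embedding p x = local_embedding p y \<longleftrightarrow> p (x - y) = 0"
  by (simp add: local_embedding_def cls_eq_iff Cauchy_const LIMSEQ_const_iff)

lemma Metric_space_local_banach: "Metric_space (carr Ep) (ndist Ep)"
proof
  fix A B
  show "0 \<le> ndist Ep A B"
  proof (cases "A \<in> carr Ep \<and> B \<in> carr Ep")
    case True
    then obtain x y where "seminorm_Cauchy p x" "A = cls x" "seminorm_Cauchy p y" "B = cls y"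
      by (metis carr_cases)
    then show ?thesis using ndist_cls[of x y] by (auto intro!: LIMSEQ_le_const p_nonneg)
  qed (auto simp: ndist_def)
  show "ndist Ep A B = ndist Ep B A"
  proof (cases "A \<in> carr Ep \<and> B \<in> carr Ep")
    case True
    then obtain x y where *: "seminorm_Cauchy p x" "A = cls x" "seminorm_Cauchy p y" "B = cls y"
      by (metis carr_cases)
    then show ?thesis using ndist_cls[of x y] ndist_cls[of y x]
      by (metis (no_types, lifting) LIMSEQ_unique ext p_minus_commute)
  qed (auto simp: ndist_def)
next
  fix A B assume "A \<in> carr Ep" "B \<in> carr Ep"
  then obtain x y where *: "seminorm_Cauchy p x" "A = cls x" "seminorm_Cauchy p y" "B = cls y"
    by (metis carr_cases)
  show "ndist Ep A B = 0 \<longleftrightarrow> A = B"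
    using * ndist_cls[of x y] cls_eq_iff[of x y] LIMSEQ_unique by metis
next
  fix A B C assume "A \<in> carr Ep" "B \<in> carr Ep" "C \<in> carr Ep"
  then obtain x y z where *: "seminorm_Cauchy p x" "A = cls x" "seminorm_Cauchy p y" "B = cls y"
    "seminorm_Cauchy p z" "C = cls z"
    by (metis carr_cases)
  show "ndist Ep A C \<le> ndist Ep A B + ndist Ep B C"
    using * p_triangle
    by (auto intro!: LIMSEQ_le[OF ndist_cls[of x z] tendsto_add[OF ndist_cls[of x y] ndist_cls[of y z]]])
qed

lemma ndist_local_embedding_le:
  assumes "seminorm_Cauchy p x" "\<And>n. n \<ge> N \<Longrightarrow> p (x n - y) \<le> e"
  shows "ndist Ep (cls x) (local_embedding p y) \<le> e"
  unfolding local_embedding_def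
  by (rule LIMSEQ_le_const2[OF ndist_cls[OF assms(1) Cauchy_const]]) (use assms(2) in blast)

lemma local_embedding_dense:
  assumes "A \<in> carr Ep" "e > 0"
  shows "\<exists>y. ndist Ep A (local_embedding p y) < e"
proof -
  obtain x where x: "seminorm_Cauchy p x" "A = cls x" using assms(1) by (rule carr_cases)
  obtain N where "\<forall>m\<ge>N. \<forall>n\<ge>N. p (x m - x n) < e / 2"
    using x(1) assms(2) unfolding seminorm_Cauchy_def by (meson half_gt_zero)
  then have "ndist Ep A (local_embedding p (x N)) \<le> e / 2"
    unfolding x(2) by (intro ndist_local_embedding_le[OF x(1), of N]) (auto intro: less_imp_le)
  then show ?thesis using assms(2) by (intro exI[of _ "x N"]) auto
qed

lemma ndist_local_embedding: "ndist Ep (local_embedding p x) (local_embedding p y) = p (x - y)"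
  using ndist_cls[OF Cauchy_const Cauchy_const, of x y]
  by (simp add: local_embedding_def LIMSEQ_const_iff)

lemma mcomplete_local_banach: "Metric_space.mcomplete (carr Ep) (ndist Ep)"
proof -
  interpret Metric_space "carr Ep" "ndist Ep" by (rule Metric_space_local_banach)
  show ?thesis unfolding mcomplete_def
  proof (intro allI impI)
    fix \<sigma> assume \<sigma>: "MCauchy \<sigma>"
    then have carr: "\<sigma> n \<in> carr Ep" for n by (auto simp: MCauchy_def)
    have "\<exists>y. ndist Ep (\<sigma> n) (local_embedding p y) < inverse (real (Suc n))" for n
      by (rule local_embedding_dense[OF carr]) simp
    then obtain y where y: "\<And>n. ndist Ep (\<sigma> n) (local_embedding p (y n)) < inverse (real (Suc n))"
      by metis
    have small: "\<exists>N. \<forall>n\<ge>N. ndist Ep (\<sigma> n) (local_embedding p (y n)) < e" if "e > 0" for e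
    proof -
      obtain N where N: "inverse (real (Suc N)) < e" using reals_Archimedean[OF \<open>e > 0\<close>] by auto
      have "ndist Ep (\<sigma> n) (local_embedding p (y n)) < e" if "n \<ge> N" for n
      proof -
        have "inverse (real (Suc n)) \<le> inverse (real (Suc N))" using that by (simp add: field_simps)
        then show ?thesis using y[of n] N by linarith
      qed
      then show ?thesis by blast
    qed
    have yC: "seminorm_Cauchy p y"
      unfolding seminorm_Cauchy_def
    proof (intro allI impI)
      fix e :: real assume "e > 0"
      then have e3: "e / 3 > 0" by simp
      obtain N1 where N1: "\<forall>n\<ge>N1. ndist Ep (\<sigma> n) (local_embedding p (y n)) < e / 3"
        using small[OF e3] by blast
      obtain N2 where N2: "\<forall>m n. N2 \<le> m \<longrightarrow> N2 \<le> n \<longrightarrow> ndist Ep (\<sigma> m) (\<sigma> n) < e / 3"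
        using \<sigma> e3 unfolding MCauchy_def by blast
      have "p (y m - y n) < e" if "m \<ge> max N1 N2" "n \<ge> max N1 N2" for m n
      proof -
        let ?i = "local_embedding p"
        have "p (y m - y n) = ndist Ep (?i (y m)) (?i (y n))" by (simp add: ndist_local_embedding)
        also have "\<dots> \<le> ndist Ep (?i (y m)) (\<sigma> m) + ndist Ep (\<sigma> m) (?i (y n))"
          by (intro triangle local_embedding_in_carr carr)
        also have "\<dots> \<le> ndist Ep (?i (y m)) (\<sigma> m) + (ndist Ep (\<sigma> m) (\<sigma> n) + ndist Ep (\<sigma> n) (?i (y n)))"
          by (intro add_left_mono triangle local_embedding_in_carr carr)
        also have "\<dots> < e"
        proof -
          have "ndist Ep (?i (y m)) (\<sigma> m) < e / 3" using N1 that by (metis commute max.boundedE)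
          moreover have "ndist Ep (\<sigma> m) (\<sigma> n) < e / 3" using N2 that by auto
          moreover have "ndist Ep (\<sigma> n) (?i (y n)) < e / 3" using N1 that by auto
          ultimately show ?thesis by linarith
        qed
        finally show ?thesis .
      qed
      then show "\<exists>N. \<forall>m\<ge>N. \<forall>n\<ge>N. p (y m - y n) < e" by blast
    qed
    have "\<exists>N. \<forall>n\<ge>N. \<sigma> n \<in> carr Ep \<and> ndist Ep (\<sigma> n) (cls y) < e" if e: "e > 0" for e
    proof -
      have e2: "e / 2 > 0" "e / 4 > 0" using e by auto
      obtain N1 where N1: "\<forall>n\<ge>N1. ndist Ep (\<sigma> n) (local_embedding p (y n)) < e / 2"
        using small[OF e2(1)] by blast
      obtain N2 where N2: "\<forall>m\<ge>N2. \<forall>n\<ge>N2. p (y m - y n) < e / 4"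
        using yC e2(2) unfolding seminorm_Cauchy_def by blast
      have "ndist Ep (\<sigma> n) (cls y) < e" if n: "n \<ge> max N1 N2" for n
      proof -
        have "ndist Ep (cls y) (local_embedding p (y n)) \<le> e / 4"
          using N2 n by (intro ndist_local_embedding_le[OF yC, of N2]) (auto intro: less_imp_le)
        then have "ndist Ep (local_embedding p (y n)) (cls y) \<le> e / 4" by (simp add: commute)
        moreover have "ndist Ep (\<sigma> n) (local_embedding p (y n)) < e / 2" using N1 n by auto
        moreover have "ndist Ep (\<sigma> n) (cls y) \<le>
            ndist Ep (\<sigma> n) (local_embedding p (y n)) + ndist Ep (local_embedding p (y n)) (cls y)"
          by (intro triangle local_embedding_in_carr carr cls_in_carr yC)
        ultimately show ?thesis using e by linarith
      qed
      then show ?thesis using carr by blast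
    qed
    then have "limitin mtopology \<sigma> (cls y) sequentially"
      unfolding limitin_metric eventually_sequentially using cls_in_carr[OF yC] by blast
    then show "\<exists>x. limitin mtopology \<sigma> x sequentially" by blast
  qed
qed

lemma canonical_map_cls:
  assumes q: "seminormed s q" "\<And>x. p x \<le> q x" and x: "seminorm_Cauchy q x"
  shows "canonical_map p (null_rel q `` {x}) = cls x" and "seminorm_Cauchy p x"
proof -
  interpret q: seminormed s q by (rule q)
  have mono: "seminorm_Cauchy p y" if "seminorm_Cauchy q y" for y
    using that q(2) unfolding seminorm_Cauchy_def by (meson le_less_trans)
  then show "seminorm_Cauchy p x" using x .
  have "cls y = cls z" if yz: "(y, z) \<in> null_rel q" for y z
  proof -
    have "(\<lambda>n. p (y n - z n)) \<longlonglongrightarrow> 0"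
      using yz q(2) by (intro tendsto_p_le[of _ "\<lambda>n. q (y n - z n)"]) (auto simp: q.null_rel_iff)
    then show ?thesis using yz mono by (subst cls_eq_iff) (auto simp: q.null_rel_iff)
  qed
  then have "congruent (null_rel q) (\<lambda>y. cls y)" by (auto simp: congruent_def)
  from UN_equiv_class[OF q.equiv_null_rel this, of x] x
  show "canonical_map p (null_rel q `` {x}) = cls x" by (simp add: canonical_map_def)
qed

lemma canonical_map_local_embedding:
  assumes "seminormed s q" "\<And>x. p x \<le> q x"
  shows "canonical_map p (local_embedding q x) = local_embedding p x"
  using canonical_map_cls[OF assms seminormed.Cauchy_const[OF assms(1)]]
  by (simp add: local_embedding_def)

end

end

theory Submission
  imports Defs
begin

text \<open>
  The theorem follows from a statement about single operators. Let \<open>P\<close> be one of the given seminorms. As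
  \<open>E\<close> is a Schwartz space, some bigger given seminorm \<open>P'\<close> makes the canonical map of the local Banach spaces
  compact, and both local Banach spaces are isomorphic to \<open>X\<close>. This amounts to operators \<open>u\<close> and \<open>v\<close>
  from \<open>E\<close> to \<open>X\<close> with dense range that represent \<open>P\<close> and \<open>P'\<close>, such that \<open>u\<close> maps the unit ball
  of \<open>v\<close> into a compact set. If \<open>R\<close> is an operator from \<open>E\<close> to \<open>Y\<close> with dense range and
  \<open>\<parallel>u x\<parallel> \<le> C * \<parallel>R x\<parallel>\<close>, \<open>\<parallel>R x\<parallel> \<le> C * \<parallel>v x\<parallel>\<close>, then \<open>\<parallel>R x\<parallel>\<close> is a continuous seminorm that
  dominates \<open>P\<close> up to a constant, and its local Banach space, the closure of the range of \<open>R\<close>, is \<open>Y\<close>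
  (\<open>local_banach_of_dense_range\<close>). The operator \<open>R\<close> is constructed in \<open>dense_range_operator\<close>.

  The construction rests on two facts about an infinite dimensional \<open>\<L>\<^sub>p\<close>-space. It has the bounded
  approximation property through finite dimensional \<open>\<ell>\<^sub>p\<close> spaces (\<open>approximation_property\<close>), whence a
  compact operator into \<open>X\<close> is a rapidly convergent series of operators that factor through such spaces
  (\<open>compact_set_expansion\<close>). And it contains copies of \<open>\<ell>\<^sub>p\<close> of every finite dimension that are complemented
  with a common constant and in general position to any finite rank projection
  (\<open>biorthogonal_block_exists\<close>), so that these intermediate spaces also fit into \<open>Y\<close> one beside the other.

  Both facts are usually derived from a complemented embedding into \<open>L\<^sub>p\<close>. Here they come from finite
  dimensional computations that are uniform in the dimension: an averaging operator for the first one
  (\<open>conditional_expectation_lp\<close>), a trace estimate for the second one (\<open>large_trace\<close>). They are carried over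
  to the whole space by taking cluster points of operators defined on larger and larger finite
  dimensional subspaces (\<open>extension_from_finite_sets\<close>).
\<close>

section \<open>Norms of finite sequences\<close>

definition lpn :: "real \<Rightarrow> 'i set \<Rightarrow> ('i \<Rightarrow> 'a::real_normed_vector) \<Rightarrow> real" where
  "lpn p I a = (\<Sum>i\<in>I. norm (a i) powr p) powr (1 / p)"

locale lp_exponent =
  fixes p :: real
  assumes p_gt_1: "1 < p"
begin

lemma lpn_nonneg [simp]: "0 \<le> lpn p I a"
  by (simp add: lpn_def)

lemma lpn_powr: "lpn p I a powr p = (\<Sum>i\<in>I. norm (a i) powr p)"
  using p_gt_1 by (simp add: lpn_def powr_powr sum_nonneg)

lemma lpn_le_iff:
  assumes "0 \<le> C"
  shows "lpn p I a \<le> C \<longleftrightarrow> (\<Sum>i\<in>I. norm (a i) powr p) \<le> C powr p"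
proof
  assume "lpn p I a \<le> C"
  then show "(\<Sum>i\<in>I. norm (a i) powr p) \<le> C powr p"
    unfolding lpn_powr[symmetric] using p_gt_1 by (intro powr_mono2) auto
next
  assume "(\<Sum>i\<in>I. norm (a i) powr p) \<le> C powr p"
  then show "lpn p I a \<le> C"
    unfolding lpn_powr[symmetric] using p_gt_1 assms powr_less_mono2[of p C "lpn p I a"] by linarith
qed

lemma lpn_cong: "(\<And>i. i \<in> I \<Longrightarrow> norm (a i) = norm (b i)) \<Longrightarrow> lpn p I a = lpn p I b"
  by (simp add: lpn_def)

lemma lpn_mono:
  assumes "finite J" "I \<subseteq> J" "\<And>i. i \<in> I \<Longrightarrow> norm (a i) \<le> norm (b i)"
  shows "lpn p I a \<le> lpn p J b"
proof -
  have "(\<Sum>i\<in>I. norm (a i) powr p) \<le> (\<Sum>i\<in>I. norm (b i) powr p)"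
    using assms p_gt_1 by (intro sum_mono powr_mono2) auto
  also have "\<dots> \<le> (\<Sum>i\<in>J. norm (b i) powr p)"
    using assms by (intro sum_mono2) auto
  finally show ?thesis unfolding lpn_def using p_gt_1 by (intro powr_mono2) (auto intro: sum_nonneg)
qed

lemma norm_le_lpn:
  assumes "finite I" "i \<in> I"
  shows "norm (a i) \<le> lpn p I a"
proof -
  have "norm (a i) = lpn p {i} a" using p_gt_1 by (simp add: lpn_def powr_powr)
  also have "\<dots> \<le> lpn p I a" using assms by (intro lpn_mono) auto
  finally show ?thesis .
qed

lemma lpn_scale:
  fixes a :: "'i \<Rightarrow> 'a::real_normed_div_algebra"
  shows "lpn p I (\<lambda>i. c * a i) = norm c * lpn p I a"
proof -
  have "(\<Sum>i\<in>I. norm (c * a i) powr p) = norm c powr p * (\<Sum>i\<in>I. norm (a i) powr p)"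
    by (simp add: norm_mult powr_mult sum_distrib_left)
  then show ?thesis using p_gt_1 by (simp add: lpn_def powr_mult sum_nonneg powr_powr)
qed

lemma lpn_reindex: "inj_on f I \<Longrightarrow> lpn p (f ` I) a = lpn p I (\<lambda>i. a (f i))"
  by (simp add: lpn_def sum.reindex)

lemma lpn_eq_0: "lpn p I a = 0 \<Longrightarrow> finite I \<Longrightarrow> i \<in> I \<Longrightarrow> a i = 0"
  using norm_le_lpn[of I i a] by simp

lemma lpn_le_card:
  assumes "finite I" "0 \<le> \<eta>" "\<And>i. i \<in> I \<Longrightarrow> norm (a i) \<le> \<eta>"
  shows "lpn p I a \<le> real (card I) * \<eta>"
proof (cases "I = {}")
  case False
  then have c: "1 \<le> real (card I)" using assms(1) by (simp add: Suc_leI card_gt_0_iff)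
  have "(\<Sum>i\<in>I. norm (a i) powr p) \<le> real (card I) * \<eta> powr p"
    using assms p_gt_1 by (intro sum_bounded_above powr_mono2) auto
  also have "\<dots> \<le> real (card I) powr p * \<eta> powr p"
    using c p_gt_1 powr_mono[of 1 p "real (card I)"] by (intro mult_right_mono) auto
  finally show ?thesis using assms by (subst lpn_le_iff) (auto simp: powr_mult)
qed (simp add: lpn_def)

lemma sum_norm_le_lpn:
  assumes "finite I"
  shows "(\<Sum>i\<in>I. norm (a i)) \<le> real (card I) * lpn p I a"
  by (rule sum_bounded_above) (simp add: norm_le_lpn assms)

text \<open>
  The exponents are arranged for the weights that norm a vector \<open>f\<close> of \<open>\<ell>\<^sub>p\<close>: these are
  of size \<open>\<bar>f\<bar>\<close> to the power \<open>p - 1\<close>. Normalise both sides and apply Young's inequality to each term.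
\<close>
lemma Hoelder_sum:
  fixes x y :: "'i \<Rightarrow> real"
  assumes "finite I" "\<And>i. i \<in> I \<Longrightarrow> 0 \<le> x i" "\<And>i. i \<in> I \<Longrightarrow> 0 \<le> y i"
  shows "(\<Sum>i\<in>I. x i powr (p - 1) * y i) \<le> lpn p I x powr (p - 1) * lpn p I y"
proof (cases "lpn p I x = 0 \<or> lpn p I y = 0")
  case True
  then have "x i powr (p - 1) * y i = 0" if "i \<in> I" for i
    using lpn_eq_0[where a=x and I=I and i=i] lpn_eq_0[where a=y and I=I and i=i] assms(1) that p_gt_1 by (metis mult_eq_0_iff powr_0)
  then have "(\<Sum>i\<in>I. x i powr (p - 1) * y i) = (\<Sum>i\<in>I. 0)" by (rule sum.cong[OF refl])
  then show ?thesis by simp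
next
  case False
  define X Y where "X = lpn p I x" and "Y = lpn p I y"
  have pos: "0 < X" "0 < Y" using False unfolding X_def Y_def by (metis less_eq_real_def lpn_nonneg)+
  define q where "q = p / (p - 1)"
  have q: "1 / q + 1 / p = 1" "0 < q" "0 < p" using p_gt_1 by (auto simp: q_def field_simps)
  have "(x i / X) powr (p - 1) * (y i / Y) \<le> (1 - 1 / p) * (x i / X) powr p + (1 / p) * (y i / Y) powr p"
    if "i \<in> I" for i
  proof -
    have "(x i / X) powr (p - 1) * (y i / Y)
        \<le> ((x i / X) powr (p - 1)) powr q / q + (y i / Y) powr p / p"
      using that assms pos p_gt_1 q by (intro Youngs_inequality) (auto simp: q_def)
    moreover have "((x i / X) powr (p - 1)) powr q = (x i / X) powr p"
      using p_gt_1 by (simp add: powr_powr q_def)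
    moreover have "1 - 1 / p = 1 / q" using q(1) by simp
    ultimately show ?thesis by simp
  qed
  then have "(\<Sum>i\<in>I. (x i / X) powr (p - 1) * (y i / Y)) \<le>
     (\<Sum>i\<in>I. (1 - 1 / p) * (x i / X) powr p + (1 / p) * (y i / Y) powr p)" by (rule sum_mono)
  also have "\<dots> = (1 - 1 / p) * (\<Sum>i\<in>I. (x i / X) powr p) + (1 / p) * (\<Sum>i\<in>I. (y i / Y) powr p)"
    by (simp add: sum.distrib sum_distrib_left)
  also have "(\<Sum>i\<in>I. (x i / X) powr p) = 1"
  proof -
    have "(\<Sum>i\<in>I. (x i / X) powr p) = (\<Sum>i\<in>I. norm (x i) powr p / X powr p)"
      using assms pos by (intro sum.cong) (auto simp: powr_divide)
    also have "\<dots> = 1" using pos by (simp only: sum_divide_distrib[symmetric] lpn_powr[symmetric]) (simp add: X_def)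
    finally show ?thesis .
  qed
  also have "(\<Sum>i\<in>I. (y i / Y) powr p) = 1"
  proof -
    have "(\<Sum>i\<in>I. (y i / Y) powr p) = (\<Sum>i\<in>I. norm (y i) powr p / Y powr p)"
      using assms pos by (intro sum.cong) (auto simp: powr_divide)
    also have "\<dots> = 1" using pos by (simp only: sum_divide_distrib[symmetric] lpn_powr[symmetric]) (simp add: Y_def)
    finally show ?thesis .
  qed
  finally have "(\<Sum>i\<in>I. (x i / X) powr (p - 1) * (y i / Y)) \<le> 1" by simp
  moreover have "(\<Sum>i\<in>I. (x i / X) powr (p - 1) * (y i / Y)) = (\<Sum>i\<in>I. x i powr (p - 1) * y i) / (X powr (p - 1) * Y)"
    unfolding sum_divide_distrib using assms pos by (intro sum.cong) (auto simp: powr_divide)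
  ultimately show ?thesis using pos by (simp add: X_def Y_def divide_le_eq)
qed

lemma lpn_triangle:
  fixes a b :: "'i \<Rightarrow> 'v::real_normed_vector"
  assumes "finite I"
  shows "lpn p I (\<lambda>i. a i + b i) \<le> lpn p I a + lpn p I b"
proof (cases "lpn p I (\<lambda>i. a i + b i) = 0")
  case True
  then show ?thesis using lpn_nonneg[of I a] lpn_nonneg[of I b] by simp
next
  case False
  define W where "W = lpn p I (\<lambda>i. a i + b i)"
  have W: "0 < W" using False lpn_nonneg[of I "\<lambda>i. a i + b i"] unfolding W_def by linarith
  have split: "norm (a i + b i) powr p \<le> norm (a i + b i) powr (p - 1) * norm (a i) + norm (a i + b i) powr (p - 1) * norm (b i)" for i
  proof -
    have "norm (a i + b i) powr p = norm (a i + b i) powr (p - 1) * norm (a i + b i)"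
      by (cases "a i + b i = 0") (auto simp: powr_diff)
    also have "\<dots> \<le> norm (a i + b i) powr (p - 1) * (norm (a i) + norm (b i))"
      by (intro mult_left_mono norm_triangle_ineq) simp
    finally show ?thesis by (simp add: distrib_left)
  qed
  have H: "(\<Sum>i\<in>I. norm (a i + b i) powr (p - 1) * norm (c i)) \<le> W powr (p - 1) * lpn p I c" for c :: "'i \<Rightarrow> 'v"
    using Hoelder_sum[OF assms, of "\<lambda>i. norm (a i + b i)" "\<lambda>i. norm (c i)"] by (simp add: W_def lpn_def)
  have "W powr (p - 1) * W = W powr p" using W by (simp add: powr_diff)
  also have "\<dots> = (\<Sum>i\<in>I. norm (a i + b i) powr p)" unfolding W_def by (rule lpn_powr)
  also have "\<dots> \<le> W powr (p - 1) * lpn p I a + W powr (p - 1) * lpn p I b"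
    by (rule order_trans[OF sum_mono[OF split]]) (unfold sum.distrib, intro add_mono H)
  finally have "W powr (p - 1) * W \<le> W powr (p - 1) * (lpn p I a + lpn p I b)" by (simp add: distrib_left)
  then show ?thesis using W by (simp add: W_def)
qed

text \<open>
  The functional with weights \<open>\<bar>f\<bar>\<^sup>p / f\<close> takes the value \<open>\<parallel>f\<parallel>\<^sup>p\<close> at \<open>f\<close>. Written like this
  it needs no conjugation, so real and complex scalars are treated alike; where \<open>f\<close> vanishes, division by
  zero gives the weight \<open>0\<close>.
\<close>
lemma weighted_sum_le:
  fixes f x :: "'i \<Rightarrow> 'a::real_normed_field"
  assumes "finite I"
  shows "norm (\<Sum>i\<in>I. of_real (norm (f i) powr p) / f i * x i) \<le> lpn p I f powr (p - 1) * lpn p I x"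
proof -
  have "norm (of_real (norm (f i) powr p) / f i * x i) = norm (f i) powr (p - 1) * norm (x i)" for i
    by (cases "f i = 0") (auto simp: norm_mult norm_divide powr_diff)
  then have "norm (\<Sum>i\<in>I. of_real (norm (f i) powr p) / f i * x i)
      \<le> (\<Sum>i\<in>I. norm (f i) powr (p - 1) * norm (x i))"
    by (intro order_trans[OF norm_sum]) simp
  also have "\<dots> \<le> lpn p I (\<lambda>i. norm (f i)) powr (p - 1) * lpn p I (\<lambda>i. norm (x i))"
    using assms by (intro Hoelder_sum) auto
  finally show ?thesis by (simp add: lpn_def)
qed

end

section \<open>The scalar field as a subfield of the complex numbers\<close>

text \<open>
  The image of \<open>r\<close> has the distances \<open>\<bar>r\<bar>\<close> from \<open>0\<close> and \<open>\<bar>r - 1\<bar>\<close> from \<open>1\<close>, and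
  the two circles meet only in \<open>r\<close>.
\<close>
lemma isometric_iso_of_real:
  fixes \<phi> :: "'k::real_normed_field \<Rightarrow> complex"
  assumes add: "\<And>x y. \<phi> (x + y) = \<phi> x + \<phi> y" and mult: "\<And>x y. \<phi> (x * y) = \<phi> x * \<phi> y"
    and nrm: "\<And>x. cmod (\<phi> x) = norm x"
  shows "\<phi> (of_real r) = of_real r"
proof -
  have "\<phi> 1 * \<phi> 1 = \<phi> 1" "\<phi> 1 \<noteq> 0" using mult[of 1 1] nrm[of 1] by auto
  then have one: "\<phi> 1 = 1" by simp
  have "\<phi> 0 = 0" using add[of 0 0] by simp
  then have neg: "\<phi> (- x) = - \<phi> x" for x using add[of x "- x"] by (simp add: eq_neg_iff_add_eq_0 add.commute)
  have "\<phi> (of_real r - 1) = \<phi> (of_real r) - 1" using add[of "of_real r" "- 1"] by (simp add: one neg)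
  then have "cmod (\<phi> (of_real r) - 1) = \<bar>r - 1\<bar>"
    using nrm[of "of_real r - 1"] by (metis norm_of_real of_real_1 of_real_diff)
  moreover have "cmod (\<phi> (of_real r)) = \<bar>r\<bar>" by (simp add: nrm)
  ultimately have "(Re (\<phi> (of_real r)))\<^sup>2 + (Im (\<phi> (of_real r)))\<^sup>2 = r\<^sup>2"
    "(Re (\<phi> (of_real r)) - 1)\<^sup>2 + (Im (\<phi> (of_real r)))\<^sup>2 = (r - 1)\<^sup>2"
    by (metis cmod_power2 power2_abs, metis cmod_power2 power2_abs minus_complex.simps one_complex.simps diff_zero)
  then have "Re (\<phi> (of_real r)) = r" "Im (\<phi> (of_real r)) = 0"
    by (auto simp: power2_eq_square algebra_simps)
  then show ?thesis by (simp add: complex_eq_iff)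
qed

text \<open>
  Both possible scalar fields are closed subfields of the complex numbers that are stable under
  conjugation; compactness of balls, the parallelogram law and conjugation are inherited from there.
\<close>
lemma scalar_embedding:
  obtains \<phi> :: "'k::real_or_complex \<Rightarrow> complex" where "inj \<phi>" "closed (range \<phi>)" "\<And>z. cnj (\<phi> z) \<in> range \<phi>"
    "\<And>x y. \<phi> (x + y) = \<phi> x + \<phi> y" "\<And>x y. \<phi> (x * y) = \<phi> x * \<phi> y" "\<And>x. cmod (\<phi> x) = norm x"
  using real_or_complex[where 'a='k]
proof
  assume "\<exists>\<phi>::'k \<Rightarrow> real. bij \<phi> \<and> (\<forall>x y. \<phi> (x + y) = \<phi> x + \<phi> y) \<and>
        (\<forall>x y. \<phi> (x * y) = \<phi> x * \<phi> y) \<and> (\<forall>x. \<bar>\<phi> x\<bar> = norm x)"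
  then obtain \<phi> :: "'k \<Rightarrow> real" where h: "bij \<phi>" "\<And>x y. \<phi> (x + y) = \<phi> x + \<phi> y"
    "\<And>x y. \<phi> (x * y) = \<phi> x * \<phi> y" "\<And>x. \<bar>\<phi> x\<bar> = norm x" by blast
  have r: "range (\<lambda>x. complex_of_real (\<phi> x)) = \<real>"
    using bij_is_surj[OF h(1)] by (auto simp: Reals_def image_iff) (metis surjD)
  show thesis
    by (rule that[of "\<lambda>x. of_real (\<phi> x)"])
      (use h bij_is_inj[OF h(1)] r in \<open>auto simp: inj_def closed_complex_Reals\<close>)
next
  assume "\<exists>\<phi>::'k \<Rightarrow> complex. bij \<phi> \<and> (\<forall>x y. \<phi> (x + y) = \<phi> x + \<phi> y) \<and>
        (\<forall>x y. \<phi> (x * y) = \<phi> x * \<phi> y) \<and> (\<forall>x. cmod (\<phi> x) = norm x)"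
  then obtain \<phi> :: "'k \<Rightarrow> complex" where h: "bij \<phi>" "\<And>x y. \<phi> (x + y) = \<phi> x + \<phi> y"
    "\<And>x y. \<phi> (x * y) = \<phi> x * \<phi> y" "\<And>x. cmod (\<phi> x) = norm x" by blast
  show thesis by (rule that[of \<phi>]) (use h bij_is_inj[OF h(1)] bij_is_surj[OF h(1)] in auto)
qed

lemma compact_cball_scalar: "compact (cball (0::'k::real_or_complex) r)"
proof -
  obtain \<phi> :: "'k \<Rightarrow> complex" where h: "inj \<phi>" "closed (range \<phi>)"
    "\<And>x y. \<phi> (x + y) = \<phi> x + \<phi> y" "\<And>x. cmod (\<phi> x) = norm x"
    using scalar_embedding by metis
  have "\<phi> 0 = 0" using h(3)[of 0 0] by simp
  then have neg: "\<phi> (- x) = - \<phi> x" for x using h(3)[of x "- x"] by (simp add: eq_neg_iff_add_eq_0 add.commute)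
  have d: "dist (\<phi> x) (\<phi> y) = dist x y" for x y
    using h(3)[of x "- y"] h(4)[of "x - y"] by (simp add: dist_norm neg)
  have c: "compact (cball 0 r \<inter> range \<phi>)" by (intro compact_Int_closed h(2)) simp
  have "continuous_on (range \<phi>) (inv \<phi>)"
    unfolding continuous_on_iff using d h(1) by (auto simp: inv_f_f)
  then have "compact (inv \<phi> ` (cball 0 r \<inter> range \<phi>))"
    by (intro compact_continuous_image c) (auto intro: continuous_on_subset)
  moreover have "inv \<phi> ` (cball 0 r \<inter> range \<phi>) = cball 0 r"
  proof (intro set_eqI iffI)
    show "z \<in> cball 0 r" if "z \<in> inv \<phi> ` (cball 0 r \<inter> range \<phi>)" for z
      using that h(1,4) by (auto simp: inv_f_f)
    show "z \<in> inv \<phi> ` (cball 0 r \<inter> range \<phi>)" if "z \<in> cball 0 r" for z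
      using that h(1,4) by (intro image_eqI[of _ _ "\<phi> z"]) (auto simp: inv_f_f)
  qed
  ultimately show ?thesis by simp
qed

lemma scalar_parallelogram:
  fixes x y :: "'k::real_or_complex"
  shows "(norm (x + y))\<^sup>2 + (norm (x - y))\<^sup>2 = 2 * (norm x)\<^sup>2 + 2 * (norm y)\<^sup>2"
proof -
  obtain \<phi> :: "'k \<Rightarrow> complex" where h:
    "\<And>x y. \<phi> (x + y) = \<phi> x + \<phi> y" "\<And>x. cmod (\<phi> x) = norm x"
    using scalar_embedding by metis
  have "\<phi> (x - y) = \<phi> x - \<phi> y" using h(1)[of "x - y" y] by simp
  then show ?thesis unfolding h(2)[symmetric] h(1)
    by (simp add: cmod_power2) (simp add: power2_eq_square algebra_simps)
qed

lemma scalar_conjugation: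
  obtains c :: "'k::real_or_complex \<Rightarrow> 'k" where "\<And>x y. c (x + y) = c x + c y"
    "\<And>x y. c (x * y) = c x * c y" "\<And>x. c x * x = of_real ((norm x)\<^sup>2)" "\<And>x. norm (c x) = norm x"
    "\<And>x. c (c x) = x"
proof -
  obtain \<phi> :: "'k \<Rightarrow> complex" where h: "inj \<phi>" "\<And>z. cnj (\<phi> z) \<in> range \<phi>"
    "\<And>x y. \<phi> (x + y) = \<phi> x + \<phi> y" "\<And>x y. \<phi> (x * y) = \<phi> x * \<phi> y" "\<And>x. cmod (\<phi> x) = norm x"
    using scalar_embedding by metis
  define c where "c x = inv \<phi> (cnj (\<phi> x))" for x
  have c: "\<phi> (c x) = cnj (\<phi> x)" for x using h(2) by (simp add: c_def f_inv_into_f)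
  show thesis
  proof (rule that[of c])
    show "c (x + y) = c x + c y" "c (x * y) = c x * c y" "c (c x) = x" for x y
      by (rule injD[OF h(1)], simp add: c h)+
    show "norm (c x) = norm x" for x by (simp flip: h(5) add: c)
    show "c x * x = of_real ((norm x)\<^sup>2)" for x
    proof (rule injD[OF h(1)])
      show "\<phi> (c x * x) = \<phi> (of_real ((norm x)\<^sup>2))"
        unfolding isometric_iso_of_real[OF h(3-5)] h(4) c h(5)[symmetric]
        by (metis complex_norm_square mult.commute of_real_power)
    qed
  qed
qed

section \<open>Spaces with a local \<open>\<ell>\<^sub>p\<close> structure\<close>

definition bounded_hom ::
    "('k::real_or_complex \<Rightarrow> 'a::real_normed_vector \<Rightarrow> 'a) \<Rightarrow> ('k \<Rightarrow> 'b::real_normed_vector \<Rightarrow> 'b) \<Rightarrow>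
     real \<Rightarrow> ('a \<Rightarrow> 'b) \<Rightarrow> bool" where
  "bounded_hom s t C f \<longleftrightarrow> module_hom s t f \<and> (\<forall>x. norm (f x) \<le> C * norm x)"

definition lp_basis ::
    "real \<Rightarrow> ('k::real_or_complex \<Rightarrow> 'x::real_normed_vector \<Rightarrow> 'x) \<Rightarrow> real \<Rightarrow> nat \<Rightarrow> (nat \<Rightarrow> 'x) \<Rightarrow> bool" where
  "lp_basis p s \<Lambda> n e \<longleftrightarrow> (\<forall>a. lpn p {..<n} a \<le> \<Lambda> * norm (\<Sum>i<n. s (a i) (e i)) \<and>
     norm (\<Sum>i<n. s (a i) (e i)) \<le> \<Lambda> * lpn p {..<n} a)"

text \<open>
  The condition defining \<open>script_L_space\<close>, with the isomorphism onto \<open>\<ell>\<^sub>p\<close> replaced by the basis that it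
  produces and with finite sets in place of finite dimensional subspaces.
\<close>
definition Lp_property :: "real \<Rightarrow> ('k::real_or_complex \<Rightarrow> 'x::real_normed_vector \<Rightarrow> 'x) \<Rightarrow> real \<Rightarrow> bool" where
  "Lp_property p s \<Lambda> \<longleftrightarrow> 1 \<le> \<Lambda> \<and> (\<forall>F. finite F \<longrightarrow>
     (\<exists>n e. lp_basis p s \<Lambda> n e \<and> F \<subseteq> range (\<lambda>a. \<Sum>i<n. s (a i) (e i))))"

text \<open>
  Tychonoff's theorem: a net of functions with values in fixed compact balls, indexed by the finite sets
  directed by inclusion, has a cluster point in the topology of pointwise convergence.
\<close>
lemma cluster_point_along_finite_sets:
  fixes G :: "'x set \<Rightarrow> 'j \<Rightarrow> 'k::real_or_complex"
  assumes "\<And>F j. norm (G F j) \<le> B j"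
  shows "\<exists>g. \<forall>S F0 \<eta>. finite S \<longrightarrow> finite F0 \<longrightarrow> 0 < \<eta> \<longrightarrow>
    (\<exists>F. finite F \<and> F0 \<subseteq> F \<and> (\<forall>j\<in>S. norm (G F j - g j) < \<eta>))"
proof -
  define K where "K = PiE UNIV (\<lambda>j. cball (0::'k) (B j))"
  have "compactin (product_topology (\<lambda>_::'j. euclidean :: 'k topology) UNIV) K"
    unfolding K_def compactin_PiE by (simp add: compact_cball_scalar)
  then have "compact K" by (simp add: euclidean_product_topology)
  let ?\<F> = "filtermap G (finite_subsets_at_top UNIV)"
  have "?\<F> \<noteq> bot" by (simp add: filtermap_bot_iff)
  moreover have "eventually (\<lambda>g. g \<in> K) ?\<F>"
    using assms by (auto simp: K_def eventually_filtermap PiE_UNIV_domain intro!: always_eventually)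
  ultimately obtain g where g: "inf (nhds g) ?\<F> \<noteq> bot"
    using \<open>compact K\<close> unfolding compact_filter by blast
  show ?thesis
  proof (intro exI[of _ g] allI impI, rule ccontr)
    fix S :: "'j set" and F0 :: "'x set" and \<eta> :: real
    assume S: "finite S" "finite F0" "0 < \<eta>"
      and no: "\<not> (\<exists>F. finite F \<and> F0 \<subseteq> F \<and> (\<forall>j\<in>S. norm (G F j - g j) < \<eta>))"
    define U where "U = (\<Inter>j\<in>S. {f. norm (f j - g j) < \<eta>})"
    have "open U" unfolding U_def
      by (intro open_INT S(1) ballI open_Collect_less continuous_intros continuous_on_product_coordinates)
    then have "eventually (\<lambda>f. f \<in> U) (nhds g)"
      using S(3) unfolding eventually_nhds by (intro exI[of _ U]) (auto simp: U_def)
    moreover have "eventually (\<lambda>f. f \<notin> U) ?\<F>"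
      unfolding eventually_filtermap eventually_finite_subsets_at_top
      using no S(2) by (intro exI[of _ F0]) (auto simp: U_def)
    ultimately have "eventually (\<lambda>f. False) (inf (nhds g) ?\<F>)"
      unfolding eventually_inf by (metis (mono_tags, lifting))
    with g show False by (simp add: eventually_False)
  qed
qed

lemma scalar_normed_space_mult: "scalar_normed_space ((*) :: 'k::real_or_complex \<Rightarrow> 'k \<Rightarrow> 'k)"
  by unfold_locales (auto simp: algebra_simps scaleR_conv_of_real norm_mult)

lemma (in lp_exponent) tendsto_lpn:
  assumes "\<And>i. i \<in> I \<Longrightarrow> ((\<lambda>n. a n i) \<longlongrightarrow> b i) F"
  shows "((\<lambda>n. lpn p I (a n)) \<longlongrightarrow> lpn p I b) F"
  unfolding lpn_def using p_gt_1 assms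
  by (intro tendsto_powr2 tendsto_sum tendsto_norm tendsto_const) (auto intro!: always_eventually sum_nonneg)

locale lp_space = lp_exponent p + scalar_normed_space s
  for p :: real and s :: "'k::real_or_complex \<Rightarrow> 'x::real_normed_vector \<Rightarrow> 'x"
begin

abbreviation functional :: "real \<Rightarrow> ('x \<Rightarrow> 'k) \<Rightarrow> bool" where
  "functional C f \<equiv> bounded_hom s (*) C f"

lemma module_hom_functionalI:
  assumes "\<And>x y. f (x + y) = f x + f y" "\<And>c x. f (s c x) = c * f x"
  shows "module_hom s ((*) :: 'k \<Rightarrow> 'k \<Rightarrow> 'k) f"
  using assms scalar_normed_space.axioms(1)[OF scalar_normed_space_mult] vector_space_axioms
  by (simp add: module_hom_iff module_iff_vector_space)

lemma sum_scale_add: "(\<Sum>i\<in>I. s (a i + b i) (e i)) = (\<Sum>i\<in>I. s (a i) (e i)) + (\<Sum>i\<in>I. s (b i) (e i))"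
  by (simp add: scale_left_distrib sum.distrib)

lemma sum_scale_mult: "(\<Sum>i\<in>I. s (c * a i) (e i)) = s c (\<Sum>i\<in>I. s (a i) (e i))"
  by (simp add: scale_sum_right)

text \<open>
  The substitute for the Hahn-Banach theorem and for weak compactness. Suppose that for every finite set
  \<open>F\<close> an operator with values in \<open>\<ell>\<^sub>p\<close>\<open>(\<Gamma>)\<close> is given, but only on a subspace \<open>W F\<close> that contains \<open>F\<close>, with a bound
  independent of \<open>F\<close>. A cluster point of these operators is linear and bounded on the whole
  space, because each instance of linearity involves three points and these lie in \<open>W F\<close> for
  all large \<open>F\<close>. The last conclusion says that the cluster point can be replaced by one of
  the given operators as long as only finitely many vectors matter.
\<close>
lemma extension_from_finite_sets:
  assumes "finite \<Gamma>" "0 \<le> K" and W: "\<And>F. finite F \<Longrightarrow> F \<subseteq> W F"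
    and H_add: "\<And>F x y c. finite F \<Longrightarrow> x \<in> W F \<Longrightarrow> y \<in> W F \<Longrightarrow> x + y \<in> W F \<Longrightarrow> c \<in> \<Gamma> \<Longrightarrow>
      H F (x + y) c = H F x c + H F y c"
    and H_scale: "\<And>F x r c. finite F \<Longrightarrow> x \<in> W F \<Longrightarrow> s r x \<in> W F \<Longrightarrow> c \<in> \<Gamma> \<Longrightarrow>
      H F (s r x) c = r * H F x c"
    and H_bound: "\<And>F x. finite F \<Longrightarrow> x \<in> W F \<Longrightarrow> lpn p \<Gamma> (H F x) \<le> K * norm x"
  obtains g :: "'x \<Rightarrow> 'c \<Rightarrow> 'k" where "\<And>c. c \<in> \<Gamma> \<Longrightarrow> module_hom s (*) (\<lambda>x. g x c)"
    "\<And>x. lpn p \<Gamma> (g x) \<le> K * norm x"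
    "\<And>S F0 \<eta>. finite S \<Longrightarrow> finite F0 \<Longrightarrow> 0 < \<eta> \<Longrightarrow>
      \<exists>F. finite F \<and> F0 \<subseteq> F \<and> (\<forall>x\<in>S. \<forall>c\<in>\<Gamma>. norm (H F x c - g x c) < \<eta>)"
proof -
  define G where "G F = (\<lambda>(x, c). if finite F \<and> x \<in> W F \<and> c \<in> \<Gamma> then H F x c else 0)" for F
  have "norm (G F j) \<le> K * norm (fst j)" for F j
  proof -
    have "norm (H F (fst j) (snd j)) \<le> K * norm (fst j)" if "finite F" "fst j \<in> W F" "snd j \<in> \<Gamma>"
      using norm_le_lpn[OF assms(1) that(3)] H_bound[OF that(1,2)] by (rule order_trans)
    then show ?thesis using assms(2) by (auto simp: G_def split: prod.splits)
  qed
  from cluster_point_along_finite_sets[of G, OF this]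
  obtain g' where g': "\<And>S F0 \<eta>. finite S \<Longrightarrow> finite F0 \<Longrightarrow> 0 < \<eta> \<Longrightarrow>
      \<exists>F. finite F \<and> F0 \<subseteq> F \<and> (\<forall>j\<in>S. norm (G F j - g' j) < \<eta>)" by metis
  define g where "g x c = g' (x, c)" for x c
  have near: "\<exists>F. finite F \<and> F0 \<subseteq> F \<and> (\<forall>x\<in>S. \<forall>c\<in>\<Gamma>. norm (H F x c - g x c) < \<eta>)"
    if fin: "finite S" "finite F0" "0 < \<eta>" for S F0 \<eta>
  proof -
    obtain F where F: "finite F" "F0 \<union> S \<subseteq> F" "\<And>j. j \<in> S \<times> \<Gamma> \<Longrightarrow> norm (G F j - g' j) < \<eta>"
      using g'[OF finite_cartesian_product[OF fin(1) assms(1)] finite_UnI[OF fin(2,1)] fin(3)] by blast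
    have "norm (H F x c - g x c) < \<eta>" if "x \<in> S" "c \<in> \<Gamma>" for x c
      using F(3)[of "(x, c)"] W[OF F(1)] F(1,2) that by (auto simp: G_def g_def)
    then show ?thesis using F by blast
  qed
  have seq: "\<exists>F. (\<forall>n. finite (F n) \<and> S \<subseteq> W (F n)) \<and> (\<forall>x\<in>S. \<forall>c\<in>\<Gamma>. (\<lambda>n. H (F n) x c) \<longlonglongrightarrow> g x c)"
    if "finite S" for S
  proof -
    have "\<exists>F. finite F \<and> S \<subseteq> F \<and> (\<forall>x\<in>S. \<forall>c\<in>\<Gamma>. norm (H F x c - g x c) < inverse (real (Suc n)))" for n
      using near[OF that that, of "inverse (real (Suc n))"] by simp
    then obtain F where F: "\<And>n. finite (F n)" "\<And>n. S \<subseteq> F n"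
      "\<And>n x c. x \<in> S \<Longrightarrow> c \<in> \<Gamma> \<Longrightarrow> norm (H (F n) x c - g x c) < inverse (real (Suc n))" by metis
    have "(\<lambda>n. H (F n) x c) \<longlonglongrightarrow> g x c" if "x \<in> S" "c \<in> \<Gamma>" for x c
    proof -
      have "(\<lambda>n. H (F n) x c - g x c) \<longlonglongrightarrow> 0"
        by (rule Lim_null_comparison[OF _ LIMSEQ_inverse_real_of_nat])
          (rule always_eventually, rule allI, rule less_imp_le, rule F(3)[OF that])
      then show ?thesis by (rule LIM_zero_cancel)
    qed
    then show ?thesis using F W by (intro exI[of _ F]) blast
  qed
  show thesis
  proof (rule that[of g])
    fix c assume c: "c \<in> \<Gamma>"
    show "module_hom s (*) (\<lambda>x. g x c)"
    proof (rule module_hom_functionalI)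
      fix x y :: 'x
      have "finite {x, y, x + y}" by simp
      from seq[OF this] obtain F where "\<forall>n. finite (F n) \<and> {x, y, x + y} \<subseteq> W (F n)"
        "\<forall>z\<in>{x, y, x + y}. \<forall>c\<in>\<Gamma>. (\<lambda>n. H (F n) z c) \<longlonglongrightarrow> g z c" by (elim exE conjE)
      then have F: "\<And>n. finite (F n)" "\<And>n. {x, y, x + y} \<subseteq> W (F n)"
        "\<And>z c. z \<in> {x, y, x + y} \<Longrightarrow> c \<in> \<Gamma> \<Longrightarrow> (\<lambda>n. H (F n) z c) \<longlonglongrightarrow> g z c" by blast+
      have "(\<lambda>n. H (F n) x c + H (F n) y c) \<longlonglongrightarrow> g x c + g y c"
        using F(3) c by (intro tendsto_add) auto
      moreover have "H (F n) (x + y) c = H (F n) x c + H (F n) y c" for n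
        using F(1)[of n] F(2)[of n] c by (intro H_add) auto
      ultimately have "(\<lambda>n. H (F n) (x + y) c) \<longlonglongrightarrow> g x c + g y c" by simp
      then show "g (x + y) c = g x c + g y c" by (rule LIMSEQ_unique[OF F(3)[OF _ c], rotated]) simp
    next
      fix r :: 'k and x :: 'x
      have "finite {x, s r x}" by simp
      from seq[OF this] obtain F where "\<forall>n. finite (F n) \<and> {x, s r x} \<subseteq> W (F n)"
        "\<forall>z\<in>{x, s r x}. \<forall>c\<in>\<Gamma>. (\<lambda>n. H (F n) z c) \<longlonglongrightarrow> g z c" by (elim exE conjE)
      then have F: "\<And>n. finite (F n)" "\<And>n. {x, s r x} \<subseteq> W (F n)"
        "\<And>z c. z \<in> {x, s r x} \<Longrightarrow> c \<in> \<Gamma> \<Longrightarrow> (\<lambda>n. H (F n) z c) \<longlonglongrightarrow> g z c" by blast+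
      have "(\<lambda>n. r * H (F n) x c) \<longlonglongrightarrow> r * g x c"
        using F(3) c by (intro tendsto_mult tendsto_const) auto
      moreover have "H (F n) (s r x) c = r * H (F n) x c" for n
        using F(1)[of n] F(2)[of n] c by (intro H_scale) auto
      ultimately have "(\<lambda>n. H (F n) (s r x) c) \<longlonglongrightarrow> r * g x c" by simp
      then show "g (s r x) c = r * g x c" by (rule LIMSEQ_unique[OF F(3)[OF _ c], rotated]) simp
    qed
  next
    fix x :: 'x
    have "finite {x}" by simp
      from seq[OF this] obtain F where "\<forall>n. finite (F n) \<and> {x} \<subseteq> W (F n)"
        "\<forall>z\<in>{x}. \<forall>c\<in>\<Gamma>. (\<lambda>n. H (F n) z c) \<longlonglongrightarrow> g z c" by (elim exE conjE)
      then have F: "\<And>n. finite (F n)" "\<And>n. {x} \<subseteq> W (F n)"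
        "\<And>z c. z \<in> {x} \<Longrightarrow> c \<in> \<Gamma> \<Longrightarrow> (\<lambda>n. H (F n) z c) \<longlonglongrightarrow> g z c" by blast+
    have "(\<lambda>n. lpn p \<Gamma> (H (F n) x)) \<longlonglongrightarrow> lpn p \<Gamma> (g x)"
      by (rule tendsto_lpn) (use F(3) in blast)
    then show "lpn p \<Gamma> (g x) \<le> K * norm x"
      by (rule LIMSEQ_le_const2) (use F H_bound in blast)
  qed (use near in blast)
qed

lemma lp_basis_coordinates:
  assumes "lp_basis p s \<Lambda> n e" "0 \<le> \<Lambda>"
  shows "\<exists>co. (\<forall>x \<in> range (\<lambda>a. \<Sum>i<n. s (a i) (e i)). (\<Sum>i<n. s (co x i) (e i)) = x) \<and>
    (\<forall>x \<in> range (\<lambda>a. \<Sum>i<n. s (a i) (e i)). \<forall>y \<in> range (\<lambda>a. \<Sum>i<n. s (a i) (e i)). \<forall>i<n.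
        co (x + y) i = co x i + co y i) \<and>
    (\<forall>x \<in> range (\<lambda>a. \<Sum>i<n. s (a i) (e i)). \<forall>c. \<forall>i<n. co (s c x) i = c * co x i)"
proof -
  let ?V = "range (\<lambda>a. \<Sum>i<n. s (a i) (e i))"
  define co where "co x = (SOME a. x = (\<Sum>i<n. s (a i) (e i)))" for x
  have co: "(\<Sum>i<n. s (co x i) (e i)) = x" if "x \<in> ?V" for x
    using that unfolding co_def by (intro someI2_ex[where Q="\<lambda>a. (\<Sum>i<n. s (a i) (e i)) = x"]) auto
  have unique: "a i = b i" if "(\<Sum>i<n. s (a i) (e i)) = (\<Sum>i<n. s (b i) (e i))" "i < n" for a b i
  proof -
    have "(\<Sum>i<n. s (a i - b i) (e i)) = 0"
      using that(1) by (simp add: scale_left_diff_distrib sum_subtractf)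
    then have "lpn p {..<n} (\<lambda>i. a i - b i) \<le> 0" using assms(1) unfolding lp_basis_def by (metis mult_zero_right norm_zero)
    then have "norm (a i - b i) \<le> 0"
      using norm_le_lpn[of "{..<n}" i "\<lambda>i. a i - b i"] that(2) by (meson finite_lessThan lessThan_iff order_trans)
    then show ?thesis by simp
  qed
  show ?thesis
  proof (intro exI[of _ co] conjI ballI allI impI)
    show "(\<Sum>i<n. s (co x i) (e i)) = x" if "x \<in> ?V" for x using co[OF that] .
  next
    fix x y i assume xy: "x \<in> ?V" "y \<in> ?V" and i: "i < n"
    have eq: "x + y = (\<Sum>i<n. s (co x i + co y i) (e i))" using co xy by (simp add: sum_scale_add)
    then have "x + y \<in> ?V" by (rule image_eqI[of _ _ "\<lambda>i. co x i + co y i"]) simp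
    then show "co (x + y) i = co x i + co y i"
      using co eq by (intro unique[OF _ i, of "co (x + y)" "\<lambda>i. co x i + co y i"]) simp
  next
    fix x c i assume x: "x \<in> ?V" and i: "i < n"
    have eq: "s c x = (\<Sum>i<n. s (c * co x i) (e i))" using co x by (simp only: sum_scale_mult)
    then have "s c x \<in> ?V" by (rule image_eqI[of _ _ "\<lambda>i. c * co x i"]) simp
    then show "co (s c x) i = c * co x i"
      using co eq by (intro unique[OF _ i, of "co (s c x)" "\<lambda>i. c * co x i"]) simp
  qed
qed

end

section \<open>The bounded approximation property\<close>

text \<open>
  A compact set in \<open>\<ell>\<^sub>p\<close>\<open>(I)\<close> is almost fixed by a contraction that factors through an \<open>\<ell>\<^sub>p\<close> space whose
  dimension does not depend on \<open>I\<close>. Change the density to \<open>h\<close>, the \<open>\<ell>\<^sub>p\<close>-norm of the values of all the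
  \<open>f j\<close> at a point. All quotients \<open>f j / h\<close> lie in the unit disc. Two coordinates are in the same class
  if these quotients agree after rounding to a finite net of the disc, so the number of classes depends on
  \<open>J\<close> and \<open>\<epsilon>\<close> only, and averaging over the classes with density \<open>h\<close> changes each \<open>f j\<close> by at
  most \<open>2 * \<epsilon> * h\<close>. The two contractions \<open>\<alpha>\<close> and \<open>\<beta>\<close> are the factors of this averaging operator.
\<close>
lemma (in lp_exponent) conditional_expectation_lp:
  fixes J :: "'j set"
  assumes "finite J" "0 < \<epsilon>"
  obtains \<Gamma> :: "('j \<Rightarrow> 'k::real_or_complex) set" where "finite \<Gamma>"
    "\<And>I (f :: 'j \<Rightarrow> 'i \<Rightarrow> 'k). finite I \<Longrightarrow> \<exists>\<alpha> \<beta>. (\<forall>x. lpn p \<Gamma> (\<lambda>c. \<Sum>i\<in>I. \<alpha> c i * x i) \<le> lpn p I x) \<and>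
      (\<forall>v. lpn p I (\<lambda>i. \<Sum>c\<in>\<Gamma>. v c * \<beta> c i) \<le> lpn p \<Gamma> v) \<and>
      (\<forall>j\<in>J. lpn p I (\<lambda>i. f j i - (\<Sum>c\<in>\<Gamma>. (\<Sum>i'\<in>I. \<alpha> c i' * f j i') * \<beta> c i))
          \<le> 2 * \<epsilon> * (\<Sum>j\<in>J. lpn p I (f j) powr p) powr (1 / p))"
proof -
  have "seq_compact (cball (0::'k) 1)" using compact_cball_scalar by (simp add: compact_eq_seq_compact_metric)
  from seq_compact_imp_totally_bounded[OF this, rule_format, OF assms(2)]
  obtain W where W: "finite W" "cball (0::'k) 1 \<subseteq> (\<Union>w\<in>W. ball w \<epsilon>)" by (elim exE conjE)
  then have "\<exists>w. w \<in> W \<and> norm (z - w) \<le> \<epsilon>" if "norm z \<le> 1" for z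
    using that by (force simp: dist_norm norm_minus_commute subset_iff)
  then obtain \<kappa> where \<kappa>: "\<And>z. norm z \<le> 1 \<Longrightarrow> \<kappa> z \<in> W" "\<And>z. norm z \<le> 1 \<Longrightarrow> norm (z - \<kappa> z) \<le> \<epsilon>" by metis
  define \<Gamma> where "\<Gamma> = (PiE J (\<lambda>_. W))"
  have fin\<Gamma>: "finite \<Gamma>" unfolding \<Gamma>_def using assms(1) W(1) by (intro finite_PiE) auto
  show thesis
  proof (rule that[OF fin\<Gamma>])
    fix I :: "'i set" and f :: "'j \<Rightarrow> 'i \<Rightarrow> 'k"
    assume I: "finite I"
    define h where "h i = lpn p J (\<lambda>j. f j i)" for i
    define I' where "I' = {i \<in> I. 0 < h i}"
    \<comment> \<open>The class of a coordinate is the rounded vector of all the quotients.\<close>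
    define cl where "cl i = (\<lambda>j\<in>J. \<kappa> (f j i / of_real (h i)))" for i
    define Ic where "Ic c = {i \<in> I'. cl i = c}" for c
    define H where "H c = (\<Sum>i\<in>Ic c. h i powr p)" for c
    define \<alpha> :: "('j \<Rightarrow> 'k) \<Rightarrow> 'i \<Rightarrow> 'k" where
      "\<alpha> c i = (if i \<in> Ic c then of_real (h i powr (p - 1) / H c powr (1 - 1 / p)) else 0)" for c i
    define \<beta> :: "('j \<Rightarrow> 'k) \<Rightarrow> 'i \<Rightarrow> 'k" where
      "\<beta> c i = (if i \<in> Ic c then of_real (h i / H c powr (1 / p)) else 0)" for c i
    have fin: "finite I'" "finite (Ic c)" "Ic c \<subseteq> I'" "I' \<subseteq> I" for c using I by (auto simp: I'_def Ic_def)
    have h0: "0 \<le> h i" for i by (simp add: h_def)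
    have quot: "norm (f j i / of_real (h i)) \<le> 1" if "i \<in> I'" "j \<in> J" for i j
      using norm_le_lpn[OF assms(1) that(2), of "\<lambda>j. f j i"] that(1) by (simp add: norm_divide I'_def h_def)
    have cl: "cl i \<in> \<Gamma>" if "i \<in> I'" for i
      unfolding cl_def \<Gamma>_def using quot[OF that] \<kappa>(1) by auto
    have group: "(\<Sum>c\<in>\<Gamma>. \<Sum>i\<in>Ic c. u i) = (\<Sum>i\<in>I'. u i)" for u :: "'i \<Rightarrow> real"
      unfolding Ic_def using cl by (intro sum.group fin fin\<Gamma>) auto
    have Hpos: "0 < H c" if "i \<in> Ic c" for i c
      unfolding H_def using fin that by (intro sum_pos2[of _ i]) (auto simp: I'_def Ic_def)
    have lpnh: "lpn p (Ic c) h = H c powr (1 / p)" for c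
      by (simp add: lpn_def H_def h0)
    have A: "lpn p \<Gamma> (\<lambda>c. \<Sum>i\<in>I. \<alpha> c i * x i) \<le> lpn p I x" for x
    proof -
      have "norm (\<Sum>i\<in>I. \<alpha> c i * x i) \<le> lpn p (Ic c) x" for c
      proof (cases "Ic c = {}")
        case True
        then show ?thesis by (simp add: \<alpha>_def)
      next
        case False
        then have pos: "0 < H c" using Hpos by blast
        have "(\<Sum>i\<in>I. \<alpha> c i * x i) = (\<Sum>i\<in>Ic c. \<alpha> c i * x i)"
          using I fin by (intro sum.mono_neutral_right) (auto simp: \<alpha>_def)
        also have "norm \<dots> \<le> (\<Sum>i\<in>Ic c. h i powr (p - 1) * norm (x i) / H c powr (1 - 1 / p))"
          by (intro order_trans[OF norm_sum] sum_mono) (simp add: \<alpha>_def norm_mult norm_divide)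
        also have "\<dots> = (\<Sum>i\<in>Ic c. h i powr (p - 1) * norm (x i)) / H c powr (1 - 1 / p)"
          by (simp add: sum_divide_distrib)
        also have "\<dots> \<le> (lpn p (Ic c) h powr (p - 1) * lpn p (Ic c) (\<lambda>i. norm (x i))) / H c powr (1 - 1 / p)"
          using h0 by (intro divide_right_mono Hoelder_sum fin) auto
        also have "lpn p (Ic c) h powr (p - 1) = H c powr (1 - 1 / p)"
          using p_gt_1 by (simp add: lpnh powr_powr diff_divide_distrib)
        finally show ?thesis using pos by (simp add: lpn_def)
      qed
      then have "(\<Sum>c\<in>\<Gamma>. norm (\<Sum>i\<in>I. \<alpha> c i * x i) powr p) \<le> (\<Sum>c\<in>\<Gamma>. lpn p (Ic c) x powr p)"
        using p_gt_1 by (intro sum_mono powr_mono2) auto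
      also have "\<dots> = (\<Sum>i\<in>I'. norm (x i) powr p)" by (simp add: lpn_powr group)
      also have "\<dots> \<le> lpn p I x powr p" unfolding lpn_powr using I fin by (intro sum_mono2) auto
      finally show ?thesis by (subst lpn_le_iff) auto
    qed
    have single: "(\<Sum>c\<in>\<Gamma>. v c * \<beta> c i) = (if i \<in> I' then v (cl i) * of_real (h i / H (cl i) powr (1 / p)) else 0)"
      for v i
    proof (cases "i \<in> I'")
      case True
      have "(\<Sum>c\<in>\<Gamma>. v c * \<beta> c i) = (\<Sum>c\<in>\<Gamma>. if c = cl i then v (cl i) * of_real (h i / H (cl i) powr (1 / p)) else 0)"
        using True by (intro sum.cong) (auto simp: \<beta>_def Ic_def)
      then show ?thesis using True cl fin\<Gamma> by simp
    qed (simp add: \<beta>_def Ic_def)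
    have B: "lpn p I (\<lambda>i. \<Sum>c\<in>\<Gamma>. v c * \<beta> c i) \<le> lpn p \<Gamma> v" for v
    proof -
      have "(\<Sum>i\<in>I. norm (\<Sum>c\<in>\<Gamma>. v c * \<beta> c i) powr p)
          = (\<Sum>i\<in>I'. norm (v (cl i)) powr p * (h i powr p / H (cl i)))"
        unfolding single
      proof (intro sum.mono_neutral_cong_right)
        fix i assume i: "i \<in> I'"
        then have "0 < H (cl i)" by (intro Hpos[of i]) (simp add: Ic_def)
        then show "norm (if i \<in> I' then v (cl i) * of_real (h i / H (cl i) powr (1 / p)) else 0) powr p =
            norm (v (cl i)) powr p * (h i powr p / H (cl i))"
          using i p_gt_1 by (simp add: norm_mult norm_divide powr_mult powr_divide powr_powr h0)
      qed (use I fin in auto)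
      also have "\<dots> = (\<Sum>c\<in>\<Gamma>. \<Sum>i\<in>Ic c. norm (v (cl i)) powr p * (h i powr p / H (cl i)))"
        by (simp add: group)
      also have "\<dots> = (\<Sum>c\<in>\<Gamma>. \<Sum>i\<in>Ic c. norm (v c) powr p * (h i powr p / H c))"
        by (intro sum.cong) (auto simp: Ic_def)
      also have "\<dots> = (\<Sum>c\<in>\<Gamma>. norm (v c) powr p * (H c / H c))"
        unfolding sum_distrib_left[symmetric] sum_divide_distrib[symmetric] H_def ..
      also have "\<dots> \<le> (\<Sum>c\<in>\<Gamma>. norm (v c) powr p)"
        by (intro sum_mono) (simp add: mult_left_le)
      also have "\<dots> = lpn p \<Gamma> v powr p" by (simp add: lpn_powr)
      finally show ?thesis by (subst lpn_le_iff) auto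
    qed
    have D: "lpn p I (\<lambda>i. f j i - (\<Sum>c\<in>\<Gamma>. (\<Sum>i'\<in>I. \<alpha> c i' * f j i') * \<beta> c i))
          \<le> 2 * \<epsilon> * (\<Sum>j\<in>J. lpn p I (f j) powr p) powr (1 / p)" if j: "j \<in> J" for j
    proof -
      have "norm (f j i - (\<Sum>c\<in>\<Gamma>. (\<Sum>i'\<in>I. \<alpha> c i' * f j i') * \<beta> c i)) \<le> norm (2 * \<epsilon> * h i)" if "i \<in> I" for i
      proof (cases "i \<in> I'")
        case False
        then have "h i = 0" using that h0[of i] by (simp add: I'_def)
        then have "f j i = 0" using lpn_eq_0[of J "\<lambda>j. f j i" j] assms(1) j by (simp add: h_def)
        then show ?thesis using False by (simp add: single)
      next
        case True
        define c where "c = cl i"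
        have ic: "i \<in> Ic c" using True by (simp add: Ic_def c_def)
        note pos = Hpos[OF ic]
        define \<theta> where "\<theta> i' = f j i' / of_real (h i') - c j" for i'
        have \<theta>: "norm (\<theta> i') \<le> \<epsilon>" "f j i' = of_real (h i') * (c j + \<theta> i')" if "i' \<in> Ic c" for i'
        proof -
          have i': "i' \<in> I'" "cl i' = c" using that by (auto simp: Ic_def)
          then have "c j = \<kappa> (f j i' / of_real (h i'))" using j unfolding cl_def by (metis restrict_apply')
          then show "norm (\<theta> i') \<le> \<epsilon>" using \<kappa>(2)[OF quot[OF i'(1) j]] by (simp add: \<theta>_def)
          show "f j i' = of_real (h i') * (c j + \<theta> i')" using i'(1) by (simp add: \<theta>_def I'_def)
        qed
        have powh: "h i' powr (p - 1) * h i' = h i' powr p" for i'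
          using h0[of i'] by (cases "h i' = 0") (auto simp: powr_diff)
        have "(\<Sum>i'\<in>I. \<alpha> c i' * f j i') = (\<Sum>i'\<in>Ic c. \<alpha> c i' * f j i')"
          using I fin by (intro sum.mono_neutral_right) (auto simp: \<alpha>_def)
        also have "\<dots> = (\<Sum>i'\<in>Ic c. of_real (h i' powr p / H c powr (1 - 1 / p)) * (c j + \<theta> i'))"
          by (intro sum.cong refl) (simp add: \<alpha>_def \<theta>(2) flip: powh)
        also have "\<dots> = of_real (H c / H c powr (1 - 1 / p)) * c j +
            of_real (1 / H c powr (1 - 1 / p)) * (\<Sum>i'\<in>Ic c. of_real (h i' powr p) * \<theta> i')"
          by (simp add: H_def distrib_left sum.distrib sum_distrib_left sum_distrib_right sum_divide_distrib)
        finally have AB: "(\<Sum>i'\<in>I. \<alpha> c i' * f j i') * of_real (h i / H c powr (1 / p))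
            = of_real (h i / H c powr (1 / p) * (H c / H c powr (1 - 1 / p))) * c j +
              of_real (h i / H c powr (1 / p) * (1 / H c powr (1 - 1 / p))) * (\<Sum>i'\<in>Ic c. of_real (h i' powr p) * \<theta> i')"
          by (simp add: algebra_simps)
        have HH: "H c powr (1 / p) * H c powr (1 - 1 / p) = H c" using pos by (simp flip: powr_add)
        then have hh: "h i / H c powr (1 / p) * (H c / H c powr (1 - 1 / p)) = h i"
            "h i / H c powr (1 / p) * (1 / H c powr (1 - 1 / p)) = h i / H c"
          using pos by (simp_all add: field_simps)
        have AB': "(\<Sum>i'\<in>I. \<alpha> c i' * f j i') * of_real (h i / H c powr (1 / p))
            = of_real (h i) * c j + of_real (h i / H c) * (\<Sum>i'\<in>Ic c. of_real (h i' powr p) * \<theta> i')"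
          using AB unfolding hh .
        have e1: "(\<Sum>c\<in>\<Gamma>. (\<Sum>i'\<in>I. \<alpha> c i' * f j i') * \<beta> c i) =
            (\<Sum>i'\<in>I. \<alpha> c i' * f j i') * of_real (h i / H c powr (1 / p))"
          using True by (simp only: single c_def if_True)
        have "f j i - (\<Sum>c\<in>\<Gamma>. (\<Sum>i'\<in>I. \<alpha> c i' * f j i') * \<beta> c i)
            = of_real (h i) * \<theta> i - of_real (h i / H c) * (\<Sum>i'\<in>Ic c. of_real (h i' powr p) * \<theta> i')"
          unfolding e1 AB' by (subst \<theta>(2)[OF ic]) (simp add: distrib_left)
        also have "norm \<dots> \<le> h i * norm (\<theta> i) + h i / H c * norm (\<Sum>i'\<in>Ic c. of_real (h i' powr p) * \<theta> i')"
          by (rule order_trans[OF norm_triangle_ineq4]) (use h0[of i] pos in \<open>simp add: norm_mult norm_divide\<close>)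
        also have "norm (\<Sum>i'\<in>Ic c. of_real (h i' powr p) * \<theta> i') \<le> (\<Sum>i'\<in>Ic c. h i' powr p * \<epsilon>)"
          using \<theta>(1) by (intro order_trans[OF norm_sum] sum_mono) (simp add: norm_mult mult_left_mono)
        also have "\<dots> = H c * \<epsilon>" by (simp add: H_def sum_distrib_right)
        also have "h i * norm (\<theta> i) + h i / H c * (H c * \<epsilon>) \<le> h i * \<epsilon> + h i * \<epsilon>"
          using \<theta>(1)[OF ic] pos h0[of i] by (intro add_mono mult_left_mono) auto
        finally have "norm (f j i - (\<Sum>c\<in>\<Gamma>. (\<Sum>i'\<in>I. \<alpha> c i' * f j i') * \<beta> c i)) \<le> h i * \<epsilon> + h i * \<epsilon>"
          using h0[of i] pos by (simp add: divide_right_mono mult_left_mono)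
        then show ?thesis using h0[of i] assms(2) by simp
      qed
      then have "lpn p I (\<lambda>i. f j i - (\<Sum>c\<in>\<Gamma>. (\<Sum>i'\<in>I. \<alpha> c i' * f j i') * \<beta> c i)) \<le> lpn p I (\<lambda>i. 2 * \<epsilon> * h i)"
        using I by (intro lpn_mono) auto
      also have "\<dots> = 2 * \<epsilon> * lpn p I h" using assms(2) by (simp only: lpn_scale) simp
      also have "lpn p I h = (\<Sum>j\<in>J. lpn p I (f j) powr p) powr (1 / p)"
        unfolding lpn_powr by (subst sum.swap) (simp add: lpn_def[of p I h] h_def lpn_powr)
      finally show ?thesis .
    qed
    show "\<exists>\<alpha> \<beta>. (\<forall>x. lpn p \<Gamma> (\<lambda>c. \<Sum>i\<in>I. \<alpha> c i * x i) \<le> lpn p I x) \<and>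
      (\<forall>v. lpn p I (\<lambda>i. \<Sum>c\<in>\<Gamma>. v c * \<beta> c i) \<le> lpn p \<Gamma> v) \<and>
      (\<forall>j\<in>J. lpn p I (\<lambda>i. f j i - (\<Sum>c\<in>\<Gamma>. (\<Sum>i'\<in>I. \<alpha> c i' * f j i') * \<beta> c i))
          \<le> 2 * \<epsilon> * (\<Sum>j\<in>J. lpn p I (f j) powr p) powr (1 / p))"
      using A B D by blast
  qed
qed

context lp_space
begin

lemma sum_scale_swap: "(\<Sum>c\<in>\<Gamma>. s (v c) (\<Sum>i\<in>I. s (\<beta> c i) (e i))) = (\<Sum>i\<in>I. s (\<Sum>c\<in>\<Gamma>. v c * \<beta> c i) (e i))"
proof -
  have "(\<Sum>c\<in>\<Gamma>. s (v c) (\<Sum>i\<in>I. s (\<beta> c i) (e i))) = (\<Sum>c\<in>\<Gamma>. \<Sum>i\<in>I. s (v c * \<beta> c i) (e i))"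
    by (simp add: scale_sum_right)
  also have "\<dots> = (\<Sum>i\<in>I. s (\<Sum>c\<in>\<Gamma>. v c * \<beta> c i) (e i))"
    by (subst sum.swap) (simp add: scale_sum_left)
  finally show ?thesis .
qed

lemma norm_sum_scale_le:
  assumes "finite I" "\<And>i. i \<in> I \<Longrightarrow> norm (e i) \<le> B" "0 \<le> B"
  shows "norm (\<Sum>i\<in>I. s (a i) (e i)) \<le> real (card I) * B * lpn p I a"
proof -
  have "norm (\<Sum>i\<in>I. s (a i) (e i)) \<le> (\<Sum>i\<in>I. norm (a i) * B)"
    using assms by (intro order_trans[OF norm_sum] sum_mono) (simp add: norm_scale mult_left_mono)
  also have "\<dots> \<le> real (card I) * lpn p I a * B"
    unfolding sum_distrib_right[symmetric] using sum_norm_le_lpn[OF assms(1)] assms(3) by (rule mult_right_mono)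
  finally show ?thesis by (simp add: mult.commute mult.left_commute)
qed

text \<open>
  The bounded approximation property, with approximating operators that factor uniformly through
  finite dimensional \<open>\<ell>\<^sub>p\<close> spaces. On large finite dimensional subspaces the factors \<open>\<alpha>\<close> and
  \<open>\<beta>\<close> are available by averaging. Their common middle space is fixed, so the first factors have a
  cluster point \<open>g\<close> defined on the whole space, while the second factor of one sufficiently large
  subspace can be kept: composed with \<open>g\<close> it still almost fixes the finite set \<open>Y0\<close>.
\<close>
lemma approximation_property:
  assumes L: "Lp_property p s \<Lambda>" and Y0: "finite Y0" and eps: "0 < \<epsilon>"
  obtains n :: nat and g :: "nat \<Rightarrow> 'x \<Rightarrow> 'k" and b :: "nat \<Rightarrow> 'x" where
    "\<And>i. i < n \<Longrightarrow> module_hom s (*) (g i)" "\<And>x. lpn p {..<n} (\<lambda>i. g i x) \<le> \<Lambda> * norm x"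
    "\<And>a. norm (\<Sum>i<n. s (a i) (b i)) \<le> \<Lambda> * lpn p {..<n} a"
    "\<And>y. y \<in> Y0 \<Longrightarrow> norm (y - (\<Sum>i<n. s (g i y) (b i))) \<le> \<epsilon>"
proof -
  have \<Lambda>: "1 \<le> \<Lambda>" using L by (simp add: Lp_property_def)
  define V where "V n e = range (\<lambda>a. \<Sum>i<n. s (a i) (e i))" for n :: nat and e
  have "\<exists>n e. lp_basis p s \<Lambda> n e \<and> F \<union> Y0 \<subseteq> V n e" if "finite F" for F
    using L Y0 that unfolding Lp_property_def V_def by blast
  then obtain N e where Ne: "\<And>F. finite F \<Longrightarrow> lp_basis p s \<Lambda> (N F) (e F)"
      "\<And>F. finite F \<Longrightarrow> F \<union> Y0 \<subseteq> V (N F) (e F)" by metis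
  note Ne = Ne(1) Ne(2)[unfolded V_def]
  define W where "W F = range (\<lambda>a. \<Sum>i<N F. s (a i) (e F i))" for F
  define Q where "Q F co \<longleftrightarrow> (\<forall>x\<in>W F. (\<Sum>i<N F. s (co x i) (e F i)) = x) \<and>
      (\<forall>x\<in>W F. \<forall>y\<in>W F. \<forall>i<N F. co (x + y) i = co x i + co y i) \<and>
      (\<forall>x\<in>W F. \<forall>c. \<forall>i<N F. co (s c x) i = c * co x i)" for F co
  have "\<exists>co. Q F co" if F: "finite F" for F
    unfolding Q_def W_def using \<Lambda> by (intro lp_basis_coordinates[OF Ne(1)[OF F]]) simp
  then obtain co where "\<And>F. finite F \<Longrightarrow> Q F (co F)" by metis
  then have co: "\<And>F x. finite F \<Longrightarrow> x \<in> W F \<Longrightarrow> (\<Sum>i<N F. s (co F x i) (e F i)) = x"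
      "\<And>F x y i. finite F \<Longrightarrow> x \<in> W F \<Longrightarrow> y \<in> W F \<Longrightarrow> i < N F \<Longrightarrow> co F (x + y) i = co F x i + co F y i"
      "\<And>F x c i. finite F \<Longrightarrow> x \<in> W F \<Longrightarrow> i < N F \<Longrightarrow> co F (s c x) i = c * co F x i"
    unfolding Q_def by simp_all
  have lpn_co: "lpn p {..<N F} (co F x) \<le> \<Lambda> * norm x" if "finite F" "x \<in> W F" for F x
    using Ne(1)[OF that(1)] co(1)[OF that] unfolding lp_basis_def by metis
  have comb: "norm (\<Sum>i<N F. s (a i) (e F i)) \<le> \<Lambda> * lpn p {..<N F} a" if "finite F" for F a
    using Ne(1)[OF that] unfolding lp_basis_def by blast
  define M where "M = (\<Sum>y\<in>Y0. (\<Lambda> * norm y) powr p) powr (1 / p)"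
  have M: "0 \<le> M" by (simp add: M_def)
  define \<epsilon>' where "\<epsilon>' = \<epsilon> / (4 * \<Lambda> * (M + 1))"
  have \<epsilon>': "0 < \<epsilon>'" using eps \<Lambda> M by (simp add: \<epsilon>'_def)
  obtain \<Gamma> :: "('x \<Rightarrow> 'k) set" where \<Gamma>: "finite \<Gamma>" and
    ex: "\<And>I (f :: 'x \<Rightarrow> nat \<Rightarrow> 'k). finite I \<Longrightarrow> \<exists>\<alpha> \<beta>. (\<forall>x. lpn p \<Gamma> (\<lambda>c. \<Sum>i\<in>I. \<alpha> c i * x i) \<le> lpn p I x) \<and>
      (\<forall>v. lpn p I (\<lambda>i. \<Sum>c\<in>\<Gamma>. v c * \<beta> c i) \<le> lpn p \<Gamma> v) \<and>
      (\<forall>j\<in>Y0. lpn p I (\<lambda>i. f j i - (\<Sum>c\<in>\<Gamma>. (\<Sum>i'\<in>I. \<alpha> c i' * f j i') * \<beta> c i))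
          \<le> 2 * \<epsilon>' * (\<Sum>j\<in>Y0. lpn p I (f j) powr p) powr (1 / p))"
    by (rule conditional_expectation_lp[OF Y0 \<epsilon>']) (rule that)
  define R where "R F \<alpha> \<beta> \<longleftrightarrow> (\<forall>x. lpn p \<Gamma> (\<lambda>c. \<Sum>i<N F. \<alpha> c i * x i) \<le> lpn p {..<N F} x) \<and>
      (\<forall>v. lpn p {..<N F} (\<lambda>i. \<Sum>c\<in>\<Gamma>. v c * \<beta> c i) \<le> lpn p \<Gamma> v) \<and>
      (\<forall>j\<in>Y0. lpn p {..<N F} (\<lambda>i. co F j i - (\<Sum>c\<in>\<Gamma>. (\<Sum>i'<N F. \<alpha> c i' * co F j i') * \<beta> c i))
          \<le> 2 * \<epsilon>' * (\<Sum>j\<in>Y0. lpn p {..<N F} (co F j) powr p) powr (1 / p))" for F \<alpha> \<beta>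
  have "\<exists>\<alpha> \<beta>. R F \<alpha> \<beta>" for F
    unfolding R_def by (rule ex) simp
  then obtain \<alpha> \<beta> where "\<And>F. R F (\<alpha> F) (\<beta> F)" by metis
  then have \<alpha>: "\<And>F x. lpn p \<Gamma> (\<lambda>c. \<Sum>i<N F. \<alpha> F c i * x i) \<le> lpn p {..<N F} x"
    and \<beta>: "\<And>F v. lpn p {..<N F} (\<lambda>i. \<Sum>c\<in>\<Gamma>. v c * \<beta> F c i) \<le> lpn p \<Gamma> v"
    and \<alpha>\<beta>: "\<And>F y. y \<in> Y0 \<Longrightarrow>
      lpn p {..<N F} (\<lambda>i. co F y i - (\<Sum>c\<in>\<Gamma>. (\<Sum>i'<N F. \<alpha> F c i' * co F y i') * \<beta> F c i))
          \<le> 2 * \<epsilon>' * (\<Sum>j\<in>Y0. lpn p {..<N F} (co F j) powr p) powr (1 / p)"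
    unfolding R_def by blast+
  define H where "H F x c = (\<Sum>i<N F. \<alpha> F c i * co F x i)" for F x c
  obtain g :: "'x \<Rightarrow> ('x \<Rightarrow> 'k) \<Rightarrow> 'k" where g: "\<And>c. c \<in> \<Gamma> \<Longrightarrow> module_hom s (*) (\<lambda>x. g x c)"
    "\<And>x. lpn p \<Gamma> (g x) \<le> \<Lambda> * norm x"
    "\<And>S F0 \<eta>. finite S \<Longrightarrow> finite F0 \<Longrightarrow> 0 < \<eta> \<Longrightarrow>
      \<exists>F. finite F \<and> F0 \<subseteq> F \<and> (\<forall>x\<in>S. \<forall>c\<in>\<Gamma>. norm (H F x c - g x c) < \<eta>)"
  proof (rule extension_from_finite_sets[of \<Gamma> \<Lambda> W H])
    show "finite \<Gamma>" "0 \<le> \<Lambda>" using \<Gamma> \<Lambda> by auto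
    show "F \<subseteq> W F" if "finite F" for F using Ne(2)[OF that] by (simp add: W_def)
    show "lpn p \<Gamma> (H F x) \<le> \<Lambda> * norm x" if "finite F" "x \<in> W F" for F x
      unfolding H_def using \<alpha> lpn_co[OF that] by (rule order_trans)
  qed (auto simp: H_def co distrib_left sum.distrib sum_distrib_left mult.left_commute)
  define \<eta> where "\<eta> = \<epsilon> / (2 * \<Lambda> * (real (card \<Gamma>) + 1))"
  have \<eta>: "0 < \<eta>" using eps \<Lambda> by (simp add: \<eta>_def add_nonneg_pos)
  obtain F where F: "finite F" "\<And>x c. x \<in> Y0 \<Longrightarrow> c \<in> \<Gamma> \<Longrightarrow> norm (H F x c - g x c) < \<eta>"
    using g(3)[OF Y0 finite.emptyI \<eta>] by blast
  define b where "b c = (\<Sum>i<N F. s (\<beta> F c i) (e F i))" for c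
  have b: "norm (\<Sum>c\<in>\<Gamma>. s (v c) (b c)) \<le> \<Lambda> * lpn p \<Gamma> v" for v
  proof -
    have "norm (\<Sum>c\<in>\<Gamma>. s (v c) (b c)) \<le> \<Lambda> * lpn p {..<N F} (\<lambda>i. \<Sum>c\<in>\<Gamma>. v c * \<beta> F c i)"
      unfolding b_def sum_scale_swap by (rule comb[OF F(1)])
    also have "\<dots> \<le> \<Lambda> * lpn p \<Gamma> v" using \<Lambda> \<beta> by (intro mult_left_mono) auto
    finally show ?thesis .
  qed
  have err: "norm (y - (\<Sum>c\<in>\<Gamma>. s (g y c) (b c))) \<le> \<epsilon>" if y: "y \<in> Y0" for y
  proof -
    have yW: "z \<in> W F" if "z \<in> Y0" for z using Ne(2)[OF F(1)] that by (auto simp: W_def)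
    have "y - (\<Sum>c\<in>\<Gamma>. s (H F y c) (b c)) = (\<Sum>i<N F. s (co F y i - (\<Sum>c\<in>\<Gamma>. H F y c * \<beta> F c i)) (e F i))"
      unfolding b_def sum_scale_swap using co(1)[OF F(1) yW[OF y]]
      by (simp add: scale_left_diff_distrib sum_subtractf)
    then have "norm (y - (\<Sum>c\<in>\<Gamma>. s (H F y c) (b c)))
        \<le> \<Lambda> * lpn p {..<N F} (\<lambda>i. co F y i - (\<Sum>c\<in>\<Gamma>. H F y c * \<beta> F c i))"
      using comb[OF F(1), of "\<lambda>i. co F y i - (\<Sum>c\<in>\<Gamma>. H F y c * \<beta> F c i)"] by (simp only:)
    also have "\<dots> \<le> \<Lambda> * (2 * \<epsilon>' * (\<Sum>j\<in>Y0. lpn p {..<N F} (co F j) powr p) powr (1 / p))"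
      using \<Lambda> \<alpha>\<beta>[OF y, of F, folded H_def] by (intro mult_left_mono) auto
    also have "\<dots> \<le> \<Lambda> * (2 * \<epsilon>' * M)"
      unfolding M_def using \<Lambda> \<epsilon>' p_gt_1 lpn_co[OF F(1) yW]
      by (intro mult_left_mono powr_mono2 sum_mono) (auto intro: sum_nonneg)
    also have "\<dots> = \<epsilon> / 2 * (M / (M + 1))"
      using \<Lambda> M by (simp add: \<epsilon>'_def)
    also have "\<dots> \<le> \<epsilon> / 2" using eps M by (intro mult_left_le) auto
    finally have 1: "norm (y - (\<Sum>c\<in>\<Gamma>. s (H F y c) (b c))) \<le> \<epsilon> / 2" .
    have "norm (\<Sum>c\<in>\<Gamma>. s (H F y c - g y c) (b c)) \<le> \<Lambda> * (real (card \<Gamma>) * \<eta>)"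
      using F(2)[OF y] \<Lambda> \<eta> \<Gamma> by (intro order_trans[OF b] mult_left_mono lpn_le_card) (auto intro: less_imp_le)
    also have "\<dots> = \<epsilon> / 2 * (real (card \<Gamma>) / (real (card \<Gamma>) + 1))"
      using \<Lambda> by (simp add: \<eta>_def)
    also have "\<dots> \<le> \<epsilon> / 2" using eps by (intro mult_left_le) auto
    finally have 2: "norm (\<Sum>c\<in>\<Gamma>. s (H F y c - g y c) (b c)) \<le> \<epsilon> / 2" .
    have eq: "y - (\<Sum>c\<in>\<Gamma>. s (g y c) (b c)) = (y - (\<Sum>c\<in>\<Gamma>. s (H F y c) (b c))) + (\<Sum>c\<in>\<Gamma>. s (H F y c - g y c) (b c))"
      by (simp add: scale_left_diff_distrib sum_subtractf)
    show ?thesis unfolding eq by (rule norm_triangle_le) (use 1 2 in simp)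
  qed
  obtain h where h: "bij_betw h {..<card \<Gamma>} \<Gamma>"
    using ex_bij_betw_nat_finite[OF \<Gamma>] by (auto simp: lessThan_atLeast0)
  have h': "inj_on h {..<card \<Gamma>}" "h ` {..<card \<Gamma>} = \<Gamma>" using h by (auto simp: bij_betw_def)
  show thesis
  proof (rule that[of "card \<Gamma>" "\<lambda>i x. g x (h i)" "\<lambda>i. b (h i)"])
    show "module_hom s (*) (\<lambda>x. g x (h i))" if "i < card \<Gamma>" for i using g(1) h'(2) that by blast
    show "lpn p {..<card \<Gamma>} (\<lambda>i. g x (h i)) \<le> \<Lambda> * norm x" for x
      using g(2)[of x] lpn_reindex[OF h'(1), of "g x"] by (simp add: h'(2))
    show "norm (\<Sum>i<card \<Gamma>. s (a i) (b (h i))) \<le> \<Lambda> * lpn p {..<card \<Gamma>} a" for a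
    proof -
      define v where "v c = a (the_inv_into {..<card \<Gamma>} h c)" for c
      have v: "v (h i) = a i" if "i < card \<Gamma>" for i
        using the_inv_into_f_f[OF h'(1)] that by (simp add: v_def)
      have "(\<Sum>c\<in>\<Gamma>. s (v c) (b c)) = (\<Sum>i<card \<Gamma>. s (v (h i)) (b (h i)))"
        by (rule sum.reindex_bij_betw[OF h, symmetric])
      also have "\<dots> = (\<Sum>i<card \<Gamma>. s (a i) (b (h i)))" by (intro sum.cong) (auto simp: v)
      finally have 1: "(\<Sum>i<card \<Gamma>. s (a i) (b (h i))) = (\<Sum>c\<in>\<Gamma>. s (v c) (b c))" by simp
      have "lpn p \<Gamma> v = lpn p {..<card \<Gamma>} (\<lambda>i. v (h i))" using lpn_reindex[OF h'(1), of v] h'(2) by simp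
      also have "\<dots> = lpn p {..<card \<Gamma>} a" by (intro lpn_cong) (simp add: v)
      finally show ?thesis using b[of v] 1 by simp
    qed
    show "norm (y - (\<Sum>i<card \<Gamma>. s (g y (h i)) (b (h i)))) \<le> \<epsilon>" if "y \<in> Y0" for y
      using err[OF that] by (simp add: sum.reindex_bij_betw[OF h, of "\<lambda>c. s (g y c) (b c)"])
  qed
qed

lemma functional_sum:
  assumes "\<And>i. i \<in> I \<Longrightarrow> module_hom s (*) (g i)"
  shows "module_hom s ((*) :: 'k \<Rightarrow> 'k \<Rightarrow> 'k) (\<lambda>x. \<Sum>i\<in>I. c i * g i x)"
proof (rule module_hom_functionalI)
  show "(\<Sum>i\<in>I. c i * g i (x + y)) = (\<Sum>i\<in>I. c i * g i x) + (\<Sum>i\<in>I. c i * g i y)" for x y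
    unfolding sum.distrib[symmetric]
    by (intro sum.cong refl) (simp add: module_hom.add[OF assms] distrib_left)
  show "(\<Sum>i\<in>I. c i * g i (s r x)) = r * (\<Sum>i\<in>I. c i * g i x)" for r x
    unfolding sum_distrib_left by (intro sum.cong refl) (simp add: module_hom.scale[OF assms])
qed

text \<open>
  A Hahn-Banach theorem up to a constant: approximate the identity at \<open>x\<close> through a finite
  dimensional \<open>\<ell>\<^sub>p\<close> space, where norming functionals are explicit.
\<close>
lemma norming_functional:
  assumes L: "Lp_property p s \<Lambda>"
  obtains \<phi> where "functional (2 * \<Lambda>\<^sup>2) \<phi>" "\<phi> x = of_real (norm x)"
proof (cases "x = 0")
  case True
  have "functional (2 * \<Lambda>\<^sup>2) (\<lambda>_. 0)"
    unfolding bounded_hom_def by (auto intro: module_hom_functionalI)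
  then show ?thesis using True that by auto
next
  case False
  have \<Lambda>: "1 \<le> \<Lambda>" using L by (simp add: Lp_property_def)
  obtain n :: nat and g b where gb:
    "\<And>i. i < n \<Longrightarrow> module_hom s (*) (g i)" "\<And>x. lpn p {..<n} (\<lambda>i. g i x) \<le> \<Lambda> * norm x"
    "\<And>a. norm (\<Sum>i<n. s (a i) (b i)) \<le> \<Lambda> * lpn p {..<n} a"
    "norm (x - (\<Sum>i<n. s (g i x) (b i))) \<le> norm x / 2"
  proof (rule approximation_property[OF L, of "{x}" "norm x / 2"])
    show "0 < norm x / 2" using False by simp
  qed (auto intro: that)
  define a where "a i = g i x" for i
  define A where "A = lpn p {..<n} a"
  have "norm x \<le> norm (x - (\<Sum>i<n. s (g i x) (b i))) + norm (\<Sum>i<n. s (a i) (b i))"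
    using norm_triangle_ineq[of "x - (\<Sum>i<n. s (g i x) (b i))" "\<Sum>i<n. s (g i x) (b i)"] by (simp add: a_def)
  then have A1: "norm x \<le> 2 * \<Lambda> * A" using gb(3)[of a] gb(4) by (simp add: A_def)
  then have A0: "0 < A" using False \<Lambda> by (metis A_def lpn_nonneg less_eq_real_def mult_zero_right norm_le_zero_iff)
  define \<phi> where "\<phi> y = (\<Sum>i<n. of_real (norm x / A powr p) * (of_real (norm (a i) powr p) / a i) * g i y)" for y
  have hom: "module_hom s (*) \<phi>" unfolding \<phi>_def using gb(1) by (intro functional_sum) auto
  have eq: "\<phi> y = of_real (norm x / A powr p) * (\<Sum>i<n. of_real (norm (a i) powr p) / a i * g i y)" for y
    by (simp add: \<phi>_def sum_distrib_left mult.assoc)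
  show thesis
  proof (rule that)
    have "norm (\<phi> y) \<le> 2 * \<Lambda>\<^sup>2 * norm y" for y
    proof -
      have "norm (\<phi> y) = norm x / A powr p * norm (\<Sum>i<n. of_real (norm (a i) powr p) / a i * g i y)"
        by (simp add: eq norm_mult norm_divide)
      also have "\<dots> \<le> norm x / A powr p * (A powr (p - 1) * (\<Lambda> * norm y))"
      proof (intro mult_left_mono order_trans[OF weighted_sum_le])
        show "lpn p {..<n} a powr (p - 1) * lpn p {..<n} (\<lambda>i. g i y) \<le> A powr (p - 1) * (\<Lambda> * norm y)"
          unfolding A_def by (intro mult_left_mono gb(2)) simp
      qed simp_all
      also have "\<dots> = norm x / A * (\<Lambda> * norm y)" using A0 by (simp add: powr_diff)
      also have "\<dots> \<le> (2 * \<Lambda>) * (\<Lambda> * norm y)"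
        using A0 A1 \<Lambda> by (intro mult_right_mono) (auto simp: field_simps)
      finally show ?thesis by (simp add: power2_eq_square)
    qed
    then show "functional (2 * \<Lambda>\<^sup>2) \<phi>" using hom by (simp add: bounded_hom_def)
    have "(\<Sum>i<n. of_real (norm (a i) powr p) / a i * g i x) = of_real (\<Sum>i<n. norm (a i) powr p)"
      unfolding of_real_sum using p_gt_1 by (intro sum.cong) (auto simp: a_def)
    then show "\<phi> x = of_real (norm x)"
      unfolding eq lpn_powr[symmetric] A_def[symmetric] of_real_mult[symmetric] using A0 by simp
  qed
qed

end

section \<open>Copies of \<open>\<ell>\<^sub>p\<close> inside \<open>\<ell>\<^sub>p\<close>\<close>

text \<open>
  Orthogonality of independent signs; \<open>A\<close> is the set of indices with sign \<open>+1\<close>. Adding one index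
  is the parallelogram law.
\<close>
lemma sum_norm_square_signs:
  fixes z :: "'t \<Rightarrow> 'k::real_or_complex"
  assumes "finite T"
  shows "(\<Sum>A\<in>Pow T. (norm (\<Sum>t\<in>T. (if t \<in> A then 1 else - 1) * z t))\<^sup>2) = 2 ^ card T * (\<Sum>t\<in>T. (norm (z t))\<^sup>2)"
  using assms
proof induction
  case (insert u T)
  let ?w = "\<lambda>A. \<Sum>t\<in>T. (if t \<in> A then 1 else - 1) * z t"
  have eq1: "(\<Sum>t\<in>insert u T. (if t \<in> A then 1 else - 1) * z t) = ?w A - z u" if "A \<in> Pow T" for A
    using insert that by (auto simp: subset_iff)
  have eq2: "(\<Sum>t\<in>insert u T. (if t \<in> insert u A then 1 else - 1) * z t) = ?w A + z u" if "A \<in> Pow T" for A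
  proof -
    have "(\<Sum>t\<in>T. (if t \<in> insert u A then 1 else - 1) * z t) = ?w A"
      using insert.hyps by (intro sum.cong) auto
    then show ?thesis using insert.hyps by simp
  qed
  have inj: "inj_on (insert u) (Pow T)" using insert.hyps by (auto simp: inj_on_def) 
  have "(\<Sum>A\<in>Pow (insert u T). (norm (\<Sum>t\<in>insert u T. (if t \<in> A then 1 else - 1) * z t))\<^sup>2)
      = (\<Sum>A\<in>Pow T. (norm (\<Sum>t\<in>insert u T. (if t \<in> A then 1 else - 1) * z t))\<^sup>2)
      + (\<Sum>A\<in>insert u ` Pow T. (norm (\<Sum>t\<in>insert u T. (if t \<in> A then 1 else - 1) * z t))\<^sup>2)"
    unfolding Pow_insert using insert.hyps by (intro sum.union_disjoint) auto
  also have "(\<Sum>A\<in>insert u ` Pow T. (norm (\<Sum>t\<in>insert u T. (if t \<in> A then 1 else - 1) * z t))\<^sup>2)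
      = (\<Sum>A\<in>Pow T. (norm (?w A + z u))\<^sup>2)"
    unfolding sum.reindex[OF inj] o_def by (rule sum.cong[OF refl]) (simp only: eq2)
  also have "(\<Sum>A\<in>Pow T. (norm (\<Sum>t\<in>insert u T. (if t \<in> A then 1 else - 1) * z t))\<^sup>2)
      = (\<Sum>A\<in>Pow T. (norm (?w A - z u))\<^sup>2)"
    by (rule sum.cong[OF refl]) (simp only: eq1)
  also have "(\<Sum>A\<in>Pow T. (norm (?w A - z u))\<^sup>2) + (\<Sum>A\<in>Pow T. (norm (?w A + z u))\<^sup>2)
      = (\<Sum>A\<in>Pow T. 2 * (norm (?w A))\<^sup>2 + 2 * (norm (z u))\<^sup>2)"
  proof -
    have "(norm (?w A - z u))\<^sup>2 + (norm (?w A + z u))\<^sup>2 = 2 * (norm (?w A))\<^sup>2 + 2 * (norm (z u))\<^sup>2" for A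
      using scalar_parallelogram[of "?w A" "z u"] by simp
    then show ?thesis by (simp only: sum.distrib[symmetric])
  qed
  also have "\<dots> = 2 * (2 ^ card T * (\<Sum>t\<in>T. (norm (z t))\<^sup>2)) + 2 * 2 ^ card T * (norm (z u))\<^sup>2"
    using insert.hyps by (simp add: sum.distrib insert.IH card_Pow flip: sum_distrib_left)
  finally show ?case using insert.hyps by (simp add: distrib_left)
qed simp

text \<open>
  Jensen's inequality for the function \<open>y powr q\<close>, as Hoelder's inequality against the constant \<open>1\<close>.
\<close>
lemma power_mean:
  fixes y :: "'a \<Rightarrow> real"
  assumes "1 < q" "finite A" "\<And>a. a \<in> A \<Longrightarrow> 0 \<le> y a"
  shows "(\<Sum>a\<in>A. y a) powr q \<le> real (card A) powr (q - 1) * (\<Sum>a\<in>A. y a powr q)"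
proof -
  interpret q: lp_exponent q by unfold_locales (rule assms)
  have "(\<Sum>a\<in>A. y a) = (\<Sum>a\<in>A. 1 powr (q - 1) * y a)" by simp
  also have "\<dots> \<le> lpn q A (\<lambda>_. 1 :: real) powr (q - 1) * lpn q A y"
    using assms by (intro q.Hoelder_sum) auto
  finally have "(\<Sum>a\<in>A. y a) powr q \<le> (lpn q A (\<lambda>_. 1 :: real) powr (q - 1) * lpn q A y) powr q"
    using assms by (intro powr_mono2) (auto intro: sum_nonneg)
  also have "\<dots> = (lpn q A (\<lambda>_. 1::real) powr q) powr (q - 1) * lpn q A y powr q"
    by (simp add: powr_mult powr_powr mult.commute)
  also have "lpn q A (\<lambda>_. 1::real) powr q = real (card A)" by (simp add: q.lpn_powr)
  also have "lpn q A y powr q = (\<Sum>a\<in>A. y a powr q)"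
    unfolding q.lpn_powr using assms by (intro sum.cong) auto
  finally show ?thesis .
qed

context lp_exponent
begin

text \<open>
  For \<open>p \<noteq> 2\<close> the \<open>p\<close>-th power sum \<open>V\<close> and the square sum \<open>S\<close> of finitely many numbers can be
  comparable only if the largest of them is. If \<open>\<mu> powr p < \<kappa> * V\<close>, interpolating between the
  exponents \<open>2\<close> and \<open>\<infinity>\<close> for \<open>p > 2\<close>, or \<open>p\<close> and \<open>\<infinity>\<close> for \<open>p < 2\<close>, makes one of \<open>V\<close> and
  \<open>S powr (p / 2)\<close> at most \<open>\<kappa> powr (\<bar>p - 2\<bar> / 2)\<close> times the other; \<open>\<kappa>\<close> is chosen to make this factor
  equal to \<open>\<delta>\<close>.
\<close>
lemma power_sum_dichotomy:
  assumes "p \<noteq> 2" "0 < \<delta>"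
  obtains C where "0 < C"
    "\<And>(T::'t set) (z::'t \<Rightarrow> real) \<mu>. finite T \<Longrightarrow> (\<And>t. t \<in> T \<Longrightarrow> 0 \<le> z t \<and> z t \<le> \<mu>) \<Longrightarrow> 0 \<le> \<mu> \<Longrightarrow> 2 < p \<Longrightarrow>
       (\<Sum>t\<in>T. z t powr p) \<le> C * \<mu> powr p + \<delta> * (\<Sum>t\<in>T. (z t)\<^sup>2) powr (p / 2)"
    "\<And>(T::'t set) (z::'t \<Rightarrow> real) \<mu>. finite T \<Longrightarrow> (\<And>t. t \<in> T \<Longrightarrow> 0 \<le> z t \<and> z t \<le> \<mu>) \<Longrightarrow> 0 \<le> \<mu> \<Longrightarrow> p < 2 \<Longrightarrow>
       (\<Sum>t\<in>T. (z t)\<^sup>2) powr (p / 2) \<le> C * \<mu> powr p + \<delta> * (\<Sum>t\<in>T. z t powr p)"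
proof -
  define \<kappa> where "\<kappa> = \<delta> powr (2 / \<bar>p - 2\<bar>)"
  have \<kappa>: "0 < \<kappa>" "\<kappa> powr (\<bar>p - 2\<bar> / 2) = \<delta>" using assms by (auto simp: \<kappa>_def powr_powr)
  define C where "C = max (1 / \<kappa>) (1 / \<kappa> powr (p / 2))"
  have C: "0 < C" "1 / \<kappa> \<le> C" "1 / \<kappa> powr (p / 2) \<le> C" using \<kappa> by (auto simp: C_def less_max_iff_disj)
  show thesis
  proof (rule that[of C])
    fix T :: "'t set" and z :: "'t \<Rightarrow> real" and \<mu> :: real
    assume T: "finite T" and z: "\<And>t. t \<in> T \<Longrightarrow> 0 \<le> z t \<and> z t \<le> \<mu>" and \<mu>: "0 \<le> \<mu>" and p: "2 < p"
    define V where "V = (\<Sum>t\<in>T. z t powr p)"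
    define S where "S = (\<Sum>t\<in>T. (z t)\<^sup>2)"
    have pos: "0 \<le> V" "0 \<le> S" unfolding V_def S_def by (auto intro: sum_nonneg)
    show "V \<le> C * \<mu> powr p + \<delta> * S powr (p / 2)"
    proof (cases "\<mu> powr p < \<kappa> * V")
      case False
      then have "V \<le> 1 / \<kappa> * \<mu> powr p" using \<kappa> by (simp add: field_simps)
      also have "\<dots> \<le> C * \<mu> powr p" using C by (intro mult_right_mono) auto
      finally show ?thesis using assms(2) pos by (simp add: add_increasing2)
    next
      case True
      then have "0 < \<kappa> * V" by (rule le_less_trans[OF powr_ge_zero])
      then have V: "0 < V" using \<kappa>(1) by (simp add: zero_less_mult_iff)
      have "V \<le> (\<Sum>t\<in>T. \<mu> powr (p - 2) * (z t)\<^sup>2)" unfolding V_def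
      proof (rule sum_mono)
        fix t assume t: "t \<in> T"
        have "z t powr p = z t powr (p - 2) * (z t)\<^sup>2"
          using z[OF t] by (cases "z t = 0") (auto simp: powr_diff simp flip: powr_numeral)
        also have "\<dots> \<le> \<mu> powr (p - 2) * (z t)\<^sup>2"
          using z[OF t] p by (intro mult_right_mono powr_mono2) auto
        finally show "z t powr p \<le> \<mu> powr (p - 2) * (z t)\<^sup>2" .
      qed
      also have "\<dots> = (\<mu> powr p) powr ((p - 2) / p) * S" using p by (simp add: S_def sum_distrib_left powr_powr)
      also have "\<dots> \<le> (\<kappa> * V) powr ((p - 2) / p) * S"
        using True pos p by (intro mult_right_mono powr_mono2) auto
      also have "\<dots> = V powr ((p - 2) / p) * (\<kappa> powr ((p - 2) / p) * S)"
        using V \<kappa> by (simp add: powr_mult)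
      finally have "V / V powr ((p - 2) / p) \<le> \<kappa> powr ((p - 2) / p) * S"
        using V by (simp add: divide_le_eq mult.commute)
      also have "V / V powr ((p - 2) / p) = V powr (1 - (p - 2) / p)"
        using V by (simp add: powr_diff)
      also have "1 - (p - 2) / p = 2 / p" using p by (simp add: field_simps)
      finally have "(V powr (2 / p)) powr (p / 2) \<le> (\<kappa> powr ((p - 2) / p) * S) powr (p / 2)"
        using p by (intro powr_mono2) auto
      then have "V \<le> \<kappa> powr ((p - 2) / 2) * S powr (p / 2)"
        using p V by (simp add: powr_powr powr_mult)
      then show ?thesis using \<kappa>(2) p C(1) by (simp add: add_increasing)
    qed
  next
    fix T :: "'t set" and z :: "'t \<Rightarrow> real" and \<mu> :: real
    assume T: "finite T" and z: "\<And>t. t \<in> T \<Longrightarrow> 0 \<le> z t \<and> z t \<le> \<mu>" and \<mu>: "0 \<le> \<mu>" and p: "p < 2"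
    define V where "V = (\<Sum>t\<in>T. z t powr p)"
    define S where "S = (\<Sum>t\<in>T. (z t)\<^sup>2)"
    have pos: "0 \<le> V" "0 \<le> S" unfolding V_def S_def by (auto intro: sum_nonneg)
    have "S \<le> (\<Sum>t\<in>T. \<mu> powr (2 - p) * z t powr p)" unfolding S_def
    proof (rule sum_mono)
      fix t assume t: "t \<in> T"
      have "(z t)\<^sup>2 = z t powr (2 - p) * z t powr p"
        using z[OF t] by (cases "z t = 0") (auto simp flip: powr_add powr_numeral)
      also have "\<dots> \<le> \<mu> powr (2 - p) * z t powr p"
        using z[OF t] p by (intro mult_right_mono powr_mono2) auto
      finally show "(z t)\<^sup>2 \<le> \<mu> powr (2 - p) * z t powr p" .
    qed
    then have "S powr (p / 2) \<le> (\<mu> powr (2 - p) * V) powr (p / 2)"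
      using pos p_gt_1 by (intro powr_mono2) (auto simp: V_def sum_distrib_left)
    also have "\<dots> = (\<mu> powr p) powr ((2 - p) / 2) * V powr (p / 2)"
      using pos by (simp add: powr_mult powr_powr mult.commute)
    finally have S: "S powr (p / 2) \<le> (\<mu> powr p) powr ((2 - p) / 2) * V powr (p / 2)" .
    show "S powr (p / 2) \<le> C * \<mu> powr p + \<delta> * V"
    proof (cases "\<mu> powr p < \<kappa> * V")
      case True
      note S
      also have "(\<mu> powr p) powr ((2 - p) / 2) * V powr (p / 2) \<le> (\<kappa> * V) powr ((2 - p) / 2) * V powr (p / 2)"
        using True p by (intro mult_right_mono powr_mono2) auto
      also have "\<dots> = \<kappa> powr ((2 - p) / 2) * (V powr ((2 - p) / 2) * V powr (p / 2))"
        using pos \<kappa> by (simp add: powr_mult)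
      also have "V powr ((2 - p) / 2) * V powr (p / 2) = V"
        using pos by (simp flip: powr_add add: diff_divide_distrib)
      also have "\<kappa> powr ((2 - p) / 2) = \<delta>" using \<kappa>(2) p by simp
      finally show ?thesis using C(1) by (simp add: add_increasing)
    next
      case False
      then have V: "V \<le> \<mu> powr p / \<kappa>" using \<kappa> by (simp add: field_simps)
      note S
      also have "(\<mu> powr p) powr ((2 - p) / 2) * V powr (p / 2) \<le> (\<mu> powr p) powr ((2 - p) / 2) * (\<mu> powr p / \<kappa>) powr (p / 2)"
        using V pos p_gt_1 by (intro mult_left_mono powr_mono2) auto
      also have "\<dots> = ((\<mu> powr p) powr ((2 - p) / 2) * (\<mu> powr p) powr (p / 2)) * (1 / \<kappa> powr (p / 2))"
        using \<kappa> by (simp add: powr_divide)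
      also have "(\<mu> powr p) powr ((2 - p) / 2) * (\<mu> powr p) powr (p / 2) = \<mu> powr p"
        by (simp flip: powr_add add: diff_divide_distrib)
      also have "\<mu> powr p * (1 / \<kappa> powr (p / 2)) \<le> \<mu> powr p * C" using C by (intro mult_left_mono) auto
      finally show ?thesis using assms(2) pos by (simp add: add_increasing2 mult.commute)
    qed
  qed (rule C)
qed

definition lp_embedding :: "real \<Rightarrow> nat \<Rightarrow> nat \<Rightarrow> (nat \<Rightarrow> nat \<Rightarrow> 'k::real_or_complex) \<Rightarrow> bool" where
  "lp_embedding \<Lambda> m n f \<longleftrightarrow> (\<forall>a. lpn p {..<m} a \<le> \<Lambda> * lpn p {..<n} (\<lambda>i. \<Sum>t<m. a t * f t i) \<and>
     lpn p {..<n} (\<lambda>i. \<Sum>t<m. a t * f t i) \<le> \<Lambda> * lpn p {..<m} a)"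

lemma lpn_unit: "t < (m::nat) \<Longrightarrow> lpn p {..<m} (\<lambda>j. if j = t then 1 else 0 :: 'a::real_normed_algebra_1) = 1"
proof -
  assume "t < m"
  have "(\<Sum>j<m. norm (if j = t then 1 else 0 :: 'a) powr p) = (\<Sum>j<m. if j = t then 1 else (0::real))"
    by (intro sum.cong) auto
  also have "\<dots> = 1" using \<open>t < m\<close> by simp
  finally show ?thesis unfolding lpn_def by simp
qed

lemma lp_embedding_unit:
  assumes "lp_embedding \<Lambda> m n (f :: nat \<Rightarrow> nat \<Rightarrow> 'k::real_or_complex)" "t < m"
  shows "lpn p {..<n} (f t) \<le> \<Lambda>" "1 \<le> \<Lambda> * lpn p {..<n} (f t)"
proof -
  have "(\<lambda>i. \<Sum>j<m. (if j = t then 1 else 0) * f j i) = f t"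
    using assms(2) by (auto simp: fun_eq_iff if_distrib[of "\<lambda>x. x * _"] cong: if_cong)
  then show "lpn p {..<n} (f t) \<le> \<Lambda>" "1 \<le> \<Lambda> * lpn p {..<n} (f t)"
    using assms(1)[unfolded lp_embedding_def, rule_format, of "\<lambda>j. if j = t then 1 else 0"]
      lpn_unit[OF assms(2), where 'a='k] by simp_all
qed

text \<open>
  Average \<open>\<parallel>\<Sum> \<plusminus> f t\<parallel>\<^sup>p\<close> over all signs. Every term is comparable to \<open>m\<close> because the \<open>f t\<close>
  span a copy of \<open>\<ell>\<^sub>p\<close>, and in each coordinate the average is compared with the square function by
  Jensen's inequality, whose direction depends on the side of \<open>2\<close> on which \<open>p\<close> lies.
\<close>
lemma lp_embedding_square_function:
  fixes f :: "nat \<Rightarrow> nat \<Rightarrow> 'k::real_or_complex"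
  assumes emb: "lp_embedding \<Lambda> m n f" and \<Lambda>: "1 \<le> \<Lambda>"
  shows "2 < p \<Longrightarrow> (\<Sum>i<n. (\<Sum>t<m. (norm (f t i))\<^sup>2) powr (p / 2)) \<le> \<Lambda> powr p * m"
    and "p < 2 \<Longrightarrow> m \<le> \<Lambda> powr p * (\<Sum>i<n. (\<Sum>t<m. (norm (f t i))\<^sup>2) powr (p / 2))"
proof -
  define N where "N = real (card (Pow {..<m}))"
  have N: "0 < N" "N = 2 ^ m" by (simp_all add: N_def card_Pow)
  define sg :: "nat set \<Rightarrow> nat \<Rightarrow> 'k" where "sg A t = (if t \<in> A then 1 else - 1)" for A t
  define w where "w A i = (\<Sum>t<m. sg A t * f t i)" for A i
  have sq: "(\<Sum>A\<in>Pow {..<m}. (norm (w A i))\<^sup>2) = N * (\<Sum>t<m. (norm (f t i))\<^sup>2)" for i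
    using sum_norm_square_signs[of "{..<m}" "\<lambda>t. f t i"] by (simp add: w_def sg_def N)
  have lp: "(\<Sum>i<n. norm (w A i) powr p) = lpn p {..<n} (w A) powr p" for A by (simp add: lpn_powr)
  have m: "lpn p {..<m} (sg A) powr p = real m" for A
    unfolding lpn_powr by (subst sum.cong[OF refl, of _ _ "\<lambda>_. 1"]) (auto simp: sg_def)
  have up: "lpn p {..<n} (w A) powr p \<le> \<Lambda> powr p * m" and low: "m \<le> \<Lambda> powr p * lpn p {..<n} (w A) powr p" for A
  proof -
    have "lpn p {..<n} (w A) \<le> \<Lambda> * lpn p {..<m} (sg A)" "lpn p {..<m} (sg A) \<le> \<Lambda> * lpn p {..<n} (w A)"
      using emb unfolding lp_embedding_def w_def by blast+
    then have "lpn p {..<n} (w A) powr p \<le> (\<Lambda> * lpn p {..<m} (sg A)) powr p"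
      "lpn p {..<m} (sg A) powr p \<le> (\<Lambda> * lpn p {..<n} (w A)) powr p"
      using p_gt_1 by (auto intro!: powr_mono2)
    then show "lpn p {..<n} (w A) powr p \<le> \<Lambda> powr p * m" "m \<le> \<Lambda> powr p * lpn p {..<n} (w A) powr p"
      using \<Lambda> by (simp_all add: powr_mult m)
  qed
  show "(\<Sum>i<n. (\<Sum>t<m. (norm (f t i))\<^sup>2) powr (p / 2)) \<le> \<Lambda> powr p * m" if p: "2 < p"
  proof -
    have "(\<Sum>t<m. (norm (f t i))\<^sup>2) powr (p / 2) \<le> (\<Sum>A\<in>Pow {..<m}. norm (w A i) powr p) / N" for i
    proof -
      have "(\<Sum>A\<in>Pow {..<m}. (norm (w A i))\<^sup>2) powr (p / 2)
          \<le> real (card (Pow {..<m})) powr (p / 2 - 1) * (\<Sum>A\<in>Pow {..<m}. (norm (w A i))\<^sup>2 powr (p / 2))"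
        using p by (intro power_mean) auto
      then have "(N * (\<Sum>t<m. (norm (f t i))\<^sup>2)) powr (p / 2)
          \<le> N powr (p / 2 - 1) * (\<Sum>A\<in>Pow {..<m}. (norm (w A i))\<^sup>2 powr (p / 2))"
        unfolding sq N_def[symmetric] .
      also have "(\<Sum>A\<in>Pow {..<m}. (norm (w A i))\<^sup>2 powr (p / 2)) = (\<Sum>A\<in>Pow {..<m}. norm (w A i) powr p)"
        by (intro sum.cong refl) (simp add: powr_powr flip: powr_numeral)
      also have "(N * (\<Sum>t<m. (norm (f t i))\<^sup>2)) powr (p / 2) =
          N powr (p / 2 - 1) * (N * (\<Sum>t<m. (norm (f t i))\<^sup>2) powr (p / 2))"
        using N(1) by (simp add: powr_mult sum_nonneg powr_diff)
      finally show ?thesis using N(1) by (simp add: pos_le_divide_eq mult.commute)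
    qed
    then have "(\<Sum>i<n. (\<Sum>t<m. (norm (f t i))\<^sup>2) powr (p / 2)) \<le> (\<Sum>i<n. (\<Sum>A\<in>Pow {..<m}. norm (w A i) powr p) / N)"
      by (intro sum_mono)
    also have "\<dots> = (\<Sum>A\<in>Pow {..<m}. lpn p {..<n} (w A) powr p) / N"
      unfolding sum_divide_distrib[symmetric] by (subst sum.swap) (simp only: lp)
    also have "\<dots> \<le> (\<Sum>A\<in>Pow {..<m}. \<Lambda> powr p * m) / N"
      using N up by (intro divide_right_mono sum_mono) auto
    also have "\<dots> = \<Lambda> powr p * m" using N(1) unfolding sum_constant N_def by (simp add: Pow_not_empty)
    finally show ?thesis .
  qed
  show "m \<le> \<Lambda> powr p * (\<Sum>i<n. (\<Sum>t<m. (norm (f t i))\<^sup>2) powr (p / 2))" if p: "p < 2"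
  proof -
    have avg: "(\<Sum>A\<in>Pow {..<m}. norm (w A i) powr p) / N \<le> (\<Sum>t<m. (norm (f t i))\<^sup>2) powr (p / 2)" for i
    proof -
      let ?S = "\<Sum>A\<in>Pow {..<m}. norm (w A i) powr p"
      have S: "0 \<le> ?S" by (intro sum_nonneg) auto
      have "?S powr (2 / p) \<le> N powr (2 / p - 1) * (\<Sum>A\<in>Pow {..<m}. (norm (w A i) powr p) powr (2 / p))"
        unfolding N_def using p p_gt_1 by (intro power_mean) auto
      also have "(\<Sum>A\<in>Pow {..<m}. (norm (w A i) powr p) powr (2 / p)) = N * (\<Sum>t<m. (norm (f t i))\<^sup>2)"
        unfolding sq[symmetric] using p_gt_1 by (intro sum.cong refl) (simp add: powr_powr)
      also have "N powr (2 / p - 1) * (N * (\<Sum>t<m. (norm (f t i))\<^sup>2)) = N powr (2 / p) * (\<Sum>t<m. (norm (f t i))\<^sup>2)"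
        using N(1) by (simp add: powr_diff)
      finally have "(?S powr (2 / p)) powr (p / 2) \<le> (N powr (2 / p) * (\<Sum>t<m. (norm (f t i))\<^sup>2)) powr (p / 2)"
        using p_gt_1 by (intro powr_mono2) auto
      then have "?S \<le> N * (\<Sum>t<m. (norm (f t i))\<^sup>2) powr (p / 2)"
        using p_gt_1 S N(1) by (simp add: powr_powr powr_mult sum_nonneg)
      then show ?thesis using N(1) by (simp add: field_simps)
    qed
    have "real m = (\<Sum>A\<in>Pow {..<m}. real m) / N" using N(1) unfolding sum_constant N_def by (simp add: Pow_not_empty)
    also have "\<dots> \<le> (\<Sum>A\<in>Pow {..<m}. \<Lambda> powr p * lpn p {..<n} (w A) powr p) / N"
      using N low by (intro divide_right_mono sum_mono) auto
    also have "\<dots> = \<Lambda> powr p * (\<Sum>i<n. (\<Sum>A\<in>Pow {..<m}. norm (w A i) powr p) / N)"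
      unfolding sum_divide_distrib[symmetric] sum_distrib_left[symmetric] lp[symmetric] by (subst sum.swap) simp
    also have "\<dots> \<le> \<Lambda> powr p * (\<Sum>i<n. (\<Sum>t<m. (norm (f t i))\<^sup>2) powr (p / 2))"
      by (intro mult_left_mono sum_mono avg) auto
    finally show ?thesis .
  qed
qed

end

context lp_exponent
begin

text \<open>
  Summed over the coordinates, both \<open>V\<close> and \<open>S powr (p / 2)\<close> are of order \<open>m\<close>, or one is bounded below
  and the other one above in the direction that \<open>power_sum_dichotomy\<close> needs. With a small \<open>\<delta>\<close> the
  terms with the maximum must therefore contribute a fixed fraction of \<open>m\<close>.
\<close>
lemma sum_max_lower_bound:
  assumes p: "p \<noteq> 2" and \<Lambda>: "1 \<le> \<Lambda>"
  obtains c :: real where "0 < c" "\<And>m n (f :: nat \<Rightarrow> nat \<Rightarrow> 'k::real_or_complex) \<tau>. lp_embedding \<Lambda> m n f \<Longrightarrow>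
    (\<And>i. i < n \<Longrightarrow> \<tau> i < m \<and> (\<forall>t<m. norm (f t i) \<le> norm (f (\<tau> i) i))) \<Longrightarrow>
    c * m \<le> (\<Sum>i<n. norm (f (\<tau> i) i) powr p)"
proof -
  define \<delta> where "\<delta> = 1 / (2 * \<Lambda> powr p * \<Lambda> powr p)"
  have \<delta>: "0 < \<delta>" using \<Lambda> by (simp add: \<delta>_def)
  obtain C where C: "0 < C"
    "\<And>(T::nat set) (z::nat \<Rightarrow> real) \<mu>. finite T \<Longrightarrow> (\<And>t. t \<in> T \<Longrightarrow> 0 \<le> z t \<and> z t \<le> \<mu>) \<Longrightarrow> 0 \<le> \<mu> \<Longrightarrow> 2 < p \<Longrightarrow>
       (\<Sum>t\<in>T. z t powr p) \<le> C * \<mu> powr p + \<delta> * (\<Sum>t\<in>T. (z t)\<^sup>2) powr (p / 2)"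
    "\<And>(T::nat set) (z::nat \<Rightarrow> real) \<mu>. finite T \<Longrightarrow> (\<And>t. t \<in> T \<Longrightarrow> 0 \<le> z t \<and> z t \<le> \<mu>) \<Longrightarrow> 0 \<le> \<mu> \<Longrightarrow> p < 2 \<Longrightarrow>
       (\<Sum>t\<in>T. (z t)\<^sup>2) powr (p / 2) \<le> C * \<mu> powr p + \<delta> * (\<Sum>t\<in>T. z t powr p)"
    by (rule power_sum_dichotomy[OF p \<delta>, where 't=nat]) (rule that; (assumption | blast))
  show thesis
  proof (rule that[of "1 / (2 * C * \<Lambda> powr p)"])
    show "0 < 1 / (2 * C * \<Lambda> powr p)" using C(1) \<Lambda> by simp
    fix m n :: nat and f :: "nat \<Rightarrow> nat \<Rightarrow> 'k" and \<tau>
    assume emb: "lp_embedding \<Lambda> m n f"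
      and \<tau>: "\<And>i. i < n \<Longrightarrow> \<tau> i < m \<and> (\<forall>t<m. norm (f t i) \<le> norm (f (\<tau> i) i))"
    define M where "M = (\<Sum>i<n. norm (f (\<tau> i) i) powr p)"
    define V where "V i = (\<Sum>t<m. norm (f t i) powr p)" for i
    define S where "S i = (\<Sum>t<m. (norm (f t i))\<^sup>2) powr (p / 2)" for i
    have V: "(\<Sum>i<n. V i) = (\<Sum>t<m. lpn p {..<n} (f t) powr p)"
      unfolding V_def lpn_powr by (rule sum.swap)
    have unit: "lpn p {..<n} (f t) powr p \<le> \<Lambda> powr p" "1 \<le> \<Lambda> powr p * lpn p {..<n} (f t) powr p" if "t < m" for t
    proof -
      show "lpn p {..<n} (f t) powr p \<le> \<Lambda> powr p"
        using lp_embedding_unit(1)[OF emb that] p_gt_1 by (intro powr_mono2) auto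
      have "1 powr p \<le> (\<Lambda> * lpn p {..<n} (f t)) powr p"
        using lp_embedding_unit(2)[OF emb that] p_gt_1 by (intro powr_mono2) auto
      then show "1 \<le> \<Lambda> powr p * lpn p {..<n} (f t) powr p" using \<Lambda> by (simp add: powr_mult)
    qed
    have Vup: "(\<Sum>i<n. V i) \<le> \<Lambda> powr p * m"
      unfolding V using sum_mono[of "{..<m}" "\<lambda>t. lpn p {..<n} (f t) powr p" "\<lambda>_. \<Lambda> powr p"] unit by (simp add: mult.commute)
    have Vlow: "m \<le> \<Lambda> powr p * (\<Sum>i<n. V i)"
      unfolding V sum_distrib_left
      using sum_mono[of "{..<m}" "\<lambda>_. 1" "\<lambda>t. \<Lambda> powr p * lpn p {..<n} (f t) powr p"] unit by simp
    have M0: "0 \<le> M" by (simp add: M_def sum_nonneg)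
    have L: "0 < \<Lambda> powr p" using \<Lambda> by simp
    have "m \<le> \<Lambda> powr p * (C * M + \<delta> * (\<Lambda> powr p * m))"
    proof (cases "2 < p")
      case True
      have "(\<Sum>i<n. V i) \<le> (\<Sum>i<n. C * norm (f (\<tau> i) i) powr p + \<delta> * S i)"
        unfolding V_def S_def using \<tau> True by (intro sum_mono C(2)) auto
      also have "\<dots> = C * M + \<delta> * (\<Sum>i<n. S i)" by (simp add: sum.distrib sum_distrib_left M_def)
      also have "\<dots> \<le> C * M + \<delta> * (\<Lambda> powr p * m)"
        using lp_embedding_square_function(1)[OF emb \<Lambda> True] \<delta> by (simp add: S_def mult_left_mono)
      finally show ?thesis using L by (intro order_trans[OF Vlow] mult_left_mono) auto
    next
      case False
      then have p2: "p < 2" using p by simp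
      have "(\<Sum>i<n. S i) \<le> (\<Sum>i<n. C * norm (f (\<tau> i) i) powr p + \<delta> * V i)"
        unfolding V_def S_def using \<tau> p2 by (intro sum_mono C(3)) auto
      also have "\<dots> = C * M + \<delta> * (\<Sum>i<n. V i)" by (simp add: sum.distrib sum_distrib_left M_def)
      also have "\<dots> \<le> C * M + \<delta> * (\<Lambda> powr p * m)" using Vup \<delta> by (simp add: mult_left_mono)
      finally have "\<Lambda> powr p * (\<Sum>i<n. S i) \<le> \<Lambda> powr p * (C * M + \<delta> * (\<Lambda> powr p * m))"
        using L by (intro mult_left_mono) auto
      then show ?thesis using lp_embedding_square_function(2)[OF emb \<Lambda> p2] unfolding S_def by (rule order_trans[rotated])
    qed
    also have "\<dots> = \<Lambda> powr p * C * M + m / 2" using L by (simp add: \<delta>_def field_simps)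
    finally show "1 / (2 * C * \<Lambda> powr p) * m \<le> (\<Sum>i<n. norm (f (\<tau> i) i) powr p)"
      using L C(1) unfolding M_def[symmetric] by (simp add: field_simps)
  qed
qed

text \<open>
  A copy of \<open>\<ell>\<^sub>p\<close> of dimension \<open>m\<close> in a bigger one is met by an operator back whose composition with the
  embedding has a trace proportional to \<open>m\<close>. For \<open>p \<noteq> 2\<close> coordinate \<open>i\<close> is assigned to the vector that is
  largest there; the vectors restricted to the coordinates assigned to them have disjoint supports, so
  their norming weights form a bounded operator, and its trace is the sum of the maxima. For \<open>p = 2\<close> no
  vector need be large anywhere (signs are an example), but the adjoint of the embedding serves instead.
\<close>
lemma large_trace:
  assumes \<Lambda>: "1 \<le> \<Lambda>"
  obtains c :: real where "0 < c" "\<And>m n (f :: nat \<Rightarrow> nat \<Rightarrow> 'k::real_or_complex). lp_embedding \<Lambda> m n f \<Longrightarrow>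
    \<exists>\<alpha> \<rho>. (\<forall>x. lpn p {..<m} (\<lambda>t. \<Sum>i<n. \<alpha> t i * x i) \<le> \<Lambda> powr p * lpn p {..<n} x) \<and>
      (\<Sum>t<m. \<Sum>i<n. \<alpha> t i * f t i) = of_real \<rho> \<and> c * m \<le> \<rho>"
proof (cases "p = 2")
  case False
  obtain c where c: "0 < c" "\<And>m n (f :: nat \<Rightarrow> nat \<Rightarrow> 'k) \<tau>. lp_embedding \<Lambda> m n f \<Longrightarrow>
    (\<And>i. i < n \<Longrightarrow> \<tau> i < m \<and> (\<forall>t<m. norm (f t i) \<le> norm (f (\<tau> i) i))) \<Longrightarrow>
    c * m \<le> (\<Sum>i<n. norm (f (\<tau> i) i) powr p)"
    by (rule sum_max_lower_bound[OF False \<Lambda>, where 'k='k]) (rule that; (assumption | blast))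
  show thesis
  proof (rule that[OF c(1)])
    fix m n and f :: "nat \<Rightarrow> nat \<Rightarrow> 'k"
    assume emb: "lp_embedding \<Lambda> m n f"
    show "\<exists>\<alpha> \<rho>. (\<forall>x. lpn p {..<m} (\<lambda>t. \<Sum>i<n. \<alpha> t i * x i) \<le> \<Lambda> powr p * lpn p {..<n} x) \<and>
      (\<Sum>t<m. \<Sum>i<n. \<alpha> t i * f t i) = of_real \<rho> \<and> c * m \<le> \<rho>"
    proof (cases "m = 0")
      case True
      then show ?thesis by (intro exI[of _ "\<lambda>_ _. 0"] exI[of _ 0]) (simp add: lpn_def)
    next
      case m: False
      have "\<exists>t<m. \<forall>t'<m. norm (f t' i) \<le> norm (f t i)" for i
      proof -
        let ?A = "(\<lambda>t. norm (f t i)) ` {..<m}"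
        have "Max ?A \<in> ?A" using m by (intro Max_in) auto
        then obtain t where t: "t < m" "Max ?A = norm (f t i)" by auto
        have "norm (f t' i) \<le> norm (f t i)" if "t' < m" for t'
          unfolding t(2)[symmetric] using that by (intro Max_ge) auto
        then show ?thesis using t(1) by blast
      qed
      then obtain \<tau> where \<tau>: "\<And>i. \<tau> i < m \<and> (\<forall>t<m. norm (f t i) \<le> norm (f (\<tau> i) i))" by metis
      define D where "D t = {i \<in> {..<n}. \<tau> i = t}" for t
      define \<alpha> where "\<alpha> t i = (if \<tau> i = t then of_real (norm (f t i) powr p) / f t i else 0)" for t i
      have group: "(\<Sum>t<m. \<Sum>i\<in>D t. u i) = (\<Sum>i<n. u i)" for u :: "nat \<Rightarrow> real"
        unfolding D_def using \<tau> by (intro sum.group) auto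
      have restr: "(\<Sum>i<n. \<alpha> t i * x i) = (\<Sum>i\<in>D t. of_real (norm (f t i) powr p) / f t i * x i)" for t x
        unfolding D_def by (intro sum.mono_neutral_cong_right) (auto simp: \<alpha>_def)
      have bound: "lpn p {..<m} (\<lambda>t. \<Sum>i<n. \<alpha> t i * x i) \<le> \<Lambda> powr p * lpn p {..<n} x" for x
      proof -
        have "norm (\<Sum>i<n. \<alpha> t i * x i) \<le> \<Lambda> powr (p - 1) * lpn p (D t) x" if "t < m" for t
        proof -
          have "norm (\<Sum>i<n. \<alpha> t i * x i) \<le> lpn p (D t) (f t) powr (p - 1) * lpn p (D t) x"
            unfolding restr by (rule weighted_sum_le) (simp add: D_def)
          also have "\<dots> \<le> \<Lambda> powr (p - 1) * lpn p (D t) x"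
            using order_trans[OF lpn_mono lp_embedding_unit(1)[OF emb that], of "D t" "f t"] p_gt_1
            by (intro mult_right_mono powr_mono2) (auto simp: D_def)
          finally show ?thesis .
        qed
        then have "(\<Sum>t<m. norm (\<Sum>i<n. \<alpha> t i * x i) powr p) \<le> (\<Sum>t<m. (\<Lambda> powr (p - 1) * lpn p (D t) x) powr p)"
          using p_gt_1 by (intro sum_mono powr_mono2) auto
        also have "\<dots> = (\<Lambda> powr (p - 1)) powr p * (\<Sum>t<m. lpn p (D t) x powr p)"
          by (simp add: powr_mult sum_distrib_left)
        also have "(\<Sum>t<m. lpn p (D t) x powr p) = lpn p {..<n} x powr p" by (simp add: lpn_powr group)
        finally have "lpn p {..<m} (\<lambda>t. \<Sum>i<n. \<alpha> t i * x i) \<le> \<Lambda> powr (p - 1) * lpn p {..<n} x"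
          by (subst lpn_le_iff) (auto simp: powr_mult)
        also have "\<dots> \<le> \<Lambda> powr p * lpn p {..<n} x"
          using \<Lambda> by (intro mult_right_mono powr_mono) auto
        finally show ?thesis .
      qed
      have "(\<Sum>t<m. \<Sum>i<n. \<alpha> t i * f t i) = (\<Sum>t<m. of_real (\<Sum>i\<in>D t. norm (f (\<tau> i) i) powr p))"
        unfolding restr of_real_sum by (intro sum.cong) (auto simp: D_def)
      also have "\<dots> = of_real (\<Sum>i<n. norm (f (\<tau> i) i) powr p)"
        unfolding of_real_sum[symmetric] group ..
      finally have "(\<Sum>t<m. \<Sum>i<n. \<alpha> t i * f t i) = of_real (\<Sum>i<n. norm (f (\<tau> i) i) powr p)" .
      then show ?thesis using bound c(2)[OF emb \<tau>] by blast
    qed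
  qed
next
  case True
  obtain cj :: "'k \<Rightarrow> 'k" where cj: "\<And>x y. cj (x + y) = cj x + cj y"
    "\<And>x y. cj (x * y) = cj x * cj y" "\<And>x. cj x * x = of_real ((norm x)\<^sup>2)" "\<And>x. norm (cj x) = norm x"
    by (rule scalar_conjugation) (rule that; assumption)
  have cj_sum: "cj (sum u T) = (\<Sum>t\<in>T. cj (u t))" if "finite T" for u and T :: "nat set"
    using that cj(4)[of 0] by induction (auto simp: cj(1))
  have sq: "lpn p I a ^ 2 = (\<Sum>i\<in>I. (norm (a i))\<^sup>2)" for I :: "nat set" and a :: "nat \<Rightarrow> 'k"
    using lpn_powr[of I a] lpn_nonneg[of I a] True by (cases "lpn p I a = 0") auto
  show thesis
  proof (rule that[of "1 / \<Lambda>\<^sup>2"])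
    fix m n and f :: "nat \<Rightarrow> nat \<Rightarrow> 'k"
    assume emb: "lp_embedding \<Lambda> m n f"
    define \<rho> where "\<rho> = (\<Sum>t<m. (lpn p {..<n} (f t))\<^sup>2)"
    have tr: "(\<Sum>t<m. \<Sum>i<n. cj (f t i) * f t i) = of_real \<rho>"
      by (simp add: \<rho>_def sq cj(3))
    have "1 / \<Lambda>\<^sup>2 \<le> (lpn p {..<n} (f t))\<^sup>2" if "t < m" for t
    proof -
      have "1\<^sup>2 \<le> (\<Lambda> * lpn p {..<n} (f t))\<^sup>2"
        using lp_embedding_unit(2)[OF emb that] by (intro power_mono) auto
      then show ?thesis using \<Lambda> by (simp add: power_mult_distrib field_simps)
    qed
    then have \<rho>: "1 / \<Lambda>\<^sup>2 * m \<le> \<rho>"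
      using sum_mono[of "{..<m}" "\<lambda>_. 1 / \<Lambda>\<^sup>2" "\<lambda>t. (lpn p {..<n} (f t))\<^sup>2"] by (simp add: \<rho>_def)
    have bound: "lpn p {..<m} (\<lambda>t. \<Sum>i<n. cj (f t i) * x i) \<le> \<Lambda> powr p * lpn p {..<n} x" for x
    proof -
      define y where "y t = (\<Sum>i<n. cj (f t i) * x i)" for t
      define w where "w i = (\<Sum>t<m. y t * f t i)" for i
      define Y where "Y = lpn p {..<m} y"
      have "of_real (Y\<^sup>2) = (\<Sum>t<m. cj (y t) * y t)" by (simp add: Y_def sq cj(3))
      also have "\<dots> = (\<Sum>i<n. \<Sum>t<m. cj (y t * f t i) * x i)"
        by (subst sum.swap) (simp add: y_def sum_distrib_left cj(2) mult.assoc)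
      also have "\<dots> = (\<Sum>i<n. cj (w i) * x i)" by (simp add: w_def cj_sum sum_distrib_right)
      finally have "Y\<^sup>2 = norm (\<Sum>i<n. cj (w i) * x i)" by (metis abs_power2 norm_of_real)
      also have "\<dots> \<le> (\<Sum>i<n. norm (w i) powr (p - 1) * norm (x i))"
        using True by (intro order_trans[OF norm_sum] sum_mono) (simp add: norm_mult cj(4))
      also have "\<dots> \<le> lpn p {..<n} (\<lambda>i. norm (w i)) powr (p - 1) * lpn p {..<n} (\<lambda>i. norm (x i))"
        by (intro Hoelder_sum) auto
      also have "\<dots> = lpn p {..<n} w * lpn p {..<n} x" using True by (simp add: lpn_def)
      also have "\<dots> \<le> \<Lambda> * Y * lpn p {..<n} x"
        using emb by (intro mult_right_mono) (auto simp: lp_embedding_def w_def[abs_def] Y_def)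
      finally have "Y * Y \<le> Y * (\<Lambda> * lpn p {..<n} x)" by (simp add: power2_eq_square mult.commute mult.left_commute)
      then have "Y \<le> \<Lambda> * lpn p {..<n} x"
        using \<Lambda> by (cases "Y = 0") (auto simp: Y_def mult_le_cancel_left less_le)
      also have "\<dots> \<le> \<Lambda> powr p * lpn p {..<n} x"
        using \<Lambda> powr_mono[of 1 p \<Lambda>] p_gt_1 by (intro mult_right_mono) auto
      finally show ?thesis unfolding Y_def y_def .
    qed
    show "\<exists>\<alpha> \<rho>. (\<forall>x. lpn p {..<m} (\<lambda>t. \<Sum>i<n. \<alpha> t i * x i) \<le> \<Lambda> powr p * lpn p {..<n} x) \<and>
      (\<Sum>t<m. \<Sum>i<n. \<alpha> t i * f t i) = of_real \<rho> \<and> 1 / \<Lambda>\<^sup>2 * m \<le> \<rho>"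
      using bound tr \<rho> by (intro exI[of _ "\<lambda>t i. cj (f t i)"] exI[of _ \<rho>]) blast
  qed (use \<Lambda> in simp)
qed

end

section \<open>Complemented copies of \<open>\<ell>\<^sub>p\<close>\<close>

context lp_space
begin

lemma sum_scale_reindex:
  assumes "finite I" "inj_on h J" "h ` J \<subseteq> I"
  shows "\<exists>b. (\<Sum>j\<in>J. s (a j) (e (h j))) = (\<Sum>i\<in>I. s (b i) (e i)) \<and> lpn p J a = lpn p I b"
proof -
  define b where "b i = (if i \<in> h ` J then a (the_inv_into J h i) else 0)" for i
  have b: "b (h j) = a j" if "j \<in> J" for j
    using that the_inv_into_f_f[OF assms(2) that] by (simp add: b_def)
  have "(\<Sum>i\<in>I. s (b i) (e i)) = (\<Sum>i\<in>h ` J. s (b i) (e i))"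
    using assms by (intro sum.mono_neutral_right) (auto simp: b_def)
  also have "\<dots> = (\<Sum>j\<in>J. s (a j) (e (h j)))"
    unfolding sum.reindex[OF assms(2)] o_def by (intro sum.cong) (auto simp: b)
  finally have 1: "(\<Sum>j\<in>J. s (a j) (e (h j))) = (\<Sum>i\<in>I. s (b i) (e i))" by simp
  have "(\<Sum>i\<in>I. norm (b i) powr p) = (\<Sum>i\<in>h ` J. norm (b i) powr p)"
    using assms by (intro sum.mono_neutral_right) (auto simp: b_def)
  also have "\<dots> = (\<Sum>j\<in>J. norm (a j) powr p)"
    unfolding sum.reindex[OF assms(2)] o_def by (intro sum.cong) (auto simp: b)
  finally show ?thesis using 1 by (auto simp: lpn_def)
qed

lemma upper_estimate_reindex:
  assumes "finite I" "inj_on h J" "h ` J \<subseteq> I" "\<And>a. norm (\<Sum>i\<in>I. s (a i) (e i)) \<le> C * lpn p I a"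
  shows "norm (\<Sum>j\<in>J. s (a j) (e (h j))) \<le> C * lpn p J a"
  using sum_scale_reindex[OF assms(1-3), of a e] assms(4) by auto

lemma infinite_dimensional_independent:
  assumes "\<not> finite_dimensional s UNIV"
  shows "\<exists>F. finite F \<and> card F = m \<and> independent F"
proof (induction m)
  case 0
  then show ?case by (intro exI[of _ "{}"]) (simp add: independent_empty)
next
  case (Suc m)
  then obtain F where F: "finite F" "card F = m" "independent F" by blast
  then have "span F \<noteq> UNIV" using assms unfolding finite_dimensional_def by blast
  then obtain x where x: "x \<notin> span F" by blast
  then have "x \<notin> F" using span_base by blast
  then show ?case using F x independent_insertI[OF x F(3)] by (intro exI[of _ "insert x F"]) auto
qed

lemma functional_mult:
  assumes "module_hom s ((*) :: 'k \<Rightarrow> 'k \<Rightarrow> 'k) g"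
  shows "module_hom s ((*) :: 'k \<Rightarrow> 'k \<Rightarrow> 'k) (\<lambda>x. c * g x)"
  by (rule module_hom_functionalI)
    (simp_all add: module_hom.add[OF assms] module_hom.scale[OF assms] distrib_left mult.left_commute)

text \<open>
  Take a copy of \<open>\<ell>\<^sub>p\<close> in the space. In every larger finite dimensional \<open>\<ell>\<^sub>p\<close> space around it there is an operator
  back onto the copy with large trace. A cluster point of these operators is defined everywhere, still has a
  large trace, and its diagonal is bounded. Hence a fixed proportion of the diagonal entries is
  bounded away from zero, and the corresponding coordinates are kept and normalised.
\<close>
lemma bounded_diagonal_system:
  assumes L: "Lp_property p s \<Lambda>" and inf: "\<not> finite_dimensional s UNIV"
  obtains C where "1 \<le> C" "\<And>m::nat. \<exists>e \<phi>. (\<forall>a. norm (\<Sum>t<m. s (a t) (e t)) \<le> C * lpn p {..<m} a) \<and>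
    (\<forall>t<m. module_hom s (*) (\<phi> t)) \<and> (\<forall>y. lpn p {..<m} (\<lambda>t. \<phi> t y) \<le> C * norm y) \<and> (\<forall>t<m. \<phi> t (e t) = 1)"
proof -
  have \<Lambda>: "1 \<le> \<Lambda>" using L by (simp add: Lp_property_def)
  then have \<Lambda>2: "1 \<le> \<Lambda> * \<Lambda>" using mult_mono[of 1 \<Lambda> 1 \<Lambda>] by simp
  obtain c :: real where c: "0 < c" and trace: "\<And>m n (f :: nat \<Rightarrow> nat \<Rightarrow> 'k). lp_embedding (\<Lambda> * \<Lambda>) m n f \<Longrightarrow>
    \<exists>\<alpha> \<rho>. (\<forall>x. lpn p {..<m} (\<lambda>t. \<Sum>i<n. \<alpha> t i * x i) \<le> (\<Lambda> * \<Lambda>) powr p * lpn p {..<n} x) \<and>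
      (\<Sum>t<m. \<Sum>i<n. \<alpha> t i * f t i) = of_real \<rho> \<and> c * m \<le> \<rho>"
    by (rule large_trace[OF \<Lambda>2, where 'k='k]) (rule that; (assumption | blast))
  define K where "K = (\<Lambda> * \<Lambda>) powr p * \<Lambda>"
  have K: "0 < K" using \<Lambda> by (simp add: K_def)
  define C where "C = max (\<Lambda> * \<Lambda>) (4 / c * K)"
  show thesis
  proof (rule that[of C])
    show "1 \<le> C" using \<Lambda>2 by (simp add: C_def)
    fix m :: nat
    \<comment> \<open>Diagonal entries are at most \<open>K * \<Lambda>\<close> and sum up to at least \<open>c / 2 * m0\<close>; this \<open>m0\<close> leaves \<open>m\<close> entries above \<open>c / 4\<close>.\<close>
    define m0 where "m0 = nat \<lceil>4 * (K * \<Lambda>) * m / c\<rceil>"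
    have m0: "4 * (K * \<Lambda>) * m / c \<le> real m0" unfolding m0_def by linarith
    obtain F0 where F0: "finite F0" "card F0 = m0" "independent F0"
      using infinite_dimensional_independent[OF inf] by blast
    obtain n0 e0 where e0: "lp_basis p s \<Lambda> n0 e0" "F0 \<subseteq> range (\<lambda>a. \<Sum>i<n0. s (a i) (e0 i))"
      using L F0(1) unfolding Lp_property_def by blast
    have "m0 \<le> n0"
    proof -
      have "F0 \<subseteq> span (e0 ` {..<n0})"
        using e0(2) by (auto intro!: span_sum span_scale intro: span_base)
      then have "card F0 \<le> card (e0 ` {..<n0})"
        using independent_span_bound[OF _ F0(3)] by blast
      also have "\<dots> \<le> n0" using card_image_le[of "{..<n0}" e0] by simp
      finally show ?thesis using F0(2) by simp
    qed
    then have sub: "\<exists>b. (\<Sum>j<m0. s (a j) (e0 j)) = (\<Sum>i<n0. s (b i) (e0 i)) \<and> lpn p {..<m0} a = lpn p {..<n0} b" for a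
      using sum_scale_reindex[of "{..<n0}" "\<lambda>x. x" "{..<m0}" a e0] by auto
    have e0': "lpn p {..<m0} a \<le> \<Lambda> * norm (\<Sum>t<m0. s (a t) (e0 t))" "norm (\<Sum>t<m0. s (a t) (e0 t)) \<le> \<Lambda> * lpn p {..<m0} a" for a
      using sub[of a] e0(1) unfolding lp_basis_def by metis+
    have norm_e0: "norm (e0 t) \<le> \<Lambda>" if "t < m0" for t
    proof -
      have "(\<Sum>j<m0. s (if j = t then 1 else 0) (e0 j)) = e0 t"
        using that by (simp add: if_distrib[of "\<lambda>x. s x _"] cong: if_cong)
      then show ?thesis using e0'(2)[of "\<lambda>j. if j = t then 1 else 0"] lpn_unit[OF that, where 'a='k] by simp
    qed
    define Y0 where "Y0 = e0 ` {..<m0}"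
    have Y0: "finite Y0" by (simp add: Y0_def)
    define V where "V n e = range (\<lambda>a. \<Sum>i<n. s (a i) (e i))" for n :: nat and e
    have "\<exists>n e. lp_basis p s \<Lambda> n e \<and> F \<union> Y0 \<subseteq> V n e" if "finite F" for F
      using L Y0 that unfolding Lp_property_def V_def by blast
    then obtain N e where "\<And>F. finite F \<Longrightarrow> lp_basis p s \<Lambda> (N F) (e F)"
        "\<And>F. finite F \<Longrightarrow> F \<union> Y0 \<subseteq> V (N F) (e F)" by metis
    note Ne = this(1) this(2)[unfolded V_def]
    define W where "W F = range (\<lambda>a. \<Sum>i<N F. s (a i) (e F i))" for F
    define Q where "Q F co \<longleftrightarrow> (\<forall>x\<in>W F. (\<Sum>i<N F. s (co x i) (e F i)) = x) \<and>
        (\<forall>x\<in>W F. \<forall>y\<in>W F. \<forall>i<N F. co (x + y) i = co x i + co y i) \<and>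
        (\<forall>x\<in>W F. \<forall>c. \<forall>i<N F. co (s c x) i = c * co x i)" for F co
    have "\<exists>co. Q F co" if F: "finite F" for F
      unfolding Q_def W_def using \<Lambda> by (intro lp_basis_coordinates[OF Ne(1)[OF F]]) simp
    then obtain co where "\<And>F. finite F \<Longrightarrow> Q F (co F)" by metis
    then have co: "\<And>F x. finite F \<Longrightarrow> x \<in> W F \<Longrightarrow> (\<Sum>i<N F. s (co F x i) (e F i)) = x"
        "\<And>F x y i. finite F \<Longrightarrow> x \<in> W F \<Longrightarrow> y \<in> W F \<Longrightarrow> i < N F \<Longrightarrow> co F (x + y) i = co F x i + co F y i"
        "\<And>F x c i. finite F \<Longrightarrow> x \<in> W F \<Longrightarrow> i < N F \<Longrightarrow> co F (s c x) i = c * co F x i"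
      unfolding Q_def by simp_all
    have lpn_co: "lpn p {..<N F} (co F x) \<le> \<Lambda> * norm x" if "finite F" "x \<in> W F" for F x
      using Ne(1)[OF that(1)] co(1)[OF that] unfolding lp_basis_def by metis
    have emb: "lp_embedding (\<Lambda> * \<Lambda>) m0 (N F) (\<lambda>t. co F (e0 t))" if F: "finite F" for F
      unfolding lp_embedding_def
    proof (intro allI)
      fix a :: "nat \<Rightarrow> 'k"
      have mem: "e0 t \<in> W F" if "t < m0" for t using Ne(2)[OF F] that by (auto simp: W_def Y0_def)
      have "(\<Sum>t<m0. s (a t) (e0 t)) = (\<Sum>t<m0. s (a t) (\<Sum>i<N F. s (co F (e0 t) i) (e F i)))"
        by (intro sum.cong refl) (simp add: co(1)[OF F mem])
      also have "\<dots> = (\<Sum>i<N F. s (\<Sum>t<m0. a t * co F (e0 t) i) (e F i))" by (rule sum_scale_swap)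
      finally have eq: "(\<Sum>t<m0. s (a t) (e0 t)) = (\<Sum>i<N F. s (\<Sum>t<m0. a t * co F (e0 t) i) (e F i))" .
      have b: "lpn p {..<N F} b \<le> \<Lambda> * norm (\<Sum>i<N F. s (b i) (e F i))" "norm (\<Sum>i<N F. s (b i) (e F i)) \<le> \<Lambda> * lpn p {..<N F} b" for b
        using Ne(1)[OF F] unfolding lp_basis_def by blast+
      have "lpn p {..<m0} a \<le> \<Lambda> * norm (\<Sum>t<m0. s (a t) (e0 t))" by (rule e0')
      also have "\<dots> \<le> \<Lambda> * (\<Lambda> * lpn p {..<N F} (\<lambda>i. \<Sum>t<m0. a t * co F (e0 t) i))"
        unfolding eq using \<Lambda> by (intro mult_left_mono b) auto
      finally have 1: "lpn p {..<m0} a \<le> \<Lambda> * \<Lambda> * lpn p {..<N F} (\<lambda>i. \<Sum>t<m0. a t * co F (e0 t) i)"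
        by (simp add: mult.assoc)
      have "lpn p {..<N F} (\<lambda>i. \<Sum>t<m0. a t * co F (e0 t) i) \<le> \<Lambda> * norm (\<Sum>t<m0. s (a t) (e0 t))"
        unfolding eq by (rule b)
      also have "\<dots> \<le> \<Lambda> * (\<Lambda> * lpn p {..<m0} a)"
        using \<Lambda> by (intro mult_left_mono e0') auto
      finally show "lpn p {..<m0} a \<le> \<Lambda> * \<Lambda> * lpn p {..<N F} (\<lambda>i. \<Sum>t<m0. a t * co F (e0 t) i) \<and>
          lpn p {..<N F} (\<lambda>i. \<Sum>t<m0. a t * co F (e0 t) i) \<le> \<Lambda> * \<Lambda> * lpn p {..<m0} a"
        using 1 by (simp add: mult.assoc)
    qed
    define R where "R F \<alpha> \<rho> \<longleftrightarrow> (\<forall>x. lpn p {..<m0} (\<lambda>t. \<Sum>i<N F. \<alpha> t i * x i) \<le> (\<Lambda> * \<Lambda>) powr p * lpn p {..<N F} x) \<and>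
      (\<Sum>t<m0. \<Sum>i<N F. \<alpha> t i * co F (e0 t) i) = of_real \<rho> \<and> c * m0 \<le> \<rho>" for F \<alpha> \<rho>
    have "\<exists>\<alpha> \<rho>. R F \<alpha> \<rho>" if "finite F" for F unfolding R_def by (rule trace[OF emb[OF that]])
    then obtain \<alpha> \<rho> where "\<And>F. finite F \<Longrightarrow> R F (\<alpha> F) (\<rho> F)" by metis
    then have \<alpha>: "\<And>F x. finite F \<Longrightarrow> lpn p {..<m0} (\<lambda>t. \<Sum>i<N F. \<alpha> F t i * x i) \<le> (\<Lambda> * \<Lambda>) powr p * lpn p {..<N F} x"
      and \<rho>: "\<And>F. finite F \<Longrightarrow> (\<Sum>t<m0. \<Sum>i<N F. \<alpha> F t i * co F (e0 t) i) = of_real (\<rho> F)"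
        "\<And>F. finite F \<Longrightarrow> c * m0 \<le> \<rho> F"
      unfolding R_def by simp_all
    define H where "H F x t = (\<Sum>i<N F. \<alpha> F t i * co F x i)" for F x t
    obtain g :: "'x \<Rightarrow> nat \<Rightarrow> 'k" where g: "\<And>t. t \<in> {..<m0} \<Longrightarrow> module_hom s (*) (\<lambda>x. g x t)"
      "\<And>x. lpn p {..<m0} (g x) \<le> K * norm x"
      "\<And>S F0 \<eta>. finite S \<Longrightarrow> finite F0 \<Longrightarrow> 0 < \<eta> \<Longrightarrow>
        \<exists>F. finite F \<and> F0 \<subseteq> F \<and> (\<forall>x\<in>S. \<forall>t\<in>{..<m0}. norm (H F x t - g x t) < \<eta>)"
    proof (rule extension_from_finite_sets[of "{..<m0}" K W H])
      show "finite {..<m0}" "0 \<le> K" using K by auto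
      show "F \<subseteq> W F" if "finite F" for F using Ne(2)[OF that] by (simp add: W_def)
      show "lpn p {..<m0} (H F x) \<le> K * norm x" if "finite F" "x \<in> W F" for F x
      proof -
        have "lpn p {..<m0} (H F x) \<le> (\<Lambda> * \<Lambda>) powr p * lpn p {..<N F} (co F x)"
          unfolding H_def by (rule \<alpha>[OF that(1)])
        also have "\<dots> \<le> (\<Lambda> * \<Lambda>) powr p * (\<Lambda> * norm x)"
          using lpn_co[OF that] by (intro mult_left_mono) auto
        finally show ?thesis by (simp add: K_def)
      qed
    qed (auto simp: H_def co distrib_left sum.distrib sum_distrib_left mult.left_commute)
    obtain F where F: "finite F" "\<And>x t. x \<in> Y0 \<Longrightarrow> t < m0 \<Longrightarrow> norm (H F x t - g x t) < c / 2"
      using g(3)[OF Y0 finite.emptyI, of "c / 2"] c by auto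
    define d where "d t = norm (g (e0 t) t)" for t
    have d: "d t \<le> K * \<Lambda>" if "t < m0" for t
    proof -
      have "d t \<le> lpn p {..<m0} (g (e0 t))" unfolding d_def using that by (intro norm_le_lpn) auto
      also note g(2)[of "e0 t"]
      also have "K * norm (e0 t) \<le> K * \<Lambda>" using norm_e0[OF that] K by (intro mult_left_mono) auto
      finally show ?thesis .
    qed
    have "c * m0 \<le> norm (\<Sum>t<m0. H F (e0 t) t)"
      using \<rho>[OF F(1)] by (simp add: H_def)
    also have "\<dots> \<le> (\<Sum>t<m0. d t + c / 2)"
    proof (intro order_trans[OF norm_sum] sum_mono)
      fix t assume "t \<in> {..<m0}"
      then have "norm (H F (e0 t) t - g (e0 t) t) < c / 2" by (intro F(2)) (auto simp: Y0_def)
      then show "norm (H F (e0 t) t) \<le> d t + c / 2"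
        using norm_triangle_ineq2[of "H F (e0 t) t" "g (e0 t) t"] by (simp add: d_def)
    qed
    also have "\<dots> = (\<Sum>t<m0. d t) + c / 2 * m0" by (simp add: sum.distrib)
    finally have sum_d: "c / 2 * m0 \<le> (\<Sum>t<m0. d t)" by (simp add: field_simps)
    define T where "T = {t\<in>{..<m0}. c / 4 \<le> d t}"
    have T: "finite T" "T \<subseteq> {..<m0}" by (auto simp: T_def)
    have "(\<Sum>t<m0. d t) \<le> (\<Sum>t<m0. (if t \<in> T then K * \<Lambda> else 0) + c / 4)"
      using d c K \<Lambda> by (intro sum_mono) (auto simp: T_def add_increasing2)
    also have "\<dots> = (\<Sum>t<m0. if t \<in> T then K * \<Lambda> else 0) + c / 4 * m0" by (simp add: sum.distrib)
    also have "(\<Sum>t<m0. if t \<in> T then K * \<Lambda> else 0) = real (card T) * (K * \<Lambda>)"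
      using T by (simp add: sum.If_cases Int_absorb1)
    finally have "c / 4 * m0 \<le> real (card T) * (K * \<Lambda>)" using sum_d by (simp add: field_simps)
    moreover have "K * \<Lambda> * m \<le> c / 4 * m0" using m0 c by (simp add: field_simps)
    ultimately have "(K * \<Lambda>) * m \<le> (K * \<Lambda>) * real (card T)" by (simp add: mult.commute)
    then have "m \<le> card T" using K \<Lambda> by simp
    then obtain T' where T': "T' \<subseteq> T" "card T' = m" "finite T'" by (rule obtain_subset_with_card_n)
    obtain h where "bij_betw h {..<m} T'"
      using ex_bij_betw_nat_finite[OF T'(3)] T'(2) by (auto simp: lessThan_atLeast0)
    then have h: "inj_on h {..<m}" "h ` {..<m} \<subseteq> T" using T'(1) by (auto simp: bij_betw_def)
    have hT: "h t < m0" "c / 4 \<le> norm (g (e0 (h t)) (h t))" if "t < m" for t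
      using h(2) that by (auto simp: T_def d_def)
    define \<phi> where "\<phi> t x = inverse (g (e0 (h t)) (h t)) * g x (h t)" for t x
    show "\<exists>e \<phi>. (\<forall>a. norm (\<Sum>t<m. s (a t) (e t)) \<le> C * lpn p {..<m} a) \<and>
      (\<forall>t<m. module_hom s (*) (\<phi> t)) \<and> (\<forall>y. lpn p {..<m} (\<lambda>t. \<phi> t y) \<le> C * norm y) \<and> (\<forall>t<m. \<phi> t (e t) = 1)"
    proof (intro exI[of _ "\<lambda>t. e0 (h t)"] exI[of _ \<phi>] conjI allI impI)
      fix a :: "nat \<Rightarrow> 'k"
      have "norm (\<Sum>t<m. s (a t) (e0 (h t))) \<le> \<Lambda> * lpn p {..<m} a"
        by (rule upper_estimate_reindex[OF finite_lessThan h(1) order_trans[OF h(2) T(2)] e0'(2)])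
      also have "\<dots> \<le> C * lpn p {..<m} a"
      proof (intro mult_right_mono)
        have "\<Lambda> * 1 \<le> \<Lambda> * \<Lambda>" using \<Lambda> by (intro mult_left_mono) auto
        then show "\<Lambda> \<le> C" unfolding C_def by simp
      qed simp
      finally show "norm (\<Sum>t<m. s (a t) (e0 (h t))) \<le> C * lpn p {..<m} a" .
    next
      fix t assume t: "t < m"
      then have "module_hom s (*) (\<lambda>x. g x (h t))" using g(1) hT(1) by blast
      then show "module_hom s (*) (\<phi> t)" unfolding \<phi>_def[abs_def] by (rule functional_mult)
      have "g (e0 (h t)) (h t) \<noteq> 0" using hT(2)[OF t] c by (metis divide_pos_pos norm_zero not_le zero_less_numeral)
      then show "\<phi> t (e0 (h t)) = 1" unfolding \<phi>_def by (rule left_inverse)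
    next
      fix y
      have "norm (\<phi> t y) \<le> norm (of_real (4 / c) * g y (h t))" if "t < m" for t
      proof -
        have "inverse (norm (g (e0 (h t)) (h t))) \<le> inverse (c / 4)"
          using hT(2)[OF that] c by (intro le_imp_inverse_le) auto
        from mult_right_mono[OF this, of "norm (g y (h t))"] show ?thesis
          using c by (simp add: \<phi>_def norm_mult norm_inverse norm_divide)
      qed
      then have "lpn p {..<m} (\<lambda>t. \<phi> t y) \<le> lpn p {..<m} (\<lambda>t. of_real (4 / c) * g y (h t))"
        by (intro lpn_mono) auto
      also have "\<dots> = 4 / c * lpn p {..<m} (\<lambda>t. g y (h t))" unfolding lpn_scale using c by (simp add: norm_divide)
      also have "lpn p {..<m} (\<lambda>t. g y (h t)) = lpn p (h ` {..<m}) (g y)" by (rule lpn_reindex[OF h(1), symmetric])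
      also have "4 / c * lpn p (h ` {..<m}) (g y) \<le> 4 / c * (K * norm y)"
        using order_trans[OF lpn_mono g(2)[of y], of "h ` {..<m}" "g y"] h(2) T(2) c by (intro mult_left_mono) auto
      also have "\<dots> = (4 / c * K) * norm y" by simp
      also have "\<dots> \<le> C * norm y" by (intro mult_right_mono) (auto simp: C_def)
      finally show "lpn p {..<m} (\<lambda>t. \<phi> t y) \<le> C * norm y" .
    qed
  qed
qed

end

context lp_space
begin

text \<open>
  The rank representation need not be biorthogonal: it only serves to bound the projection by finitely many
  vectors and functionals.
\<close>
definition finite_rank_projection :: "('x \<Rightarrow> 'x) \<Rightarrow> bool" where
  "finite_rank_projection Q \<longleftrightarrow> (\<forall>x. Q (Q x) = Q x) \<and>
     (\<exists>(r::nat) f \<psi>. (\<forall>j<r. \<exists>K. functional K (\<psi> j)) \<and> (\<forall>x. Q x = (\<Sum>j<r. s (\<psi> j x) (f j))))"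

lemma functional_hom: "functional K f \<Longrightarrow> module_hom s (*) f"
  by (simp add: bounded_hom_def)

lemma functional_bound: "functional K f \<Longrightarrow> norm (f x) \<le> K * norm x"
  by (simp add: bounded_hom_def)

lemma functional_mono: "functional K f \<Longrightarrow> K \<le> K' \<Longrightarrow> functional K' f"
  unfolding bounded_hom_def by (meson mult_right_mono norm_ge_zero order_trans)

lemma functional_sum_vector:
  assumes "module_hom s ((*) :: 'k \<Rightarrow> 'k \<Rightarrow> 'k) f"
  shows "f (\<Sum>i\<in>I. s (a i) (e i)) = (\<Sum>i\<in>I. a i * f (e i))"
  by (simp add: module_hom.sum[OF assms] module_hom.scale[OF assms])

lemma finite_rank_linear:
  assumes "\<And>j. j < (r::nat) \<Longrightarrow> module_hom s (*) (\<psi> j)"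
  shows "(\<Sum>j<r. s (\<psi> j (x + y)) (f j)) = (\<Sum>j<r. s (\<psi> j x) (f j)) + (\<Sum>j<r. s (\<psi> j y) (f j))"
    "(\<Sum>j<r. s (\<psi> j (s c x)) (f j)) = s c (\<Sum>j<r. s (\<psi> j x) (f j))"
proof -
  show "(\<Sum>j<r. s (\<psi> j (x + y)) (f j)) = (\<Sum>j<r. s (\<psi> j x) (f j)) + (\<Sum>j<r. s (\<psi> j y) (f j))"
    unfolding sum.distrib[symmetric] by (intro sum.cong refl) (simp add: module_hom.add[OF assms] scale_left_distrib)
  show "(\<Sum>j<r. s (\<psi> j (s c x)) (f j)) = s c (\<Sum>j<r. s (\<psi> j x) (f j))"
    unfolding scale_sum_right by (intro sum.cong refl) (simp add: module_hom.scale[OF assms])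
qed

lemma module_hom_selfI:
  assumes "\<And>x y. f (x + y) = f x + f y" "\<And>c x. f (s c x) = s c (f x)"
  shows "module_hom s s f"
  using assms vector_space_axioms by (simp add: module_hom_iff module_iff_vector_space)

lemma finite_rank_projection_hom:
  assumes "finite_rank_projection Q"
  shows "module_hom s s Q"
proof -
  obtain r :: nat and f \<psi> where r: "\<And>j. j < r \<Longrightarrow> \<exists>K. functional K (\<psi> j)" "\<And>x. Q x = (\<Sum>j<r. s (\<psi> j x) (f j))"
    using assms unfolding finite_rank_projection_def by blast
  show ?thesis
    by (rule module_hom_selfI; unfold r(2); rule finite_rank_linear; use r(1) functional_hom in blast)
qed

lemma sum_lessThan_add: "(\<Sum>j<r + n. g j) = (\<Sum>j<r. g j) + (\<Sum>i<n. g (r + i))" for g :: "nat \<Rightarrow> 'b::comm_monoid_add"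
  by (induction n) (simp_all add: add.assoc)

lemma finite_rank_projection_add:
  assumes Q: "finite_rank_projection Q" and \<phi>: "\<And>i. i < n \<Longrightarrow> \<exists>K. functional K (\<phi> i)"
    and bi: "\<And>i j. i < n \<Longrightarrow> j < n \<Longrightarrow> \<phi> i (e j) = (if i = j then 1 else 0)"
    and e: "\<And>i. i < n \<Longrightarrow> Q (e i) = 0" and kill: "\<And>i x. i < n \<Longrightarrow> \<phi> i (Q x) = 0"
    and Q'_def: "\<And>x. Q' x = Q x + (\<Sum>i<(n::nat). s (\<phi> i x) (e i))"
  shows "finite_rank_projection Q'" "Q' (Q x) = Q x" "Q (Q' x) = Q x"
    "i < n \<Longrightarrow> Q' (e i) = e i" "i < n \<Longrightarrow> \<phi> i (Q' x) = \<phi> i x"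
proof -
  have idem: "Q (Q x) = Q x" for x using Q by (simp add: finite_rank_projection_def)
  have hom: "module_hom s s Q" by (rule finite_rank_projection_hom[OF Q])
  have \<phi>h: "module_hom s (*) (\<phi> i)" if "i < n" for i using \<phi>[OF that] functional_hom by blast
  show 1: "Q' (Q x) = Q x" for x by (simp add: Q'_def idem kill)
  show 2: "Q (Q' x) = Q x" for x
    by (simp add: Q'_def module_hom.add[OF hom] module_hom.sum[OF hom] module_hom.scale[OF hom] idem e)
  show 3: "\<phi> i (Q' x) = \<phi> i x" if "i < n" for i x
  proof -
    have "(\<Sum>j<n. \<phi> j x * \<phi> i (e j)) = (\<Sum>j<n. if j = i then \<phi> j x else 0)"
      using that by (intro sum.cong refl) (simp add: bi)
    then show ?thesis
      using that by (simp add: Q'_def module_hom.add[OF \<phi>h[OF that]] functional_sum_vector[OF \<phi>h[OF that]] kill)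
  qed
  show "Q' (e i) = e i" if "i < n" for i
  proof -
    have "(\<Sum>j<n. s (\<phi> j (e i)) (e j)) = (\<Sum>j<n. if j = i then e j else 0)"
      using that by (intro sum.cong refl) (simp add: bi)
    then show ?thesis using that by (simp add: Q'_def e)
  qed
  show "finite_rank_projection Q'"
    unfolding finite_rank_projection_def
  proof (intro conjI allI)
    show "Q' (Q' x) = Q' x" for x
    proof -
      have "Q' (Q' x) = Q (Q' x) + (\<Sum>i<n. s (\<phi> i (Q' x)) (e i))" by (simp add: Q'_def)
      also have "\<dots> = Q x + (\<Sum>i<n. s (\<phi> i x) (e i))" by (simp add: 2 3)
      finally show ?thesis by (simp add: Q'_def)
    qed
    obtain r :: nat and f \<psi> where r: "\<And>j. j < r \<Longrightarrow> \<exists>K. functional K (\<psi> j)" "\<And>x. Q x = (\<Sum>j<r. s (\<psi> j x) (f j))"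
      using Q unfolding finite_rank_projection_def by blast
    define f' where "f' j = (if j < r then f j else e (j - r))" for j
    define \<psi>' where "\<psi>' j = (if j < r then \<psi> j else \<phi> (j - r))" for j
    show "\<exists>(r::nat) f \<psi>. (\<forall>j<r. \<exists>K. functional K (\<psi> j)) \<and> (\<forall>x. Q' x = (\<Sum>j<r. s (\<psi> j x) (f j)))"
    proof (intro exI[of _ "r + n"] exI[of _ f'] exI[of _ \<psi>'] conjI allI impI)
      show "\<exists>K. functional K (\<psi>' j)" if "j < r + n" for j
        using that r(1)[of j] \<phi>[of "j - r"] by (cases "j < r") (auto simp: \<psi>'_def)
      show "Q' x = (\<Sum>j<r + n. s (\<psi>' j x) (f' j))" for x
        unfolding sum_lessThan_add Q'_def r(2) by (simp add: f'_def \<psi>'_def)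
    qed
  qed
qed

text \<open>
  A vector has few large coordinates because the \<open>p\<close>-th powers of the coordinates have a bounded sum.
\<close>
lemma count_large_coordinates:
  assumes "0 < \<eta>" "0 \<le> C" "norm y \<le> K" "lpn p {..<m} (\<lambda>t. \<phi> t y) \<le> C * norm y"
  shows "real (card {t\<in>{..<m::nat}. \<eta> < norm (\<phi> t y)}) \<le> (C * K / \<eta>) powr p"
proof -
  define S where "S = {t\<in>{..<m}. \<eta> < norm (\<phi> t y)}"
  have "real (card S) * \<eta> powr p = (\<Sum>t\<in>S. \<eta> powr p)" by simp
  also have "\<dots> \<le> (\<Sum>t\<in>S. norm (\<phi> t y) powr p)"
    using assms p_gt_1 by (intro sum_mono powr_mono2) (auto simp: S_def)
  also have "\<dots> \<le> (\<Sum>t<m. norm (\<phi> t y) powr p)" by (intro sum_mono2) (auto simp: S_def)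
  also have "\<dots> \<le> (C * K) powr p"
  proof -
    have "C * norm y \<le> C * K" using assms by (intro mult_left_mono) auto
    then have "lpn p {..<m} (\<lambda>t. \<phi> t y) \<le> C * K" using assms(4) by linarith
    moreover have "0 \<le> C * K" using assms order_trans[OF norm_ge_zero assms(3)] by simp
    ultimately show ?thesis by (subst (asm) lpn_le_iff) auto
  qed
  finally have "real (card S) * \<eta> powr p \<le> (C * K) powr p" .
  moreover have "(C * K / \<eta>) powr p = (C * K) powr p / \<eta> powr p"
    using assms order_trans[OF norm_ge_zero assms(3)] by (simp add: powr_divide)
  ultimately show ?thesis using assms(1) unfolding S_def[symmetric] by (simp add: pos_le_divide_eq)
qed

text \<open>
  The values of a functional on a copy of the unit vector basis lie in the dual space of \<open>\<ell>\<^sub>p\<close>: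
  test the functional on the sum of the vectors with large values, with signs that prevent cancellation.
\<close>
lemma count_large_values:
  assumes \<eta>: "0 < \<eta>" and C: "0 \<le> C" "0 \<le> K" and \<psi>: "functional K \<psi>"
    and e: "\<And>a. norm (\<Sum>t<m. s (a t) (e t)) \<le> C * lpn p {..<m} a"
  shows "real (card {t\<in>{..<m::nat}. \<eta> < norm (\<psi> (e t))}) \<le> (K * C / \<eta>) powr (p / (p - 1))"
proof -
  define S where "S = {t\<in>{..<m}. \<eta> < norm (\<psi> (e t))}"
  define a :: "nat \<Rightarrow> 'k" where "a t = of_real (norm (\<psi> (e t))) / \<psi> (e t)" for t
  have S: "finite S" "S \<subseteq> {..<m}" by (auto simp: S_def)
  have ne: "\<psi> (e t) \<noteq> 0" if "t \<in> S" for t using that \<eta> by (auto simp: S_def)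
  show ?thesis
  proof (cases "S = {}")
    case True
    then show ?thesis unfolding S_def[symmetric] by simp
  next
    case False
    then have c: "0 < real (card S)" using S by (simp add: card_gt_0_iff)
    have "\<psi> (\<Sum>t\<in>S. s (a t) (e t)) = (\<Sum>t\<in>S. of_real (norm (\<psi> (e t))))"
      unfolding functional_sum_vector[OF functional_hom[OF \<psi>]] by (intro sum.cong refl) (simp add: a_def ne)
    then have "norm (\<psi> (\<Sum>t\<in>S. s (a t) (e t))) = (\<Sum>t\<in>S. norm (\<psi> (e t)))"
      by (simp flip: of_real_sum add: sum_nonneg)
    moreover have "(\<Sum>t\<in>S. \<eta>) \<le> (\<Sum>t\<in>S. norm (\<psi> (e t)))" by (intro sum_mono) (auto simp: S_def)
    ultimately have "real (card S) * \<eta> \<le> norm (\<psi> (\<Sum>t\<in>S. s (a t) (e t)))" by simp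
    also have "\<dots> \<le> K * norm (\<Sum>t\<in>S. s (a t) (e t))" by (rule functional_bound[OF \<psi>])
    also have "\<dots> \<le> K * (C * lpn p S a)"
      using C S upper_estimate_reindex[of "{..<m}" "\<lambda>x. x" S e C a] e by (intro mult_left_mono) auto
    also have "lpn p S a = real (card S) powr (1 / p)"
    proof -
      have "(\<Sum>t\<in>S. norm (a t) powr p) = (\<Sum>t\<in>S. 1)"
        by (intro sum.cong refl) (simp add: a_def norm_divide ne)
      then show ?thesis by (simp add: lpn_def)
    qed
    finally have "real (card S) * \<eta> \<le> K * (C * real (card S) powr (1 / p))" .
    then have "real (card S) / real (card S) powr (1 / p) \<le> K * C / \<eta>"
      using c \<eta> by (simp add: field_simps)
    also have "real (card S) / real (card S) powr (1 / p) = real (card S) powr ((p - 1) / p)"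
      using c p_gt_1 by (simp add: powr_diff diff_divide_distrib)
    finally have "(real (card S) powr ((p - 1) / p)) powr (p / (p - 1)) \<le> (K * C / \<eta>) powr (p / (p - 1))"
      using p_gt_1 by (intro powr_mono2) auto
    then show ?thesis using c p_gt_1 unfolding S_def[symmetric] by (simp add: powr_powr)
  qed
qed

end

context lp_space
begin

text \<open>
  All but a bounded number of the indices satisfy the finitely many smallness conditions, and the number
  of exceptions does not depend on \<open>m\<close>.
\<close>
lemma pick_index:
  assumes ne: "\<And>f. f \<in> V \<Longrightarrow> norm f \<le> K" and fin: "finite V" "finite (U :: ('x \<Rightarrow> 'k) set)" "finite T"
    and U: "\<And>\<psi>. \<psi> \<in> U \<Longrightarrow> functional K \<psi>" and \<eta>: "0 < \<eta>" and C: "0 \<le> C" "0 \<le> K"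
    and e: "\<And>a. norm (\<Sum>t<m. s (a t) (e t)) \<le> C * lpn p {..<m} a"
    and \<phi>: "\<And>y. lpn p {..<m} (\<lambda>t. \<phi> t y) \<le> C * norm y"
    and B: "(C * K / \<eta>) powr p \<le> real B" "(K * C / \<eta>) powr (p / (p - 1)) \<le> real B"
    and m: "card T + (card V + card U) * B < m"
  obtains t where "t < m" "t \<notin> T" "\<And>f. f \<in> V \<Longrightarrow> norm (\<phi> t f) \<le> \<eta>" "\<And>\<psi>. \<psi> \<in> U \<Longrightarrow> norm (\<psi> (e t)) \<le> \<eta>"
proof -
  define bad where "bad = T \<union> (\<Union>f\<in>V. {t\<in>{..<m}. \<eta> < norm (\<phi> t f)}) \<union> (\<Union>\<psi>\<in>U. {t\<in>{..<m}. \<eta> < norm (\<psi> (e t))})"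
  have 1: "card {t\<in>{..<m}. \<eta> < norm (\<phi> t f)} \<le> B" if "f \<in> V" for f
    using count_large_coordinates[OF \<eta> C(1), of f K m \<phi>] ne[OF that] \<phi>[of f] B(1) by linarith
  have 2: "card {t\<in>{..<m}. \<eta> < norm (\<psi> (e t))} \<le> B" if "\<psi> \<in> U" for \<psi>
    using count_large_values[OF \<eta> C U[OF that] e] B(2) by linarith
  have "card (\<Union>f\<in>V. {t\<in>{..<m}. \<eta> < norm (\<phi> t f)}) \<le> (\<Sum>f\<in>V. B)"
    by (rule order_trans[OF card_UN_le[OF fin(1)] sum_mono]) (rule 1)
  moreover have "card (\<Union>\<psi>\<in>U. {t\<in>{..<m}. \<eta> < norm (\<psi> (e t))}) \<le> (\<Sum>\<psi>\<in>U. B)"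
    by (rule order_trans[OF card_UN_le[OF fin(2)] sum_mono]) (rule 2)
  moreover have "card bad \<le> card T + card (\<Union>f\<in>V. {t\<in>{..<m}. \<eta> < norm (\<phi> t f)}) + card (\<Union>\<psi>\<in>U. {t\<in>{..<m}. \<eta> < norm (\<psi> (e t))})"
    unfolding bad_def by (meson add_right_mono card_Un_le order_trans)
  ultimately have "card bad < card {..<m}" using m by (simp add: algebra_simps)
  moreover have "finite bad" using fin by (auto simp: bad_def)
  ultimately have "\<not> {..<m} \<subseteq> bad" by (meson card_mono not_less)
  then obtain t where "t < m" "t \<notin> bad" by auto
  then show thesis by (intro that[of t]) (auto simp: bad_def not_less)
qed

text \<open>
  A copy of \<open>\<ell>\<^sub>p\<close> together with a bounded coordinate map, decoupled from the range and the kernel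
  of \<open>Q\<close>.
\<close>
definition biorthogonal_block :: "real \<Rightarrow> ('x \<Rightarrow> 'x) \<Rightarrow> nat \<Rightarrow> (nat \<Rightarrow> 'x) \<Rightarrow> (nat \<Rightarrow> 'x \<Rightarrow> 'k) \<Rightarrow> bool" where
  "biorthogonal_block C Q n e \<phi> \<longleftrightarrow>
     (\<forall>i<n. Q (e i) = 0 \<and> functional C (\<phi> i) \<and> (\<forall>x. \<phi> i (Q x) = 0) \<and> (\<forall>j<n. \<phi> i (e j) = (if i = j then 1 else 0))) \<and>
     (\<forall>a. norm (\<Sum>i<n. s (a i) (e i)) \<le> C * lpn p {..<n} a) \<and> (\<forall>x. lpn p {..<n} (\<lambda>i. \<phi> i x) \<le> C * norm x)"

text \<open>
  The point is that the constant depends neither on the dimension \<open>n\<close> nor on the projection \<open>Q\<close>.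
  Start from a diagonal system much longer than \<open>n\<close> and choose its members one at a time such that the new
  pair almost annihilates the range of \<open>Q\<close> and the pairs chosen before. Composing with the
  complementary projection and renormalising makes the relations exact at the cost of an error as
  small as desired, so the bounds of the diagonal system survive.
\<close>
lemma biorthogonal_block_exists:
  assumes L: "Lp_property p s \<Lambda>" and inf: "\<not> finite_dimensional s UNIV"
  obtains C where "0 < C" "\<And>n Q. finite_rank_projection Q \<Longrightarrow> \<exists>e \<phi>. biorthogonal_block C Q n e \<phi>"
proof -
  obtain C0 where C0: "1 \<le> C0" and raw: "\<And>m::nat. \<exists>e \<phi>. (\<forall>a. norm (\<Sum>t<m. s (a t) (e t)) \<le> C0 * lpn p {..<m} a) \<and>
    (\<forall>t<m. module_hom s (*) (\<phi> t)) \<and> (\<forall>y. lpn p {..<m} (\<lambda>t. \<phi> t y) \<le> C0 * norm y) \<and> (\<forall>t<m. \<phi> t (e t) = 1)"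
    by (rule bounded_diagonal_system[OF L inf]) (rule that; (assumption | blast))
  show thesis
  proof (rule that[of "(C0 + 1)"])
    show "0 < (C0 + 1)" using C0 by simp
    fix n Q assume Q: "finite_rank_projection Q"
    obtain r :: nat and f \<psi> where r: "\<And>j. j < r \<Longrightarrow> \<exists>K. functional K (\<psi> j)" "\<And>x. Q x = (\<Sum>j<r. s (\<psi> j x) (f j))"
      using Q unfolding finite_rank_projection_def by blast
    have idem: "Q (Q x) = Q x" for x using Q by (simp add: finite_rank_projection_def)
    have Qh: "module_hom s s Q" by (rule finite_rank_projection_hom[OF Q])
    obtain k where k: "\<And>j. j < r \<Longrightarrow> functional (k j) (\<psi> j)" using r(1) by metis
    define K where "K = C0 + 1 + (\<Sum>j<r. \<bar>k j\<bar> + norm (f j))"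
    have Kge: "\<bar>k j\<bar> + norm (f j) \<le> (\<Sum>j<r. \<bar>k j\<bar> + norm (f j))" if "j < r" for j
      using that by (intro member_le_sum) auto
    have K: "C0 + 1 \<le> K" "\<And>j. j < r \<Longrightarrow> norm (f j) \<le> K" "\<And>j. j < r \<Longrightarrow> functional K (\<psi> j)"
    proof -
      show "C0 + 1 \<le> K" unfolding K_def by (simp add: sum_nonneg)
      show "norm (f j) \<le> K" if "j < r" for j
        using Kge[OF that] C0 abs_ge_zero[of "k j"] unfolding K_def by linarith
      have "k j \<le> K" if "j < r" for j
        using Kge[OF that] C0 norm_ge_zero[of "f j"] unfolding K_def by linarith
      then show "functional K (\<psi> j)" if "j < r" for j using k that functional_mono by blast
    qed
    \<comment> \<open>\<open>\<eta>0\<close> bounds the change of each vector and functional, such that \<open>n\<close> changes amount to at most \<open>1\<close>; \<open>\<eta>\<close> is the smallness demanded of the new pair.\<close>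
    define \<eta>0 where "\<eta>0 = 1 / (real n + 1)"
    define \<delta> where "\<delta> = \<eta>0 / (4 * C0)"
    define \<eta> where "\<eta> = \<delta> / (C0 * K * (real r + real n + 1))"
    have \<eta>0: "0 < \<eta>0" "\<eta>0 \<le> 1" by (auto simp: \<eta>0_def)
    have \<delta>: "0 < \<delta>" "\<delta> \<le> 1 / 4" using \<eta>0 C0 by (auto simp: \<delta>_def field_simps)
    have K0: "0 < K" using K(1) C0 by linarith
    have \<eta>: "0 < \<eta>" using \<delta> K0 C0 by (simp add: \<eta>_def)
    have small: "C0 * ((real r + real j) * (\<eta> * K)) \<le> \<delta>" if "j \<le> n" for j
    proof -
      have "C0 * ((real r + real j) * (\<eta> * K)) = \<delta> * ((real r + real j) / (real r + real n + 1))"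
      proof -
        have "C0 * (x * (\<delta> / (C0 * K * D) * K)) = \<delta> * (x / D)" for x D :: real using C0 K0 by simp
        then show ?thesis unfolding \<eta>_def .
      qed
      also have "\<dots> \<le> \<delta>" using that \<delta> by (intro mult_left_le) auto
      finally show ?thesis .
    qed
    have small': "(real r + real j) * (\<eta> * K) \<le> \<delta>" if "j \<le> n" for j
    proof -
      have "1 * ((real r + real j) * (\<eta> * K)) \<le> C0 * ((real r + real j) * (\<eta> * K))"
        using C0 \<eta> K0 by (intro mult_right_mono) auto
      then show ?thesis using small[OF that] by linarith
    qed
    obtain B :: nat where B: "(C0 * K / \<eta>) powr p \<le> real B" "(K * C0 / \<eta>) powr (p / (p - 1)) \<le> real B"
    proof
      show "(C0 * K / \<eta>) powr p \<le> real (nat \<lceil>(C0 * K / \<eta>) powr p\<rceil> + nat \<lceil>(K * C0 / \<eta>) powr (p / (p - 1))\<rceil>)"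
        "(K * C0 / \<eta>) powr (p / (p - 1)) \<le> real (nat \<lceil>(C0 * K / \<eta>) powr p\<rceil> + nat \<lceil>(K * C0 / \<eta>) powr (p / (p - 1))\<rceil>)"
        by linarith+
    qed
    \<comment> \<open>More indices than can be excluded: at most \<open>n\<close> that are used, and at most \<open>B\<close> for each of \<open>r + n\<close> vectors and \<open>r + n\<close> functionals.\<close>
    define m where "m = n + ((r + n) + (r + n)) * B + 1"
    obtain e \<phi> where e: "\<And>a. norm (\<Sum>t<m. s (a t) (e t)) \<le> C0 * lpn p {..<m} a"
      and \<phi>h: "\<And>t. t < m \<Longrightarrow> module_hom s (*) (\<phi> t)" and \<phi>: "\<And>y. lpn p {..<m} (\<lambda>t. \<phi> t y) \<le> C0 * norm y"
      and \<phi>e: "\<And>t. t < m \<Longrightarrow> \<phi> t (e t) = 1"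
      using raw[of m] by blast
    have \<phi>b: "norm (\<phi> t y) \<le> C0 * norm y" if "t < m" for t y
      using norm_le_lpn[of "{..<m}" t "\<lambda>t. \<phi> t y"] \<phi>[of y] that by simp
    have eb: "norm (e t) \<le> C0" if "t < m" for t
    proof -
      have "(\<Sum>j<m. s (if j = t then 1 else 0) (e j)) = e t"
        using that by (simp add: if_distrib[of "\<lambda>x. s x _"] cong: if_cong)
      then show ?thesis using e[of "\<lambda>j. if j = t then 1 else 0"] lpn_unit[OF that, where 'a='k] by simp
    qed
    have "\<exists>\<tau> e' \<phi>'. inj_on \<tau> {..<j} \<and> (\<forall>i<j. \<tau> i < m \<and> Q (e' i) = 0 \<and> (\<forall>x. \<phi>' i (Q x) = 0) \<and> module_hom s (*) (\<phi>' i) \<and>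
        (\<forall>l<j. \<phi>' i (e' l) = (if i = l then 1 else 0)) \<and>
        norm (e' i - e (\<tau> i)) \<le> \<eta>0 \<and> (\<forall>y. norm (\<phi>' i y - \<phi> (\<tau> i) y) \<le> \<eta>0 * norm y))" if "j \<le> n" for j
      using that
    proof (induction j)
      case 0
      then show ?case by simp
    next
      case (Suc j)
      then obtain \<tau> e' \<phi>' where inj: "inj_on \<tau> {..<j}" and *: "\<forall>i<j. \<tau> i < m \<and> Q (e' i) = 0 \<and> (\<forall>x. \<phi>' i (Q x) = 0) \<and>
        module_hom s (*) (\<phi>' i) \<and> (\<forall>l<j. \<phi>' i (e' l) = (if i = l then 1 else 0)) \<and>
        norm (e' i - e (\<tau> i)) \<le> \<eta>0 \<and> (\<forall>y. norm (\<phi>' i y - \<phi> (\<tau> i) y) \<le> \<eta>0 * norm y)"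
        by auto
      then have ih: "\<And>i. i < j \<Longrightarrow> \<tau> i < m" "\<And>i. i < j \<Longrightarrow> Q (e' i) = 0" "\<And>i x. i < j \<Longrightarrow> \<phi>' i (Q x) = 0"
        "\<And>i. i < j \<Longrightarrow> module_hom s (*) (\<phi>' i)" "\<And>i l. i < j \<Longrightarrow> l < j \<Longrightarrow> \<phi>' i (e' l) = (if i = l then 1 else 0)"
        "\<And>i. i < j \<Longrightarrow> norm (e' i - e (\<tau> i)) \<le> \<eta>0" "\<And>i y. i < j \<Longrightarrow> norm (\<phi>' i y - \<phi> (\<tau> i) y) \<le> \<eta>0 * norm y"
        by blast+
      have e'K: "norm (e' i) \<le> K" if "i < j" for i
        using norm_triangle_ineq2[of "e' i" "e (\<tau> i)"] ih(6)[OF that] eb[OF ih(1)[OF that]] \<eta>0 K(1) by linarith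
      have \<phi>'K: "functional K (\<phi>' i)" if "i < j" for i
        unfolding bounded_hom_def
      proof (intro conjI allI ih(4) that)
        fix x
        have "norm (\<phi>' i x) \<le> \<eta>0 * norm x + C0 * norm x"
          using norm_triangle_ineq2[of "\<phi>' i x" "\<phi> (\<tau> i) x"] ih(7)[OF that, of x] \<phi>b[OF ih(1)[OF that], of x] by linarith
        also have "\<dots> = (\<eta>0 + C0) * norm x" by (simp add: algebra_simps)
        also have "\<dots> \<le> K * norm x" using \<eta>0 K(1) by (intro mult_right_mono) auto
        finally show "norm (\<phi>' i x) \<le> K * norm x" .
      qed
      define V where "V = f ` {..<r} \<union> e' ` {..<j}"
      define U where "U = \<psi> ` {..<r} \<union> \<phi>' ` {..<j}"
      have VU: "card V \<le> r + j" "card U \<le> r + j" "card (\<tau> ` {..<j}) \<le> j"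
        unfolding V_def U_def
        by (rule order_trans[OF card_Un_le add_mono], use card_image_le[of "{..<_::nat}"] in force, use card_image_le[of "{..<_::nat}"] in force)+
          (use card_image_le[of "{..<j}" \<tau>] in force)
      have "card (\<tau> ` {..<j}) + (card V + card U) * B \<le> j + ((r + j) + (r + j)) * B"
        by (intro add_mono mult_right_mono VU) auto
      also have "\<dots> \<le> n + ((r + n) + (r + n)) * B" using Suc.prems by (intro add_mono mult_right_mono) auto
      also have "\<dots> < m" by (simp add: m_def)
      finally have card: "card (\<tau> ` {..<j}) + (card V + card U) * B < m" .
      obtain t where t: "t < m" "t \<notin> \<tau> ` {..<j}" "\<And>f. f \<in> V \<Longrightarrow> norm (\<phi> t f) \<le> \<eta>" "\<And>\<psi>. \<psi> \<in> U \<Longrightarrow> norm (\<psi> (e t)) \<le> \<eta>"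
      proof (rule pick_index[of V K U "\<tau> ` {..<j}" \<eta> C0 e m \<phi> B])
        show "norm f \<le> K" if "f \<in> V" for f using that e'K K(2) by (auto simp: V_def)
        show "functional K \<psi>" if "\<psi> \<in> U" for \<psi> using that \<phi>'K K(3) by (auto simp: U_def)
        show "finite V" "finite U" by (auto simp: V_def U_def)
        show "finite (\<tau> ` {..<j})" by simp
        show "0 \<le> C0" "0 \<le> K" using C0 K0 by auto
      qed (rule \<eta> e \<phi> B card | (rule that; (assumption | blast)))+
      define P where "P x = Q x + (\<Sum>i<j. s (\<phi>' i x) (e' i))" for x
      have \<phi>'K': "\<exists>K. functional K (\<phi>' i)" if "i < j" for i using \<phi>'K[OF that] by blast
      note add = finite_rank_projection_add[OF Q, of j \<phi>' e' P, OF \<phi>'K' ih(5) ih(2) ih(3) P_def]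
      have Pfr: "finite_rank_projection P" by (rule add(1))
      have PQ: "P (Q x) = Q x" and QP: "Q (P x) = Q x" and Pe: "i < j \<Longrightarrow> P (e' i) = e' i"
        and \<phi>P: "i < j \<Longrightarrow> \<phi>' i (P x) = \<phi>' i x" for x i
        using add(2-5) by blast+
      note Ph = finite_rank_projection_hom[OF Pfr]
      define w where "w = e t - P (e t)"
      define \<rho> where "\<rho> = 1 - \<phi> t (P (e t))"
      define \<omega> where "\<omega> x = inverse \<rho> * (\<phi> t x - \<phi> t (P x))" for x
      have \<phi>th: "module_hom s (*) (\<phi> t)" by (rule \<phi>h[OF t(1)])
      have Pet: "norm (P (e t)) \<le> (real r + real j) * (\<eta> * K)"
      proof -
        have "norm (P (e t)) \<le> (\<Sum>l<r. norm (s (\<psi> l (e t)) (f l))) + (\<Sum>i<j. norm (s (\<phi>' i (e t)) (e' i)))"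
          unfolding P_def r(2) by (intro order_trans[OF norm_triangle_ineq] add_mono norm_sum)
        also have "\<dots> \<le> (\<Sum>l<r. \<eta> * K) + (\<Sum>i<j. \<eta> * K)"
          unfolding norm_scale using t(4) K(2) e'K \<eta> by (intro add_mono sum_mono mult_mono) (auto simp: U_def)
        finally show ?thesis by (simp add: algebra_simps)
      qed
      have \<phi>tP: "norm (\<phi> t (P y)) \<le> (real r + real j) * (\<eta> * K) * norm y" for y
      proof -
        have "\<phi> t (P y) = (\<Sum>l<r. \<psi> l y * \<phi> t (f l)) + (\<Sum>i<j. \<phi>' i y * \<phi> t (e' i))"
          unfolding P_def r(2) module_hom.add[OF \<phi>th] functional_sum_vector[OF \<phi>th] ..
        then have "norm (\<phi> t (P y)) \<le> (\<Sum>l<r. norm (\<psi> l y * \<phi> t (f l))) + (\<Sum>i<j. norm (\<phi>' i y * \<phi> t (e' i)))"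
          by (simp only:) (intro order_trans[OF norm_triangle_ineq] add_mono norm_sum)
        also have "\<dots> \<le> (\<Sum>l<r. (K * norm y) * \<eta>) + (\<Sum>i<j. (K * norm y) * \<eta>)"
          unfolding norm_mult using t(3) functional_bound[OF K(3)] functional_bound[OF \<phi>'K] K0
          by (intro add_mono sum_mono mult_mono) (auto simp: V_def)
        finally show ?thesis by (simp add: algebra_simps)
      qed
      have jn: "j \<le> n" using Suc.prems by simp
      have r1: "norm (\<phi> t (P (e t))) \<le> \<delta>"
      proof -
        have "norm (\<phi> t (P (e t))) \<le> C0 * norm (P (e t))" by (rule \<phi>b[OF t(1)])
        also have "\<dots> \<le> C0 * ((real r + real j) * (\<eta> * K))" using Pet C0 by (intro mult_left_mono) auto
        also have "\<dots> \<le> \<delta>" by (rule small[OF jn])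
        finally show ?thesis .
      qed
      have \<rho>: "1 / 2 \<le> norm \<rho>" "norm (1 - \<rho>) \<le> \<delta>"
        using norm_triangle_ineq2[of 1 "\<phi> t (P (e t))"] r1 \<delta>(2) by (auto simp: \<rho>_def)
      then have \<rho>0: "\<rho> \<noteq> 0" by auto
      have inv\<rho>: "norm (inverse \<rho>) \<le> 2"
        using le_imp_inverse_le[OF \<rho>(1)] by (simp add: norm_inverse)
      have Qw: "Q w = 0" by (simp add: w_def module_hom.diff[OF Qh] QP)
      have \<phi>'w: "\<phi>' i w = 0" if "i < j" for i
        by (simp add: w_def module_hom.diff[OF ih(4)[OF that]] \<phi>P[OF that])
      have Pw: "P w = 0" by (simp add: P_def Qw \<phi>'w)
      have \<omega>Q: "\<omega> (Q x) = 0" for x by (simp add: \<omega>_def PQ)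
      have \<omega>e: "\<omega> (e' i) = 0" if "i < j" for i by (simp add: \<omega>_def Pe[OF that])
      have \<omega>w: "\<omega> w = 1"
      proof -
        have "\<phi> t w = \<rho>" by (simp add: w_def module_hom.diff[OF \<phi>th] \<phi>e[OF t(1)] \<rho>_def)
        then show ?thesis using \<rho>0 by (simp add: \<omega>_def Pw module_hom.zero[OF \<phi>th])
      qed
      have \<omega>h: "module_hom s (*) \<omega>"
        unfolding \<omega>_def[abs_def]
        by (rule functional_mult, rule module_hom_functionalI)
          (simp_all add: module_hom.add[OF \<phi>th] module_hom.scale[OF \<phi>th] module_hom.add[OF Ph] module_hom.scale[OF Ph] right_diff_distrib)
      have \<omega>b: "norm (\<omega> y - \<phi> t y) \<le> \<eta>0 * norm y" for y
      proof -
        have "\<omega> y - \<phi> t y = inverse \<rho> * ((1 - \<rho>) * \<phi> t y - \<phi> t (P y))"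
          using \<rho>0 by (simp add: \<omega>_def field_simps)
        then have "norm (\<omega> y - \<phi> t y) = norm (inverse \<rho>) * norm ((1 - \<rho>) * \<phi> t y - \<phi> t (P y))"
          by (simp only: norm_mult)
        also have "\<dots> \<le> 2 * (\<delta> * (C0 * norm y) + \<delta> * norm y)"
        proof (intro mult_mono inv\<rho> order_trans[OF norm_triangle_ineq4] add_mono)
          show "norm ((1 - \<rho>) * \<phi> t y) \<le> \<delta> * (C0 * norm y)"
            unfolding norm_mult using \<delta> by (intro mult_mono \<rho>(2) \<phi>b[OF t(1)]) auto
          show "norm (\<phi> t (P y)) \<le> \<delta> * norm y"
            using \<phi>tP[of y] mult_right_mono[OF small'[OF jn], of "norm y"] by simp
        qed auto
        also have "\<dots> \<le> 2 * (\<delta> * (C0 * norm y) + \<delta> * (C0 * norm y))"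
          using C0 \<delta> by (intro mult_left_mono add_mono) (auto simp: mult_le_cancel_right1)
        also have "\<dots> = \<eta>0 * norm y" using C0 by (simp add: \<delta>_def)
        finally show ?thesis .
      qed
      have wb: "norm (w - e t) \<le> \<eta>0"
      proof -
        have "norm (w - e t) \<le> \<delta>" using Pet small'[OF jn] by (simp add: w_def)
        also have "\<delta> \<le> \<eta>0" using \<eta>0 C0 by (simp add: \<delta>_def field_simps)
        finally show ?thesis .
      qed
      show ?case
      proof (intro exI[of _ "\<tau>(j := t)"] exI[of _ "e'(j := w)"] exI[of _ "\<phi>'(j := \<omega>)"] conjI)
        show "inj_on (\<tau>(j := t)) {..<Suc j}"
          using inj t(2) by (auto simp: inj_on_def lessThan_Suc)
        show "\<forall>i<Suc j. (\<tau>(j := t)) i < m \<and> Q ((e'(j := w)) i) = 0 \<and> (\<forall>x. (\<phi>'(j := \<omega>)) i (Q x) = 0) \<and>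
          module_hom s (*) ((\<phi>'(j := \<omega>)) i) \<and> (\<forall>l<Suc j. (\<phi>'(j := \<omega>)) i ((e'(j := w)) l) = (if i = l then 1 else 0)) \<and>
          norm ((e'(j := w)) i - e ((\<tau>(j := t)) i)) \<le> \<eta>0 \<and> (\<forall>y. norm ((\<phi>'(j := \<omega>)) i y - \<phi> ((\<tau>(j := t)) i) y) \<le> \<eta>0 * norm y)"
          unfolding less_Suc_eq using ih t(1) Qw \<phi>'w \<omega>Q \<omega>e \<omega>w \<omega>h \<omega>b wb by auto
      qed
    qed
    from this[OF order_refl] obtain \<tau> e' \<phi>' where inj: "inj_on \<tau> {..<n}" and *: "\<forall>i<n. \<tau> i < m \<and> Q (e' i) = 0 \<and>
      (\<forall>x. \<phi>' i (Q x) = 0) \<and> module_hom s (*) (\<phi>' i) \<and> (\<forall>l<n. \<phi>' i (e' l) = (if i = l then 1 else 0)) \<and>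
      norm (e' i - e (\<tau> i)) \<le> \<eta>0 \<and> (\<forall>y. norm (\<phi>' i y - \<phi> (\<tau> i) y) \<le> \<eta>0 * norm y)"
      by blast
    have \<tau>: "\<tau> ` {..<n} \<subseteq> {..<m}" using * by auto
    have upper: "norm (\<Sum>i<n. s (a i) (e' i)) \<le> (C0 + 1) * lpn p {..<n} a" for a
    proof -
      have "(\<Sum>i<n. s (a i) (e' i)) = (\<Sum>i<n. s (a i) (e (\<tau> i))) + (\<Sum>i<n. s (a i) (e' i - e (\<tau> i)))"
        by (simp add: scale_right_diff_distrib sum_subtractf)
      also have "norm \<dots> \<le> C0 * lpn p {..<n} a + real n * \<eta>0 * lpn p {..<n} a"
        using upper_estimate_reindex[OF finite_lessThan inj \<tau> e, of a]
          norm_sum_scale_le[of "{..<n}" "\<lambda>i. e' i - e (\<tau> i)" \<eta>0 a] * \<eta>0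
        by (intro order_trans[OF norm_triangle_ineq] add_mono) auto
      also have "real n * \<eta>0 \<le> 1" by (simp add: \<eta>0_def)
      finally show ?thesis by (simp add: mult_right_mono algebra_simps)
    qed
    have coord: "lpn p {..<n} (\<lambda>i. \<phi>' i x) \<le> (C0 + 1) * norm x" for x
    proof -
      have "lpn p {..<n} (\<lambda>i. \<phi>' i x) = lpn p {..<n} (\<lambda>i. \<phi> (\<tau> i) x + (\<phi>' i x - \<phi> (\<tau> i) x))" by simp
      also have "\<dots> \<le> lpn p {..<n} (\<lambda>i. \<phi> (\<tau> i) x) + lpn p {..<n} (\<lambda>i. \<phi>' i x - \<phi> (\<tau> i) x)"
        by (rule lpn_triangle) simp
      also have "\<dots> \<le> C0 * norm x + real n * (\<eta>0 * norm x)"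
      proof (intro add_mono)
        have "lpn p {..<n} (\<lambda>i. \<phi> (\<tau> i) x) = lpn p (\<tau> ` {..<n}) (\<lambda>t. \<phi> t x)"
          by (rule lpn_reindex[OF inj, symmetric])
        also have "\<dots> \<le> lpn p {..<m} (\<lambda>t. \<phi> t x)" using \<tau> by (intro lpn_mono) auto
        finally show "lpn p {..<n} (\<lambda>i. \<phi> (\<tau> i) x) \<le> C0 * norm x" using \<phi>[of x] by linarith
        show "lpn p {..<n} (\<lambda>i. \<phi>' i x - \<phi> (\<tau> i) x) \<le> real n * (\<eta>0 * norm x)"
          using lpn_le_card[of "{..<n}" "\<eta>0 * norm x" "\<lambda>i. \<phi>' i x - \<phi> (\<tau> i) x"] * \<eta>0 by simp
      qed
      also have "real n * (\<eta>0 * norm x) \<le> 1 * norm x"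
        unfolding mult.assoc[symmetric] by (intro mult_right_mono) (auto simp: \<eta>0_def)
      finally show ?thesis by (simp add: algebra_simps)
    qed
    have "functional ((C0 + 1)) (\<phi>' i)" if "i < n" for i
      unfolding bounded_hom_def using * that coord norm_le_lpn[of "{..<n}" i "\<lambda>i. \<phi>' i _"]
      by (meson finite_lessThan lessThan_iff order_trans)
    then show "\<exists>e \<phi>. biorthogonal_block ((C0 + 1)) Q n e \<phi>"
      unfolding biorthogonal_block_def using * upper coord by (intro exI[of _ e'] exI[of _ \<phi>']) blast
  qed
qed

end

section \<open>Biorthogonal sequences\<close>

context lp_space
begin

lemma finite_rank_projection_bounded:
  assumes "finite_rank_projection Q"
  obtains K where "0 \<le> K" "\<And>x. norm (Q x) \<le> K * norm x"
proof -
  obtain r :: nat and f \<psi> where r: "\<And>j. j < r \<Longrightarrow> \<exists>K. functional K (\<psi> j)" "\<And>x. Q x = (\<Sum>j<r. s (\<psi> j x) (f j))"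
    using assms unfolding finite_rank_projection_def by blast
  then obtain k where k: "\<And>j. j < r \<Longrightarrow> functional (k j) (\<psi> j)" by metis
  have kn: "norm (\<psi> j x) \<le> \<bar>k j\<bar> * norm x" if "j < r" for j x
    using functional_bound[OF k[OF that], of x] by (meson abs_ge_self mult_right_mono norm_ge_zero order_trans)
  show thesis
  proof (rule that[of "\<Sum>j<r. \<bar>k j\<bar> * norm (f j)"])
    show "0 \<le> (\<Sum>j<r. \<bar>k j\<bar> * norm (f j))" by (simp add: sum_nonneg)
    fix x
    have "norm (Q x) \<le> (\<Sum>j<r. \<bar>k j\<bar> * norm x * norm (f j))"
      unfolding r(2) using kn by (intro order_trans[OF norm_sum] sum_mono) (simp add: norm_scale mult_right_mono)
    then show "norm (Q x) \<le> (\<Sum>j<r. \<bar>k j\<bar> * norm (f j)) * norm x"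
      by (simp only: sum_distrib_right mult.assoc) (simp add: mult.commute mult.left_commute)
  qed
qed

text \<open>
  The usual order of projections, by inclusion of ranges and reverse inclusion of kernels.
\<close>
definition projection_le :: "('x \<Rightarrow> 'x) \<Rightarrow> ('x \<Rightarrow> 'x) \<Rightarrow> bool" where
  "projection_le Q Q' \<longleftrightarrow> (\<forall>x. Q' (Q x) = Q x \<and> Q (Q' x) = Q x)"

lemma projection_le_trans: "projection_le Q Q' \<Longrightarrow> projection_le Q' Q'' \<Longrightarrow> projection_le Q Q''"
  unfolding projection_le_def by metis

text \<open>
  Project the missing part \<open>y - Q y\<close> by a norming functional \<open>\<zeta>\<close>. The functional vanishes on the kernel
  of the new projection, and unlike the projection it has a bound that does not deteriorate when the
  construction is repeated.
\<close>
lemma add_vector: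
  assumes L: "Lp_property p s \<Lambda>" and Q: "finite_rank_projection Q"
  obtains Q' \<zeta> where "finite_rank_projection Q'" "Q' y = y" "projection_le Q Q'"
    "\<And>x. \<exists>c. Q' x = Q x + s c (y - Q y)" "functional (2 * \<Lambda>\<^sup>2) \<zeta>"
    "\<zeta> (y - Q y) = of_real (norm (y - Q y))" "\<And>x. Q' x = 0 \<Longrightarrow> \<zeta> x = 0"
proof -
  have idem: "Q (Q x) = Q x" for x using Q by (simp add: finite_rank_projection_def)
  note Qh = finite_rank_projection_hom[OF Q]
  define z where "z = y - Q y"
  have Qz: "Q z = 0" by (simp add: z_def module_hom.diff[OF Qh] idem)
  show thesis
  proof (cases "z = 0")
    case True
    then have y: "Q y = y" by (simp add: z_def)
    show thesis
    proof (rule that[of Q "\<lambda>_. 0"])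
      show "projection_le Q Q" by (simp add: projection_le_def idem)
      show "functional (2 * \<Lambda>\<^sup>2) (\<lambda>_. 0)"
        unfolding bounded_hom_def by (auto intro: module_hom_functionalI)
      show "\<exists>c. Q x = Q x + s c (y - Q y)" for x by (intro exI[of _ 0]) simp
    qed (use Q y in auto)
  next
    case False
    obtain \<zeta> where \<zeta>: "functional (2 * \<Lambda>\<^sup>2) \<zeta>" "\<zeta> z = of_real (norm z)" by (rule norming_functional[OF L]) (rule that)
    note \<zeta>h = functional_hom[OF \<zeta>(1)]
    define c :: 'k where "c = inverse (of_real (norm z))"
    have c: "c \<noteq> 0" using False by (simp add: c_def)
    define \<phi> where "\<phi> x = c * \<zeta> (x - Q x)" for x
    obtain K where K: "0 \<le> K" "\<And>x. norm (Q x) \<le> K * norm x" by (rule finite_rank_projection_bounded[OF Q]) (rule that)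
    have \<phi>h: "module_hom s (*) \<phi>" unfolding \<phi>_def[abs_def]
    proof (rule functional_mult, rule module_hom_functionalI)
      show "\<zeta> (x + y - Q (x + y)) = \<zeta> (x - Q x) + \<zeta> (y - Q y)" for x y
        by (simp add: module_hom.add[OF Qh] module_hom.add[OF \<zeta>h] module_hom.diff[OF \<zeta>h])
      show "\<zeta> (s r x - Q (s r x)) = r * \<zeta> (x - Q x)" for r x
        by (simp add: module_hom.scale[OF Qh] module_hom.scale[OF \<zeta>h] module_hom.diff[OF \<zeta>h] right_diff_distrib)
    qed
    have "functional (norm c * (2 * \<Lambda>\<^sup>2 * (1 + K))) \<phi>"
      unfolding bounded_hom_def
    proof (intro conjI \<phi>h allI)
      fix x
      have "norm (\<phi> x) \<le> norm c * (2 * \<Lambda>\<^sup>2 * norm (x - Q x))"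
        unfolding \<phi>_def norm_mult by (intro mult_left_mono functional_bound[OF \<zeta>(1)]) auto
      also have "norm (x - Q x) \<le> (1 + K) * norm x"
        using norm_triangle_ineq4[of x "Q x"] K(2)[of x] by (simp add: algebra_simps)
      finally show "norm (\<phi> x) \<le> norm c * (2 * \<Lambda>\<^sup>2 * (1 + K)) * norm x"
        by (simp add: mult_left_mono mult.assoc)
    qed
    then have \<phi>b: "\<exists>K. functional K \<phi>" by blast
    have \<phi>z: "\<phi> z = 1" using False by (simp add: \<phi>_def Qz \<zeta>(2) c_def)
    have \<phi>Q: "\<phi> (Q x) = 0" for x by (simp add: \<phi>_def idem module_hom.zero[OF \<zeta>h])
    define Q' where "Q' x = Q x + s (\<phi> x) z" for x
    note add = finite_rank_projection_add[OF Q, of 1 "\<lambda>_. \<phi>" "\<lambda>_. z" Q']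
    show thesis
    proof (rule that[of Q' \<zeta>])
      show "finite_rank_projection Q'" by (rule add(1)) (use \<phi>b \<phi>z Qz \<phi>Q in \<open>auto simp: Q'_def\<close>)
      have "\<phi> y = 1" using \<phi>z by (simp add: \<phi>_def z_def module_hom.diff[OF Qh] idem)
      then show "Q' y = y" by (simp add: Q'_def z_def)
      show "projection_le Q Q'"
        unfolding projection_le_def Q'_def
        by (simp add: module_hom.add[OF Qh] module_hom.scale[OF Qh] Qz idem \<phi>Q)
      show "\<exists>c. Q' x = Q x + s c (y - Q y)" for x unfolding Q'_def z_def by blast
      show "functional (2 * \<Lambda>\<^sup>2) \<zeta>" "\<zeta> (y - Q y) = of_real (norm (y - Q y))" using \<zeta> by (auto simp: z_def)
      show "\<zeta> x = 0" if "Q' x = 0" for x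
      proof -
        have "Q (Q' x) = Q x" by (simp add: Q'_def module_hom.add[OF Qh] module_hom.scale[OF Qh] Qz idem)
        then have Qx: "Q x = 0" using that by (simp add: module_hom.zero[OF Qh])
        then have "s (\<phi> x) z = 0" using that by (simp add: Q'_def)
        then have "\<phi> x = 0" using False by simp
        then show ?thesis using c by (simp add: \<phi>_def Qx)
      qed
    qed
  qed
qed

lemma finite_rank_projection_zero: "finite_rank_projection (\<lambda>_. 0)"
  unfolding finite_rank_projection_def by (auto intro!: exI[of _ "0::nat"])

text \<open>
  Infinitely many blocks of prescribed dimensions that are mutually biorthogonal, such that every \<open>y j\<close> is
  seen by finitely many of them. The blocks are chosen one after the other relative to an increasing
  sequence of finite rank projections whose ranges take up the previous blocks and the vectors
  \<open>y j\<close>.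
\<close>
lemma biorthogonal_sequence:
  assumes L: "Lp_property p s \<Lambda>" and inf: "\<not> finite_dimensional s UNIV"
  obtains C where "0 < C" "\<And>(n::nat \<Rightarrow> nat) (y::nat \<Rightarrow> 'x). \<exists>e \<phi>. (\<forall>k. \<forall>i<n k. functional C (\<phi> k i)) \<and>
    (\<forall>k l. \<forall>i<n k. \<forall>j<n l. \<phi> k i (e l j) = (if k = l \<and> i = j then 1 else 0)) \<and>
    (\<forall>k a. norm (\<Sum>i<n k. s (a i) (e k i)) \<le> C * lpn p {..<n k} a) \<and>
    (\<forall>k x. lpn p {..<n k} (\<lambda>i. \<phi> k i x) \<le> C * norm x) \<and>
    (\<forall>k j. j < k \<longrightarrow> (\<forall>i<n k. \<phi> k i (y j) = 0))"
proof -
  obtain C where C: "0 < C" "\<And>n Q. finite_rank_projection Q \<Longrightarrow> \<exists>e \<phi>. biorthogonal_block C Q n e \<phi>"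
    by (rule biorthogonal_block_exists[OF L inf]) (rule that; (assumption | blast))
  show thesis
  proof (rule that[OF C(1)])
    fix n :: "nat \<Rightarrow> nat" and y :: "nat \<Rightarrow> 'x"
    define step where "step k Q e \<phi> Q' \<longleftrightarrow> biorthogonal_block C Q (n k) e \<phi> \<and> finite_rank_projection Q' \<and>
      Q' (y k) = y k \<and> projection_le Q Q' \<and> (\<forall>i<n k. Q' (e i) = e i \<and> (\<forall>x. \<phi> i (Q' x) = \<phi> i x))" for k Q e \<phi> Q'
    have "\<exists>e \<phi> Q'. step k Q e \<phi> Q'" if Q: "finite_rank_projection Q" for k Q
    proof -
      obtain e \<phi> where b: "biorthogonal_block C Q (n k) e \<phi>" using C(2)[OF Q] by blast
      define P where "P x = Q x + (\<Sum>i<n k. s (\<phi> i x) (e i))" for x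
      have bs: "\<And>i. i < n k \<Longrightarrow> \<exists>K. functional K (\<phi> i)"
        "\<And>i j. i < n k \<Longrightarrow> j < n k \<Longrightarrow> \<phi> i (e j) = (if i = j then 1 else 0)"
        "\<And>i. i < n k \<Longrightarrow> Q (e i) = 0" "\<And>i x. i < n k \<Longrightarrow> \<phi> i (Q x) = 0"
        using b unfolding biorthogonal_block_def by blast+
      note add = finite_rank_projection_add[OF Q bs P_def]
      have P: "finite_rank_projection P" by (rule add(1))
      have Pe: "i < n k \<Longrightarrow> P (e i) = e i" and \<phi>P: "i < n k \<Longrightarrow> \<phi> i (P x) = \<phi> i x" for i x
        using add(4,5) by blast+
      obtain Q' where Q': "finite_rank_projection Q'" "Q' (y k) = y k" "projection_le P Q'"
        by (rule add_vector[OF L P]) (rule that)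
      have PQ': "Q' (P x) = P x" "P (Q' x) = P x" for x using Q'(3) by (auto simp: projection_le_def)
      have "projection_le Q P" unfolding projection_le_def using add(2,3) by blast
      then have "projection_le Q Q'" using Q'(3) by (rule projection_le_trans)
      moreover have "Q' (e i) = e i" if "i < n k" for i using Pe[OF that] PQ'(1)[of "e i"] by simp
      moreover have "\<phi> i (Q' x) = \<phi> i x" if "i < n k" for i x
        using \<phi>P[OF that, of x] \<phi>P[OF that, of "Q' x"] PQ'(2)[of x] by simp
      ultimately show ?thesis unfolding step_def using b Q' by blast
    qed
    then have "\<forall>k Q. \<exists>T. finite_rank_projection Q \<longrightarrow> step k Q (fst T) (fst (snd T)) (snd (snd T))" by fastforce
    then obtain T where T: "\<And>k Q. finite_rank_projection Q \<Longrightarrow> step k Q (fst (T k Q)) (fst (snd (T k Q))) (snd (snd (T k Q)))"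
      by metis
    define E where "E k Q = fst (T k Q)" for k Q
    define \<Phi> where "\<Phi> k Q = fst (snd (T k Q))" for k Q
    define NX where "NX k Q = snd (snd (T k Q))" for k Q
    have st: "step k Q (E k Q) (\<Phi> k Q) (NX k Q)" if "finite_rank_projection Q" for k Q
      using T[OF that] by (simp add: E_def \<Phi>_def NX_def)
    define PP where "PP = rec_nat (\<lambda>_. 0) NX"
    have PP: "PP 0 = (\<lambda>_. 0)" "PP (Suc k) = NX k (PP k)" for k by (simp_all add: PP_def)
    have fr: "finite_rank_projection (PP k)" for k
    proof (induction k)
      case (Suc k)
      then show ?case using st[of "PP k" k] by (simp add: PP step_def)
    qed (simp add: PP finite_rank_projection_zero)
    define e where "e k = E k (PP k)" for k
    define \<phi> where "\<phi> k = \<Phi> k (PP k)" for k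
    have s: "step k (PP k) (e k) (\<phi> k) (PP (Suc k))" for k
      using st[OF fr, of k k] by (simp add: PP e_def \<phi>_def)
    have idem: "PP k (PP k x) = PP k x" for k x using fr[of k] by (simp add: finite_rank_projection_def)
    have le: "projection_le (PP k) (PP (k + l))" for k l
    proof (induction l)
      case (Suc l)
      have "projection_le (PP (k + l)) (PP (Suc (k + l)))" using s[of "k + l"] by (simp add: step_def)
      then show ?case using projection_le_trans[OF Suc] by simp
    qed (simp add: projection_le_def idem)
    have le': "PP l (PP k x) = PP k x" "PP k (PP l x) = PP k x" if "k \<le> l" for k l x
      using le[of k "l - k"] that by (auto simp: projection_le_def)
    have bl: "biorthogonal_block C (PP k) (n k) (e k) (\<phi> k)" for k using s[of k] by (simp add: step_def)
    then have b: "\<And>k i. i < n k \<Longrightarrow> PP k (e k i) = 0" "\<And>k i. i < n k \<Longrightarrow> functional C (\<phi> k i)"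
        "\<And>k i x. i < n k \<Longrightarrow> \<phi> k i (PP k x) = 0"
        "\<And>k i j. i < n k \<Longrightarrow> j < n k \<Longrightarrow> \<phi> k i (e k j) = (if i = j then 1 else 0)"
        "\<And>k a. norm (\<Sum>i<n k. s (a i) (e k i)) \<le> C * lpn p {..<n k} a"
        "\<And>k x. lpn p {..<n k} (\<lambda>i. \<phi> k i x) \<le> C * norm x"
      unfolding biorthogonal_block_def by blast+
    have y: "PP l (y k) = y k" if "k < l" for k l
      using le'(1)[of "Suc k" l "y k"] s[of k] that by (simp add: step_def)
    have el: "PP l (e k i) = e k i" if "k < l" "i < n k" for k l i
      using le'(1)[of "Suc k" l "e k i"] s[of k] that by (simp add: step_def)
    have fl: "\<phi> k i (PP l x) = \<phi> k i x" if "k < l" "i < n k" for k l i x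
    proof -
      have "\<phi> k i (PP (Suc k) (PP l x)) = \<phi> k i (PP l x)" "\<phi> k i (PP (Suc k) x) = \<phi> k i x"
        using s[of k] that(2) by (simp_all add: step_def)
      then show ?thesis using le'(2)[of "Suc k" l x] that(1) by simp
    qed
    have orth: "\<phi> k i (e l j) = (if k = l \<and> i = j then 1 else 0)" if "i < n k" "j < n l" for k l i j
    proof -
      consider "k < l" | "k = l" | "l < k" by linarith
      then show ?thesis
      proof cases
        case 1
        then have "\<phi> k i (e l j) = \<phi> k i (PP l (e l j))" using fl that by simp
        then show ?thesis using 1 that b(1) module_hom.zero[OF functional_hom[OF b(2)[OF that(1)]]] by simp
      next
        case 2
        then show ?thesis using that b(4) by simp
      next
        case 3
        then have "\<phi> k i (e l j) = \<phi> k i (PP k (e l j))" using el that by simp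
        then show ?thesis using 3 that b(3) by simp
      qed
    qed
    have zero: "\<phi> k i (y j) = 0" if "j < k" "i < n k" for k j i
      using b(3)[OF that(2), of "y j"] y[OF that(1)] by simp
    show "\<exists>e \<phi>. (\<forall>k. \<forall>i<n k. functional C (\<phi> k i)) \<and>
      (\<forall>k l. \<forall>i<n k. \<forall>j<n l. \<phi> k i (e l j) = (if k = l \<and> i = j then 1 else 0)) \<and>
      (\<forall>k a. norm (\<Sum>i<n k. s (a i) (e k i)) \<le> C * lpn p {..<n k} a) \<and>
      (\<forall>k x. lpn p {..<n k} (\<lambda>i. \<phi> k i x) \<le> C * norm x) \<and>
      (\<forall>k j. j < k \<longrightarrow> (\<forall>i<n k. \<phi> k i (y j) = 0))"
      using b(2,5,6) orth zero by (intro exI[of _ e] exI[of _ \<phi>]) blast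
  qed
qed

text \<open>
  A dense subspace of an infinite dimensional space is not contained in the range of a finite rank
  projection, because this range is closed and finite dimensional.
\<close>
lemma triangular_sequence:
  assumes L: "Lp_property p s \<Lambda>" and inf: "\<not> finite_dimensional s UNIV"
    and V0: "subspace V0" "closure V0 = UNIV"
  obtains z \<zeta> where "\<And>n::nat. z n \<in> V0" "\<And>n. norm (z n) = 1" "\<And>n. functional (2 * \<Lambda>\<^sup>2) (\<zeta> n)"
    "\<And>n. \<zeta> n (z n) = 1" "\<And>n m. n < m \<Longrightarrow> \<zeta> n (z m) = 0"
proof -
  define good where "good Q \<longleftrightarrow> finite_rank_projection Q \<and> range Q \<subseteq> V0" for Q
  define step where "step Q Q' z \<zeta> \<longleftrightarrow> good Q' \<and> projection_le Q Q' \<and> z \<in> V0 \<and> norm z = 1 \<and> Q z = 0 \<and>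
    functional (2 * \<Lambda>\<^sup>2) \<zeta> \<and> \<zeta> z = 1 \<and> (\<forall>x. Q' x = 0 \<longrightarrow> \<zeta> x = 0)" for Q Q' z \<zeta>
  have "\<exists>Q' z \<zeta>. step Q Q' z \<zeta>" if "good Q" for Q
  proof -
    have Q: "finite_rank_projection Q" "range Q \<subseteq> V0" using that by (auto simp: good_def)
    have idem: "Q (Q x) = Q x" for x using Q(1) by (simp add: finite_rank_projection_def)
    note Qh = finite_rank_projection_hom[OF Q(1)]
    obtain K where K: "0 \<le> K" "\<And>x. norm (Q x) \<le> K * norm x" by (rule finite_rank_projection_bounded[OF Q(1)]) (rule that)
    have "\<exists>y\<in>V0. Q y \<noteq> y"
    proof (rule ccontr)
      assume "\<not> (\<exists>y\<in>V0. Q y \<noteq> y)"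
      then have sub: "V0 \<subseteq> {y. Q y = y}" by auto
      have "dist (Q x) (Q y) \<le> K * dist x y" for x y
        using K(2)[of "x - y"] by (simp add: dist_norm module_hom.diff[OF Qh])
      then have "K-lipschitz_on UNIV Q" using K(1) by (intro lipschitz_onI) auto
      then have "continuous_on UNIV Q" by (rule lipschitz_on_continuous_on)
      then have "closed {y. Q y = y}" by (intro closed_Collect_eq continuous_on_id)
      then have "closure V0 \<subseteq> {y. Q y = y}" using sub by (rule closure_minimal[rotated])
      then have fixed: "Q y = y" for y using V0(2) by auto
      obtain r :: nat and f \<psi> where r: "\<And>x. Q x = (\<Sum>j<r. s (\<psi> j x) (f j))"
        using Q(1) unfolding finite_rank_projection_def by blast
      have "y \<in> span (f ` {..<r})" for y
        by (subst fixed[symmetric], subst r) (intro span_sum span_scale span_base imageI)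
      then have "span (f ` {..<r}) = UNIV" by blast
      then show False using inf unfolding finite_dimensional_def by blast
    qed
    then obtain y0 where y0: "y0 \<in> V0" "Q y0 \<noteq> y0" by blast
    define y where "y = s (of_real (inverse (norm (y0 - Q y0)))) (y0 - Q y0)"
    have Qy: "Q y = 0" by (simp add: y_def module_hom.scale[OF Qh] module_hom.diff[OF Qh] idem)
    have ny: "norm y = 1" using y0(2) by (simp add: y_def norm_scale norm_inverse)
    have yV: "y \<in> V0" unfolding y_def using V0(1) Q(2) y0(1) by (intro subspace_scale subspace_diff) auto
    obtain Q' \<zeta> where Q': "finite_rank_projection Q'" "projection_le Q Q'"
      "\<And>x. \<exists>c. Q' x = Q x + s c (y - Q y)" "functional (2 * \<Lambda>\<^sup>2) \<zeta>"
      "\<zeta> (y - Q y) = of_real (norm (y - Q y))" "\<And>x. Q' x = 0 \<Longrightarrow> \<zeta> x = 0"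
      by (rule add_vector[OF L Q(1)]) (rule that; (assumption | blast))
    have "Q' x \<in> V0" for x
    proof -
      obtain c where "Q' x = Q x + s c (y - Q y)" using Q'(3) by blast
      then show ?thesis using V0(1) Q(2) yV by (simp add: Qy) (intro subspace_add subspace_scale, auto)
    qed
    then show ?thesis unfolding step_def good_def using Q' Qy ny yV
      by (intro exI[of _ Q'] exI[of _ y] exI[of _ \<zeta>]) auto
  qed
  then obtain NX Z ZE where st: "\<And>Q. good Q \<Longrightarrow> step Q (NX Q) (Z Q) (ZE Q)" by metis
  define PP where "PP k = (NX ^^ k) (\<lambda>_. 0)" for k
  have good: "good (PP k)" for k
  proof (induction k)
    case 0
    then show ?case using V0(1) by (simp add: PP_def good_def finite_rank_projection_zero subspace_0)
  next
    case (Suc k)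
    then show ?case using st[of "PP k"] by (simp add: PP_def step_def)
  qed
  have s: "step (PP k) (PP (Suc k)) (Z (PP k)) (ZE (PP k))" for k
    using st[OF good, of k] by (simp add: PP_def)
  have idem: "PP k (PP k x) = PP k x" for k x using good[of k] by (simp add: good_def finite_rank_projection_def)
  have le: "projection_le (PP k) (PP (k + l))" for k l
  proof (induction l)
    case (Suc l)
    have "projection_le (PP (k + l)) (PP (Suc (k + l)))" using s[of "k + l"] by (simp add: step_def)
    then show ?case using projection_le_trans[OF Suc] by simp
  qed (simp add: projection_le_def idem)
  show thesis
  proof (rule that[of "\<lambda>k. Z (PP k)" "\<lambda>k. ZE (PP k)"])
    show "ZE (PP n) (Z (PP m)) = 0" if "n < m" for n m
    proof -
      have "PP m (Z (PP m)) = 0" using s[of m] by (simp add: step_def)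
      moreover have "PP (Suc n) (PP m (Z (PP m))) = PP (Suc n) (Z (PP m))"
        using le[of "Suc n" "m - Suc n"] that by (simp add: projection_le_def)
      moreover have "PP (Suc n) 0 = 0"
        using good[of "Suc n"] finite_rank_projection_hom module_hom.zero unfolding good_def by blast
      ultimately have "PP (Suc n) (Z (PP m)) = 0" by simp
      then show ?thesis using s[of n] by (simp add: step_def)
    qed
  qed (use s in \<open>auto simp: step_def\<close>)
qed

end

section \<open>Expansion of compact sets\<close>

context lp_space
begin

text \<open>
  A finite net reduces compact sets to finite sets; the vectors \<open>b i\<close> are finitely many and can be
  moved into the dense subspace.
\<close>
lemma approximation_in_dense_subspace:
  assumes L: "Lp_property p s \<Lambda>" and K: "compact K" and M: "\<And>y. y \<in> K \<Longrightarrow> norm y \<le> M" "0 < M"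
    and X0: "closure X0 = UNIV" and eps: "0 < \<epsilon>"
  obtains n :: nat and g b where "\<And>i. i < n \<Longrightarrow> functional \<Lambda> (g i)" "\<And>x. lpn p {..<n} (\<lambda>i. g i x) \<le> \<Lambda> * norm x"
    "\<And>i. i < n \<Longrightarrow> b i \<in> X0" "\<And>a. norm (\<Sum>i<n. s (a i) (b i)) \<le> (\<Lambda> + 1) * lpn p {..<n} a"
    "\<And>y. y \<in> K \<Longrightarrow> norm (y - (\<Sum>i<n. s (g i y) (b i))) \<le> \<epsilon>"
proof -
  have \<Lambda>: "1 \<le> \<Lambda>" using L by (simp add: Lp_property_def)
  define \<epsilon>1 where "\<epsilon>1 = \<epsilon> / (2 * (1 + (\<Lambda> + 1) * \<Lambda>))"
  have pos: "0 < 1 + (\<Lambda> + 1) * \<Lambda>" using \<Lambda> by (simp add: add_pos_nonneg)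
  have \<epsilon>1: "0 < \<epsilon>1" using eps pos by (simp add: \<epsilon>1_def)
  have "seq_compact K" using K by (simp add: compact_eq_seq_compact_metric)
  from seq_compact_imp_totally_bounded[OF this, rule_format, OF \<epsilon>1]
  obtain Y0 where Y0: "finite Y0" "Y0 \<subseteq> K" "K \<subseteq> (\<Union>y\<in>Y0. ball y \<epsilon>1)" by (elim exE conjE)
  have eps4: "0 < \<epsilon> / 4" using eps by simp
  obtain n :: nat and g b0 where g: "\<And>i. i < n \<Longrightarrow> module_hom s (*) (g i)" "\<And>x. lpn p {..<n} (\<lambda>i. g i x) \<le> \<Lambda> * norm x"
    and b0: "\<And>a. norm (\<Sum>i<n. s (a i) (b0 i)) \<le> \<Lambda> * lpn p {..<n} a"
    "\<And>y. y \<in> Y0 \<Longrightarrow> norm (y - (\<Sum>i<n. s (g i y) (b0 i))) \<le> \<epsilon> / 4"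
    by (rule approximation_property[OF L Y0(1) eps4]) (rule that; (assumption | blast))
  define \<eta> where "\<eta> = min 1 (\<epsilon> / (4 * \<Lambda> * M)) / (real n + 1)"
  have \<eta>: "0 < \<eta>" using eps \<Lambda> M(2) by (simp add: \<eta>_def)
  have n\<eta>: "real n * \<eta> \<le> 1" "real n * \<eta> \<le> \<epsilon> / (4 * \<Lambda> * M)"
  proof -
    have "real n * \<eta> = min 1 (\<epsilon> / (4 * \<Lambda> * M)) * (real n / (real n + 1))" by (simp add: \<eta>_def)
    also have "\<dots> \<le> min 1 (\<epsilon> / (4 * \<Lambda> * M))" using eps \<Lambda> M(2) by (intro mult_left_le) auto
    finally show "real n * \<eta> \<le> 1" "real n * \<eta> \<le> \<epsilon> / (4 * \<Lambda> * M)" by auto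
  qed
  have "\<exists>b\<in>X0. dist b x < \<eta>" for x using X0 \<eta> closure_approachable[of x X0] by auto
  then obtain pick where pick: "\<And>x. pick x \<in> X0" "\<And>x. dist (pick x) x < \<eta>" by metis
  define b where "b i = pick (b0 i)" for i
  have bb: "norm (\<Sum>i<n. s (a i) (b i - b0 i)) \<le> real n * \<eta> * lpn p {..<n} a" for a
    using norm_sum_scale_le[of "{..<n}" "\<lambda>i. b i - b0 i" \<eta> a] pick(2) \<eta> by (auto simp: b_def dist_norm less_imp_le)
  have split: "(\<Sum>i<n. s (a i) (b i)) = (\<Sum>i<n. s (a i) (b0 i)) + (\<Sum>i<n. s (a i) (b i - b0 i))" for a
    by (simp add: scale_right_diff_distrib sum_subtractf)
  have upper: "norm (\<Sum>i<n. s (a i) (b i)) \<le> (\<Lambda> + 1) * lpn p {..<n} a" for a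
  proof -
    have "norm (\<Sum>i<n. s (a i) (b i)) \<le> \<Lambda> * lpn p {..<n} a + real n * \<eta> * lpn p {..<n} a"
      unfolding split by (intro order_trans[OF norm_triangle_ineq] add_mono b0 bb)
    also have "real n * \<eta> * lpn p {..<n} a \<le> 1 * lpn p {..<n} a" using n\<eta>(1) by (intro mult_right_mono) auto
    finally show ?thesis by (simp add: algebra_simps)
  qed
  show thesis
  proof (rule that[of n g b])
    show "functional \<Lambda> (g i)" if "i < n" for i
      unfolding bounded_hom_def
    proof (intro conjI allI g(1) that)
      show "norm (g i x) \<le> \<Lambda> * norm x" for x
        using norm_le_lpn[of "{..<n}" i "\<lambda>i. g i x"] g(2)[of x] that by simp
    qed
    show "norm (y - (\<Sum>i<n. s (g i y) (b i))) \<le> \<epsilon>" if y: "y \<in> K" for y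
    proof -
      obtain y0 where y0: "y0 \<in> Y0" "norm (y - y0) < \<epsilon>1"
        using y Y0(3) by (auto simp: dist_norm norm_minus_commute)
      have gd: "g i y = g i (y - y0) + g i y0" if "i < n" for i by (simp flip: module_hom.add[OF g(1)[OF that]])
      have "(\<Sum>i<n. s (g i y) (b i)) = (\<Sum>i<n. s (g i (y - y0)) (b i)) + (\<Sum>i<n. s (g i y0) (b i))"
        unfolding sum.distrib[symmetric] by (intro sum.cong refl) (simp add: gd scale_left_distrib)
      then have eq: "y - (\<Sum>i<n. s (g i y) (b i)) = (y - y0) - (\<Sum>i<n. s (g i (y - y0)) (b i))
          + ((y0 - (\<Sum>i<n. s (g i y0) (b0 i))) - (\<Sum>i<n. s (g i y0) (b i - b0 i)))"
        using split[of "\<lambda>i. g i y0"] by simp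
      have "norm (\<Sum>i<n. s (g i (y - y0)) (b i)) \<le> (\<Lambda> + 1) * (\<Lambda> * norm (y - y0))"
        using \<Lambda> g(2)[of "y - y0"] by (intro order_trans[OF upper] mult_left_mono) auto
      then have "norm ((y - y0) - (\<Sum>i<n. s (g i (y - y0)) (b i))) \<le> norm (y - y0) + (\<Lambda> + 1) * (\<Lambda> * norm (y - y0))"
        by (intro order_trans[OF norm_triangle_ineq4] add_left_mono)
      also have "\<dots> = (1 + (\<Lambda> + 1) * \<Lambda>) * norm (y - y0)" by (simp add: algebra_simps)
      also have "\<dots> \<le> (1 + (\<Lambda> + 1) * \<Lambda>) * \<epsilon>1" using y0(2) pos by (intro mult_left_mono) auto
      also have "\<dots> = \<epsilon> / 2"
      proof -
        have "q * (\<epsilon> / (2 * q)) = \<epsilon> / 2" if "0 < q" for q :: real using that by simp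
        from this[OF pos] show ?thesis unfolding \<epsilon>1_def .
      qed
      finally have 1: "norm ((y - y0) - (\<Sum>i<n. s (g i (y - y0)) (b i))) \<le> \<epsilon> / 2" .
      have "norm (\<Sum>i<n. s (g i y0) (b i - b0 i)) \<le> real n * \<eta> * (\<Lambda> * M)"
      proof (rule order_trans[OF bb mult_left_mono])
        have "lpn p {..<n} (\<lambda>i. g i y0) \<le> \<Lambda> * norm y0" by (rule g)
        also have "\<dots> \<le> \<Lambda> * M" using M(1)[of y0] y0(1) Y0(2) \<Lambda> by (intro mult_left_mono) auto
        finally show "lpn p {..<n} (\<lambda>i. g i y0) \<le> \<Lambda> * M" .
      qed (use \<eta> in simp)
      also have "\<dots> \<le> \<epsilon> / (4 * \<Lambda> * M) * (\<Lambda> * M)" using n\<eta>(2) \<Lambda> M(2) by (intro mult_right_mono) auto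
      also have "\<dots> = \<epsilon> / 4" using \<Lambda> M(2) by simp
      finally have 2: "norm (\<Sum>i<n. s (g i y0) (b i - b0 i)) \<le> \<epsilon> / 4" .
      have 3: "norm ((y0 - (\<Sum>i<n. s (g i y0) (b0 i))) - (\<Sum>i<n. s (g i y0) (b i - b0 i))) \<le> \<epsilon> / 4 + \<epsilon> / 4"
        by (intro order_trans[OF norm_triangle_ineq4] add_mono b0(2) y0(1) 2)
      show ?thesis unfolding eq by (rule order_trans[OF norm_triangle_ineq]) (use 1 3 in linarith)
    qed
  qed (use g upper pick in \<open>auto simp: b_def\<close>)
qed

lemma bounded_hom_diff_finite_rank:
  assumes "bounded_hom s s M r" "\<And>i. i < (n::nat) \<Longrightarrow> functional \<Lambda> (g i)" "0 \<le> \<Lambda>" "0 \<le> M"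
  shows "\<exists>M'\<ge>0. bounded_hom s s M' (\<lambda>x. r x - (\<Sum>i<n. s (g i (r x)) (b i)))"
proof -
  have rh: "module_hom s s r" and rb: "norm (r x) \<le> M * norm x" for x using assms(1) by (auto simp: bounded_hom_def)
  have gh: "module_hom s (*) (g i)" if "i < n" for i using assms(2)[OF that] by (rule functional_hom)
  have "module_hom s s (\<lambda>x. r x - (\<Sum>i<n. s (g i (r x)) (b i)))"
    by (rule module_hom_selfI)
      (simp_all add: module_hom.add[OF rh] module_hom.scale[OF rh] finite_rank_linear[OF gh] scale_right_diff_distrib)
  moreover have "norm (r x - (\<Sum>i<n. s (g i (r x)) (b i))) \<le> (M + (\<Sum>i<n. \<Lambda> * M * norm (b i))) * norm x" for x
  proof -
    have "norm (\<Sum>i<n. s (g i (r x)) (b i)) \<le> (\<Sum>i<n. \<Lambda> * (M * norm x) * norm (b i))"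
    proof (intro order_trans[OF norm_sum] sum_mono)
      fix i assume "i \<in> {..<n}"
      then have "norm (g i (r x)) \<le> \<Lambda> * norm (r x)" using functional_bound[OF assms(2)] by simp
      also have "\<dots> \<le> \<Lambda> * (M * norm x)" using assms(3) rb by (rule mult_left_mono[rotated])
      finally show "norm (s (g i (r x)) (b i)) \<le> \<Lambda> * (M * norm x) * norm (b i)"
        by (simp add: norm_scale mult_right_mono)
    qed
    also have "\<dots> = (\<Sum>i<n. \<Lambda> * M * norm (b i)) * norm x" by (simp add: sum_distrib_left sum_distrib_right algebra_simps)
    finally show ?thesis using rb[of x] norm_triangle_ineq4[of "r x" "\<Sum>i<n. s (g i (r x)) (b i)"]
      by (simp add: algebra_simps)
  qed
  moreover have "0 \<le> M + (\<Sum>i<n. \<Lambda> * M * norm (b i))" using assms by (intro add_nonneg_nonneg sum_nonneg) auto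
  ultimately show ?thesis unfolding bounded_hom_def by blast
qed

text \<open>
  Approximate the identity on \<open>K\<close>, then on the set of the errors, and so on. The error after \<open>k\<close> steps
  is a bounded operator \<open>rr k\<close> that maps \<open>K\<close> onto a compact set of norm at most \<open>M / 4\<^sup>k\<close>, so the constants of
  the approximating operators do not accumulate.
\<close>
lemma compact_set_expansion:
  assumes L: "Lp_property p s \<Lambda>" and K: "compact K" and X0: "closure X0 = UNIV"
  obtains C and n :: "nat \<Rightarrow> nat" and d b where "0 < C" "\<And>k i. i < n k \<Longrightarrow> b k i \<in> X0"
    "\<And>k i. i < n k \<Longrightarrow> \<exists>M. functional M (d k i)"
    "\<And>k y. y \<in> K \<Longrightarrow> lpn p {..<n k} (\<lambda>i. d k i y) \<le> C * (1 / 4) ^ k"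
    "\<And>k a. norm (\<Sum>i<n k. s (a i) (b k i)) \<le> C * lpn p {..<n k} a"
    "\<And>y. y \<in> K \<Longrightarrow> (\<lambda>k. \<Sum>i<n k. s (d k i y) (b k i)) sums y"
proof -
  have \<Lambda>: "1 \<le> \<Lambda>" using L by (simp add: Lp_property_def)
  obtain M where M: "0 < M" "\<And>y. y \<in> K \<Longrightarrow> norm y \<le> M"
    using compact_imp_bounded[OF K] unfolding bounded_pos by blast
  define good where "good k r \<longleftrightarrow> (\<exists>B\<ge>0. bounded_hom s s B r) \<and> (\<forall>y\<in>K. norm (r y) \<le> M * (1 / 4) ^ k)"
    for k :: nat and r
  define ap where "ap r n g b \<longleftrightarrow> (\<forall>i<n. functional \<Lambda> (g i) \<and> b i \<in> X0) \<and> (\<forall>x. lpn p {..<n} (\<lambda>i. g i x) \<le> \<Lambda> * norm x) \<and>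
    (\<forall>a. norm (\<Sum>i<n. s (a i) (b i)) \<le> (\<Lambda> + 1) * lpn p {..<n} a)" for r :: "'x \<Rightarrow> 'x" and n :: nat and g b
  define st where "st k r T \<longleftrightarrow> ap r (fst T) (fst (snd T)) (snd (snd T)) \<and>
      good (Suc k) (\<lambda>x. r x - (\<Sum>i<fst T. s (fst (snd T) i (r x)) (snd (snd T) i)))" for k r T
  have "\<exists>T. ap r (fst T) (fst (snd T)) (snd (snd T)) \<and>
      good (Suc k) (\<lambda>x. r x - (\<Sum>i<fst T. s (fst (snd T) i (r x)) (snd (snd T) i)))" if g: "good k r" for k r
  proof -
    obtain B where B: "0 \<le> B" "bounded_hom s s B r" using g by (auto simp: good_def)
    then have rh: "module_hom s s r" and rb: "norm (r x) \<le> B * norm x" for x by (auto simp: bounded_hom_def)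
    have "dist (r x) (r y) \<le> B * dist x y" for x y
      using rb[of "x - y"] by (simp add: dist_norm module_hom.diff[OF rh])
    then have "B-lipschitz_on UNIV r" using B(1) by (intro lipschitz_onI) auto
    then have "continuous_on K r" by (meson lipschitz_on_continuous_on continuous_on_subset subset_UNIV)
    then have rK: "compact (r ` K)" using K by (intro compact_continuous_image)
    have bd: "norm y \<le> M" if "y \<in> r ` K" for y
    proof -
      have "norm y \<le> M * (1 / 4) ^ k" using that g by (auto simp: good_def)
      also have "\<dots> \<le> M" using M(1) by (intro mult_left_le power_le_one) auto
      finally show ?thesis .
    qed
    have eps: "0 < M * (1 / 4) ^ Suc k" using M(1) by simp
    obtain n :: nat and g b where *: "\<And>i. i < n \<Longrightarrow> functional \<Lambda> (g i)" "\<And>x. lpn p {..<n} (\<lambda>i. g i x) \<le> \<Lambda> * norm x"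
      "\<And>i. i < n \<Longrightarrow> b i \<in> X0" "\<And>a. norm (\<Sum>i<n. s (a i) (b i)) \<le> (\<Lambda> + 1) * lpn p {..<n} a"
      "\<And>y. y \<in> r ` K \<Longrightarrow> norm (y - (\<Sum>i<n. s (g i y) (b i))) \<le> M * (1 / 4) ^ Suc k"
    proof (rule approximation_in_dense_subspace[OF L rK _ M(1) X0 eps])
      show "norm y \<le> M" if "y \<in> r ` K" for y by (rule bd[OF that])
    qed (rule that; (assumption | blast))
    have "\<exists>B'\<ge>0. bounded_hom s s B' (\<lambda>x. r x - (\<Sum>i<n. s (g i (r x)) (b i)))"
      by (rule bounded_hom_diff_finite_rank[OF B(2) *(1) _ B(1)]) (use \<Lambda> in auto)
    then show ?thesis
      using * by (intro exI[of _ "(n, g, b)"]) (auto simp: ap_def good_def)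
  qed
  then have ex: "\<And>k r. good k r \<Longrightarrow> \<exists>T. st k r T" unfolding st_def .
  then obtain T where "\<And>k r. good k r \<Longrightarrow> st k r (T k r)" by metis
  then have T: "\<And>k r. good k r \<Longrightarrow> ap r (fst (T k r)) (fst (snd (T k r))) (snd (snd (T k r))) \<and>
      good (Suc k) (\<lambda>x. r x - (\<Sum>i<fst (T k r). s (fst (snd (T k r)) i (r x)) (snd (snd (T k r)) i)))"
    unfolding st_def .
  define rr where "rr = rec_nat (\<lambda>x. x) (\<lambda>k r x. r x - (\<Sum>i<fst (T k r). s (fst (snd (T k r)) i (r x)) (snd (snd (T k r)) i)))"
  define n where "n k = fst (T k (rr k))" for k
  define g where "g k = fst (snd (T k (rr k)))" for k
  define b where "b k = snd (snd (T k (rr k)))" for k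
  have rr: "rr 0 = (\<lambda>x. x)" "rr (Suc k) = (\<lambda>x. rr k x - (\<Sum>i<n k. s (g k i (rr k x)) (b k i)))" for k
    by (simp_all add: rr_def n_def g_def b_def)
  have good: "good k (rr k)" for k
  proof (induction k)
    case 0
    have "bounded_hom s s 1 (\<lambda>x. x)" unfolding bounded_hom_def by (auto intro: module_hom_selfI)
    then show ?case using M(2) by (auto simp: good_def rr intro!: exI[of _ 1])
  next
    case (Suc k)
    then show ?case using T[OF Suc] by (simp add: rr n_def g_def b_def)
  qed
  have ap: "ap (rr k) (n k) (g k) (b k)" for k using T[OF good[of k]] by (simp add: n_def g_def b_def)
  define C where "C = \<Lambda> * M + \<Lambda> + 1"
  show thesis
  proof (rule that[of C n b "\<lambda>k i x. g k i (rr k x)"])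
    show "0 < C" using \<Lambda> M(1) by (simp add: C_def add_pos_pos)
    show "b k i \<in> X0" if "i < n k" for k i using ap[of k] that by (simp add: ap_def)
    show "\<exists>M. functional M (\<lambda>x. g k i (rr k x))" if i: "i < n k" for k i
    proof -
      obtain B where B: "0 \<le> B" "bounded_hom s s B (rr k)" using good[of k] by (auto simp: good_def)
      then have rh: "module_hom s s (rr k)" and rb: "norm (rr k x) \<le> B * norm x" for x by (auto simp: bounded_hom_def)
      have gf: "functional \<Lambda> (g k i)" using ap[of k] i by (simp add: ap_def)
      note gh = functional_hom[OF gf]
      have "module_hom s (*) (\<lambda>x. g k i (rr k x))"
        by (rule module_hom_functionalI)
          (simp_all add: module_hom.add[OF rh] module_hom.add[OF gh] module_hom.scale[OF rh] module_hom.scale[OF gh])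
      moreover have "norm (g k i (rr k x)) \<le> \<Lambda> * B * norm x" for x
        using order_trans[OF functional_bound[OF gf] mult_left_mono[OF rb]] \<Lambda> by (simp add: mult.assoc)
      ultimately show ?thesis unfolding bounded_hom_def by blast
    qed
    show "lpn p {..<n k} (\<lambda>i. g k i (rr k y)) \<le> C * (1 / 4) ^ k" if "y \<in> K" for k y
    proof -
      have "lpn p {..<n k} (\<lambda>i. g k i (rr k y)) \<le> \<Lambda> * norm (rr k y)" using ap[of k] by (simp add: ap_def)
      also have "\<dots> \<le> \<Lambda> * (M * (1 / 4) ^ k)" using good[of k] that \<Lambda> by (intro mult_left_mono) (auto simp: good_def)
      also have "\<dots> = \<Lambda> * M * (1 / 4) ^ k" by simp
      also have "\<dots> \<le> C * (1 / 4) ^ k" using \<Lambda> by (intro mult_right_mono) (auto simp: C_def)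
      finally show ?thesis .
    qed
    show "norm (\<Sum>i<n k. s (a i) (b k i)) \<le> C * lpn p {..<n k} a" for k a
    proof -
      have "norm (\<Sum>i<n k. s (a i) (b k i)) \<le> (\<Lambda> + 1) * lpn p {..<n k} a" using ap[of k] by (simp add: ap_def)
      also have "\<dots> \<le> C * lpn p {..<n k} a" using \<Lambda> M(1) by (intro mult_right_mono) (auto simp: C_def)
      finally show ?thesis .
    qed
    show "(\<lambda>k. \<Sum>i<n k. s (g k i (rr k y)) (b k i)) sums y" if y: "y \<in> K" for y
    proof -
      have part: "(\<Sum>k<m. \<Sum>i<n k. s (g k i (rr k y)) (b k i)) = y - rr m y" for m
        by (induction m) (simp_all add: rr)
      have "(\<lambda>m. M * (1 / 4) ^ m) \<longlonglongrightarrow> M * 0" by (intro tendsto_mult tendsto_const LIMSEQ_power_zero) simp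
      moreover have "norm (rr m y) \<le> M * (1 / 4) ^ m" for m using good[of m] y unfolding good_def by blast
      ultimately have "(\<lambda>m. rr m y) \<longlonglongrightarrow> 0"
        by (intro Lim_null_comparison[of "\<lambda>m. rr m y" "\<lambda>m. M * (1 / 4) ^ m"]) simp_all
      then have "(\<lambda>m. y - rr m y) \<longlonglongrightarrow> y - 0" by (intro tendsto_diff tendsto_const)
      then show ?thesis unfolding sums_def part by simp
    qed
  qed
qed

end

section \<open>Compact operators with dense range in another space\<close>

lemma (in scalar_normed_space) bounded_linear_scale: "bounded_linear (s c)"
proof (rule bounded_linear_intro[of _ "norm c"])
  show "s c (x + y) = s c x + s c y" for x y by (rule scale_right_distrib)
  show "s c (r *\<^sub>R x) = r *\<^sub>R s c x" for r x
    by (simp flip: scale_of_real add: mult.commute)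
  show "norm (s c x) \<le> norm x * norm c" for x by (simp add: norm_scale mult.commute)
qed

lemma bounded_hom_bounded_linear:
  assumes "scalar_normed_space s" "scalar_normed_space t" "bounded_hom s t C f"
  shows "bounded_linear f"
proof (rule bounded_linear_intro[of _ C])
  have f: "module_hom s t f" using assms(3) by (simp add: bounded_hom_def)
  show "f (x + y) = f x + f y" for x y by (rule module_hom.add[OF f])
  show "f (r *\<^sub>R x) = r *\<^sub>R f x" for r x
    unfolding scalar_normed_space.scale_of_real[OF assms(1), symmetric] scalar_normed_space.scale_of_real[OF assms(2), symmetric]
    by (rule module_hom.scale[OF f])
  show "norm (f x) \<le> norm x * C" for x using assms(3) by (simp add: bounded_hom_def mult.commute)
qed

lemma (in scalar_normed_space) subspace_closure:
  assumes "subspace V"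
  shows "subspace (closure V)"
proof (rule subspaceI)
  show "0 \<in> closure V" using assms closure_subset subspace_0 by blast
  show "x + y \<in> closure V" if xy: "x \<in> closure V" "y \<in> closure V" for x y
  proof -
    obtain a b where "\<forall>n. a n \<in> V" "a \<longlonglongrightarrow> x" "\<forall>n. b n \<in> V" "b \<longlonglongrightarrow> y"
      using xy unfolding closure_sequential by blast
    then have "\<forall>n. a n + b n \<in> V" "(\<lambda>n. a n + b n) \<longlonglongrightarrow> x + y"
      using subspace_add[OF assms] by (auto intro: tendsto_add)
    then show ?thesis unfolding closure_sequential by (intro exI[of _ "\<lambda>n. a n + b n"] conjI)
  qed
  show "s c x \<in> closure V" if x: "x \<in> closure V" for c x
  proof -
    obtain a where "\<forall>n. a n \<in> V" "a \<longlonglongrightarrow> x" using x unfolding closure_sequential by blast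
    then have "\<forall>n. s c (a n) \<in> V" "(\<lambda>n. s c (a n)) \<longlonglongrightarrow> s c x"
      using subspace_scale[OF assms] bounded_linear.tendsto[OF bounded_linear_scale] by auto
    then show ?thesis unfolding closure_sequential by (intro exI[of _ "\<lambda>n. s c (a n)"] conjI)
  qed
qed

lemma series_of_homs:
  fixes f :: "nat \<Rightarrow> 'e::ab_group_add \<Rightarrow> 'b::banach" and t :: "'k::real_or_complex \<Rightarrow> 'b \<Rightarrow> 'b"
  assumes t: "scalar_normed_space t" and f: "\<And>k. module_hom sE t (f k)"
    and b: "\<And>k x. norm (f k x) \<le> B * (1 / 2) ^ k * q x"
  shows "summable (\<lambda>k. f k x)" "module_hom sE t (\<lambda>x. \<Sum>k. f k x)" "norm (\<Sum>k. f k x) \<le> 2 * B * q x"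
proof -
  interpret t: scalar_normed_space t by (rule t)
  have geo: "(\<lambda>k. B * (1 / 2) ^ k * q x) sums (2 * B * q x)" for x
    using sums_mult[OF sums_mult2[OF geometric_sums[of "1 / 2 :: real"]], of "q x" B] by (simp add: mult.assoc mult.commute mult.left_commute)
  then have sn: "summable (\<lambda>k. norm (f k x))" for x
    using b by (intro summable_comparison_test'[OF sums_summable[OF geo[of x]], of 0]) auto
  then show sm: "summable (\<lambda>k. f k x)" for x by (rule summable_norm_cancel)
  have "module sE" "module t" using f[of 0] by (simp_all add: module_hom_iff)
  then show "module_hom sE t (\<lambda>x. \<Sum>k. f k x)"
    unfolding module_hom_iff
    using suminf_add[OF sm sm] bounded_linear.suminf[OF t.bounded_linear_scale sm]
    by (auto simp: module_hom.add[OF f] module_hom.scale[OF f])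
  have "norm (\<Sum>k. f k x) \<le> (\<Sum>k. norm (f k x))" by (rule summable_norm[OF sn])
  also have "\<dots> \<le> (\<Sum>k. B * (1 / 2) ^ k * q x)" by (intro suminf_le b sn sums_summable[OF geo])
  also have "\<dots> = 2 * B * q x" using geo by (rule sums_unique[symmetric])
  finally show "norm (\<Sum>k. f k x) \<le> 2 * B * q x" .
qed

text \<open>
  The case \<open>g x = 0\<close> is the reason for scaling by slightly more than \<open>g x\<close>.
\<close>
lemma homogeneous_bound:
  fixes f g :: "'e \<Rightarrow> real" and sE :: "'k::real_or_complex \<Rightarrow> 'e \<Rightarrow> 'e"
  assumes f: "\<And>c x. f (sE c x) = norm c * f x" and g: "\<And>c x. g (sE c x) = norm c * g x" "\<And>x. 0 \<le> g x"
    and B: "0 < B" "\<And>x. g x \<le> 1 \<Longrightarrow> f x \<le> B"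
  shows "f x \<le> B * g x"
proof (rule field_le_epsilon)
  fix e :: real assume e: "0 < e"
  define t where "t = g x + e / B"
  have t: "0 < t" using e B(1) g(2)[of x] by (simp add: t_def add_nonneg_pos)
  have "g (sE (of_real (1 / t)) x) = g x / t"
    using t by (simp add: g norm_divide)
  also have "\<dots> \<le> 1" using t e B(1) by (simp add: t_def)
  finally have "f (sE (of_real (1 / t)) x) \<le> B" by (rule B(2))
  then have "f x / t \<le> B" using t by (simp add: f norm_divide)
  then have "f x \<le> B * t" using t by (simp add: pos_divide_le_eq)
  then show "f x \<le> B * g x + e" using B(1) by (simp add: t_def algebra_simps)
qed

text \<open>
  Bounded sequences in the seminorm of \<open>v\<close> have subsequences on which \<open>u\<close>, hence \<open>R\<close>, is Cauchy. The
  differences of a triangular sequence along such a subsequence have small images under \<open>R\<close>, yet they are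
  detected by uniformly bounded functionals.
\<close>
lemma (in lp_space) small_triangular_sequence:
  fixes v :: "'e::ab_group_add \<Rightarrow> 'x" and u :: "'e \<Rightarrow> 'z::real_normed_vector" and R :: "'e \<Rightarrow> 'y::real_normed_vector"
  assumes L: "Lp_property p s \<Lambda>" and inf: "\<not> finite_dimensional s UNIV"
    and v: "module_hom sE s v" "closure (range v) = UNIV" and u: "module_hom sE t u"
    and K: "compact K" "\<And>x. norm (v x) \<le> 1 \<Longrightarrow> u x \<in> K"
    and R: "\<And>\<epsilon>. 0 < \<epsilon> \<Longrightarrow> \<exists>M. \<forall>x. norm (R x) \<le> M * norm (u x) + \<epsilon> * norm (v x)"
    and \<tau>: "\<And>l::nat. 0 < \<tau> l"
  obtains w \<gamma> where "\<And>l::nat. functional (2 * \<Lambda>\<^sup>2) (\<gamma> l)" "\<And>l. \<gamma> l (v (w l)) = 1" "\<And>j l. l < j \<Longrightarrow> \<gamma> l (v (w j)) = 0"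
    "\<And>l. norm (v (w l)) \<le> 2" "\<And>l. norm (R (w l)) \<le> \<tau> l"
proof -
  have sub: "subspace (range v)" using module_hom.subspace_image[OF v(1), of UNIV] v(1)
    by (simp add: module.subspace_def module_hom_iff)
  obtain z \<zeta> where z: "\<And>n::nat. z n \<in> range v" "\<And>n. norm (z n) = 1" "\<And>n. functional (2 * \<Lambda>\<^sup>2) (\<zeta> n)"
    "\<And>n. \<zeta> n (z n) = 1" "\<And>n m. n < m \<Longrightarrow> \<zeta> n (z m) = 0"
    by (rule triangular_sequence[OF L inf sub v(2)]) (rule that; (assumption | blast))
  have "\<forall>n. \<exists>x. v x = z n" using z(1) by (metis imageE)
  then obtain a where a: "\<And>n. v (a n) = z n" by metis
  have "\<forall>n. u (a n) \<in> K" using K(2) a z(2) by simp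
  then obtain limit \<sigma> where \<sigma>: "strict_mono \<sigma>" "((\<lambda>n. u (a n)) \<circ> \<sigma>) \<longlonglongrightarrow> limit"
    using K(1)[unfolded compact_def, rule_format, of "\<lambda>n. u (a n)"] by blast
  define x where "x n = a (\<sigma> n)" for n
  have "Cauchy (\<lambda>n. u (x n))" using LIMSEQ_imp_Cauchy[OF \<sigma>(2)] by (simp add: x_def o_def)
  have diff: "v (x n - x m) = z (\<sigma> n) - z (\<sigma> m)" for n m by (simp add: module_hom.diff[OF v(1)] x_def a)
  have v2: "norm (v (x n - x m)) \<le> 2" for n m
    using norm_triangle_ineq4[of "z (\<sigma> n)" "z (\<sigma> m)"] z(2) by (simp add: diff)
  have "\<exists>N. \<forall>n\<ge>N. \<forall>m\<ge>N. norm (R (x n - x m)) \<le> \<epsilon>" if \<epsilon>: "0 < \<epsilon>" for \<epsilon>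
  proof -
    obtain M where M: "\<And>x. norm (R x) \<le> M * norm (u x) + \<epsilon> / 4 * norm (v x)" using R[of "\<epsilon> / 4"] \<epsilon> by auto
    have pos: "0 < \<epsilon> / (2 * (\<bar>M\<bar> + 1))" using \<epsilon> by simp
    obtain N where N: "\<And>n m. N \<le> n \<Longrightarrow> N \<le> m \<Longrightarrow> norm (u (x n) - u (x m)) < \<epsilon> / (2 * (\<bar>M\<bar> + 1))"
      using \<open>Cauchy (\<lambda>n. u (x n))\<close> pos unfolding Cauchy_def dist_norm by metis
    have "norm (R (x n - x m)) \<le> \<epsilon>" if "N \<le> n" "N \<le> m" for n m
    proof -
      have un: "norm (u (x n - x m)) < \<epsilon> / (2 * (\<bar>M\<bar> + 1))" using N[OF that] by (simp add: module_hom.diff[OF u])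
      have "M * norm (u (x n - x m)) \<le> (\<bar>M\<bar> + 1) * norm (u (x n - x m))" by (intro mult_right_mono) auto
      also have "\<dots> \<le> (\<bar>M\<bar> + 1) * (\<epsilon> / (2 * (\<bar>M\<bar> + 1)))" using un by (intro mult_left_mono) auto
      also have "\<dots> = \<epsilon> / 2"
      proof -
        have q: "q * (\<epsilon> / (2 * q)) = \<epsilon> / 2" if "0 < q" for q :: real using that by simp
        show ?thesis by (rule q) (simp add: add_nonneg_pos)
      qed
      finally have "M * norm (u (x n - x m)) \<le> \<epsilon> / 2" .
      moreover have "\<epsilon> / 4 * norm (v (x n - x m)) \<le> \<epsilon> / 4 * 2" using v2 \<epsilon> by (intro mult_left_mono) auto
      ultimately show ?thesis using M[of "x n - x m"] by linarith
    qed
    then show ?thesis by blast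
  qed
  then have "\<forall>l. \<exists>N. \<forall>n\<ge>N. \<forall>m\<ge>N. norm (R (x n - x m)) \<le> \<tau> l" using \<tau> by blast
  then obtain th where th: "\<And>l n m. th l \<le> n \<Longrightarrow> th l \<le> m \<Longrightarrow> norm (R (x n - x m)) \<le> \<tau> l" by metis
  \<comment> \<open>Any strictly increasing choice above the thresholds \<open>th\<close> will do.\<close>
  define N where "N l = l + (\<Sum>j\<le>l. th j)" for l
  have "strict_mono N" by (intro strict_monoI_Suc) (simp add: N_def)
  then have Nmono: "N l < N j" if "l < j" for l j using that by (rule strict_monoD)
  have Nth: "th l \<le> N l" for l
  proof -
    have "th l \<le> (\<Sum>j\<le>l. th j)" by (rule member_le_sum) auto
    then show ?thesis by (simp add: N_def)
  qed
  define w where "w l = x (N l) - x (Suc (N l))" for l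
  define \<gamma> where "\<gamma> l = \<zeta> (\<sigma> (N l))" for l
  have \<gamma>h: "module_hom s (*) (\<gamma> l)" for l unfolding \<gamma>_def by (rule functional_hom[OF z(3)])
  have \<sigma>mono: "\<sigma> n < \<sigma> m" if "n < m" for n m using \<sigma>(1) that by (rule strict_monoD)
  have vw: "v (w l) = z (\<sigma> (N l)) - z (\<sigma> (Suc (N l)))" for l by (simp add: w_def diff)
  show thesis
  proof (rule that[of \<gamma> w])
    show "functional (2 * \<Lambda>\<^sup>2) (\<gamma> l)" for l by (simp add: \<gamma>_def z(3))
    show "norm (v (w l)) \<le> 2" for l by (simp add: w_def v2)
    show "norm (R (w l)) \<le> \<tau> l" for l using th[of l "N l" "Suc (N l)"] Nth[of l] by (simp add: w_def)
    show "\<gamma> l (v (w l)) = 1" for l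
      using z(4)[of "\<sigma> (N l)"] z(5)[OF \<sigma>mono[OF lessI]] unfolding vw module_hom.diff[OF \<gamma>h] by (simp add: \<gamma>_def)
    show "\<gamma> l (v (w j)) = 0" if "l < j" for j l
    proof -
      have "\<sigma> (N l) < \<sigma> (N j)" "\<sigma> (N l) < \<sigma> (Suc (N j))" using Nmono[OF that] by (auto intro: \<sigma>mono)
      then show ?thesis using z(5) unfolding vw module_hom.diff[OF \<gamma>h] by (simp add: \<gamma>_def)
    qed
  qed
qed

text \<open>
  This is the heart of the matter: \<open>u\<close>, compact relative to \<open>v\<close>, factors through \<open>Y\<close> by an operator
  \<open>R\<close> with dense range. Expand \<open>u\<close> into finite rank pieces that pass through \<open>\<ell>\<^sub>p\<close> spaces and put these
  spaces into \<open>Y\<close> as biorthogonal blocks. This gives \<open>R0\<close> and an operator \<open>S\<close> from \<open>Y\<close> to \<open>X\<close> with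
  \<open>S (R0 x) = u x\<close>. Adding to \<open>R0\<close> any operator with values in the kernel of \<open>S\<close> preserves this
  equation, and with it the lower estimate for the sum. Such a summand \<open>G\<close> suffices to make the range dense:
  the vectors \<open>b k i\<close> were chosen in the range of \<open>u\<close>, so every \<open>y j\<close> is the sum of a value of \<open>R0\<close>
  and of an element \<open>z j\<close> of the kernel of \<open>S\<close>, and \<open>G\<close> has to reach the elements \<open>z j\<close> only.
  For this it uses vectors on which \<open>R0\<close> is negligible.
\<close>
theorem dense_range_operator:
  fixes sE :: "'k::real_or_complex \<Rightarrow> 'e::ab_group_add \<Rightarrow> 'e" and sX :: "'k \<Rightarrow> 'x::banach \<Rightarrow> 'x"
    and sY :: "'k \<Rightarrow> 'y::banach \<Rightarrow> 'y" and u v :: "'e \<Rightarrow> 'x"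
  assumes p: "1 < p"
    and X: "scalar_normed_space sX" "Lp_property p sX \<Lambda>X" "\<not> finite_dimensional sX UNIV"
    and Y: "scalar_normed_space sY" "Lp_property p sY \<Lambda>Y" "\<not> finite_dimensional sY UNIV"
    and sep: "closure (range (y :: nat \<Rightarrow> 'y)) = UNIV"
    and u: "module_hom sE sX u" "closure (range u) = UNIV"
    and v: "module_hom sE sX v" "closure (range v) = UNIV"
    and K: "compact K" "\<And>x. norm (v x) \<le> 1 \<Longrightarrow> u x \<in> K"
  obtains R C where "module_hom sE sY R" "0 < C" "\<And>x. norm (R x) \<le> C * norm (v x)" "\<And>x. norm (u x) \<le> C * norm (R x)"
    "closure (range R) = UNIV"
proof -
  interpret X: lp_space p sX using p X(1) by (simp add: lp_space_def lp_exponent_def)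
  interpret Y: lp_space p sY using p Y(1) by (simp add: lp_space_def lp_exponent_def)
  interpret E: module sE using u(1) by (simp add: module_hom_iff)
  have rangeu: "X.subspace (range u)" using module_hom.subspace_image[OF u(1), of UNIV] by (simp add: E.subspace_def)
  obtain C1 and n :: "nat \<Rightarrow> nat" and d b where C1: "0 < C1" and b: "\<And>k i. i < n k \<Longrightarrow> b k i \<in> range u"
    and d: "\<And>k i. i < n k \<Longrightarrow> \<exists>M. X.functional M (d k i)"
    and dK: "\<And>k y. y \<in> K \<Longrightarrow> lpn p {..<n k} (\<lambda>i. d k i y) \<le> C1 * (1 / 4) ^ k"
    and b_upper: "\<And>k a. norm (\<Sum>i<n k. sX (a i) (b k i)) \<le> C1 * lpn p {..<n k} a"
    and expand: "\<And>y. y \<in> K \<Longrightarrow> (\<lambda>k. \<Sum>i<n k. sX (d k i y) (b k i)) sums y"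
    by (rule X.compact_set_expansion[OF X(2) K(1) u(2)]) (rule that; (assumption | blast))
  obtain C2 where C2: "0 < C2" and ex2: "\<And>(n::nat \<Rightarrow> nat) (y::nat \<Rightarrow> 'y). \<exists>e \<phi>. (\<forall>k. \<forall>i<n k. Y.functional C2 (\<phi> k i)) \<and>
    (\<forall>k l. \<forall>i<n k. \<forall>j<n l. \<phi> k i (e l j) = (if k = l \<and> i = j then 1 else 0)) \<and>
    (\<forall>k a. norm (\<Sum>i<n k. sY (a i) (e k i)) \<le> C2 * lpn p {..<n k} a) \<and>
    (\<forall>k x. lpn p {..<n k} (\<lambda>i. \<phi> k i x) \<le> C2 * norm x) \<and>
    (\<forall>k j. j < k \<longrightarrow> (\<forall>i<n k. \<phi> k i (y j) = 0))"
    by (rule Y.biorthogonal_sequence[OF Y(2,3)]) (rule that; (assumption | blast))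
  obtain e \<phi> where o: "\<forall>k. \<forall>i<n k. Y.functional C2 (\<phi> k i)"
    "\<forall>k l. \<forall>i<n k. \<forall>j<n l. \<phi> k i (e l j) = (if k = l \<and> i = j then 1 else 0)"
    "\<forall>k a. norm (\<Sum>i<n k. sY (a i) (e k i)) \<le> C2 * lpn p {..<n k} a"
    "\<forall>k x. lpn p {..<n k} (\<lambda>i. \<phi> k i x) \<le> C2 * norm x"
    "\<forall>k j. j < k \<longrightarrow> (\<forall>i<n k. \<phi> k i (y j) = 0)"
    using ex2[of n y] by (elim exE conjE) (rule that)
  have \<phi>: "Y.functional C2 (\<phi> k i)" if "i < n k" for k i using o(1) that by blast
  have bi: "\<phi> k i (e l j) = (if k = l \<and> i = j then 1 else 0)" if "i < n k" "j < n l" for k l i j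
    using o(2) that by blast
  have e_upper: "norm (\<Sum>i<n k. sY (a i) (e k i)) \<le> C2 * lpn p {..<n k} a" for k a using o(3) by blast
  have \<phi>_upper: "lpn p {..<n k} (\<lambda>i. \<phi> k i x) \<le> C2 * norm x" for k x using o(4) by blast
  have \<phi>y: "\<phi> k i (y j) = 0" if "j < k" "i < n k" for k j i using o(5) that by blast
  note uh = u(1) note vh = v(1)
  have dh: "module_hom sX (*) (d k i)" if "i < n k" for k i using d[OF that] X.functional_hom by blast
  have \<phi>h: "module_hom sY (*) (\<phi> k i)" if "i < n k" for k i using \<phi>[OF that] Y.functional_hom by blast

  have du: "lpn p {..<n k} (\<lambda>i. d k i (u x)) \<le> C1 * (1 / 4) ^ k * norm (v x)" for k x
  proof (rule homogeneous_bound[where f = "\<lambda>x. lpn p {..<n k} (\<lambda>i. d k i (u x))" and g = "\<lambda>x. norm (v x)" and sE = sE])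
    show "norm (v (sE c x)) = norm c * norm (v x)" for c x by (simp add: module_hom.scale[OF vh] X.norm_scale)
    show "0 \<le> norm (v x)" for x by simp
    show "lpn p {..<n k} (\<lambda>i. d k i (u (sE c x))) = norm c * lpn p {..<n k} (\<lambda>i. d k i (u x))" for c x
      unfolding X.lpn_scale[symmetric]
      by (rule X.lpn_cong) (simp add: module_hom.scale[OF uh] module_hom.scale[OF dh])
    show "0 < C1 * (1 / 4) ^ k" using C1 by simp
    show "lpn p {..<n k} (\<lambda>i. d k i (u x)) \<le> C1 * (1 / 4) ^ k" if "norm (v x) \<le> 1" for x
      by (rule dK[OF K(2)[OF that]])
  qed
  define T where "T k x = (\<Sum>i<n k. sX (d k i (u x)) (b k i))" for k x
  have T_sums: "(\<lambda>k. T k x) sums u x" for x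
  proof -
    define t where "t = 1 / (norm (v x) + 1)"
    have t: "0 < t" by (simp add: t_def add_nonneg_pos)
    have "norm (v (sE (of_real t) x)) = norm (v x) * t" using t by (simp add: module_hom.scale[OF vh] X.norm_scale)
    also have "\<dots> \<le> 1" unfolding t_def using norm_ge_zero[of "v x"] by (simp add: divide_le_eq not_less)
    finally have "u (sE (of_real t) x) \<in> K" by (rule K(2))
    from expand[OF this] have "(\<lambda>k. T k (sE (of_real t) x)) sums u (sE (of_real t) x)" by (simp add: T_def)
    moreover have "T k (sE (of_real t) x) = t *\<^sub>R T k x" for k
    proof -
      have "T k (sE (of_real t) x) = (\<Sum>i<n k. sX (of_real t * d k i (u x)) (b k i))"
        unfolding T_def by (intro sum.cong refl) (simp add: module_hom.scale[OF uh] module_hom.scale[OF dh])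
      then show ?thesis by (simp only: X.sum_scale_mult T_def X.scale_of_real)
    qed
    moreover have "u (sE (of_real t) x) = t *\<^sub>R u x" by (simp add: module_hom.scale[OF uh] X.scale_of_real)
    ultimately have "(\<lambda>k. t *\<^sub>R T k x) sums (t *\<^sub>R u x)" by simp
    from sums_scaleR_right[OF this, of "1 / t"] show ?thesis using t by simp
  qed

  \<comment> \<open>The decay \<open>1 / 4\<^sup>k\<close> of the pieces is shared equally: \<open>R0\<close> gains the factor \<open>2\<^sup>k\<close> and \<open>S\<close> gives it back, so that both series converge.\<close>
  define Rk where "Rk k x = sY (2 ^ k) (\<Sum>i<n k. sY (d k i (u x)) (e k i))" for k x
  have Rkh: "module_hom sE sY (Rk k)" for k
    unfolding module_hom_iff
  proof (intro conjI allI)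
    show "module sE" "module sY" by unfold_locales
    have eq: "(\<Sum>i<n k. sY (d k i (u (x + x'))) (e k i)) = (\<Sum>i<n k. sY (d k i (u x) + d k i (u x')) (e k i))"
      "(\<Sum>i<n k. sY (d k i (u (sE c x))) (e k i)) = (\<Sum>i<n k. sY (c * d k i (u x)) (e k i))" for x x' c
      by (auto intro!: sum.cong simp: module_hom.add[OF uh] module_hom.add[OF dh] module_hom.scale[OF uh] module_hom.scale[OF dh])
    show "Rk k (x + x') = Rk k x + Rk k x'" for x x'
      unfolding Rk_def eq Y.sum_scale_add by (rule Y.scale_right_distrib)
    show "Rk k (sE c x) = sY c (Rk k x)" for c x
      unfolding Rk_def eq Y.sum_scale_mult by (simp add: mult.commute)
  qed
  have Rkb: "norm (Rk k x) \<le> (C2 * C1) * (1 / 2) ^ k * norm (v x)" for k x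
  proof -
    have "norm (Rk k x) = 2 ^ k * norm (\<Sum>i<n k. sY (d k i (u x)) (e k i))"
      by (simp add: Rk_def Y.norm_scale norm_power)
    also have "\<dots> \<le> 2 ^ k * (C2 * (C1 * (1 / 4) ^ k * norm (v x)))"
      using C2 du by (intro mult_left_mono order_trans[OF e_upper]) auto
    also have "\<dots> = C2 * C1 * (2 ^ k * (1 / 4) ^ k) * norm (v x)" by simp
    also have "2 ^ k * (1 / 4) ^ k = (1 / 2 :: real) ^ k" by (simp flip: power_mult_distrib)
    finally show ?thesis .
  qed
  define R0 where "R0 x = (\<Sum>k. Rk k x)" for x
  note R0 = series_of_homs[OF Y(1) Rkh Rkb, folded R0_def]

  define Sk where "Sk k z = sX ((1 / 2) ^ k) (\<Sum>i<n k. sX (\<phi> k i z) (b k i))" for k z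
  have Skh: "module_hom sY sX (Sk k)" for k
    unfolding module_hom_iff
  proof (intro conjI allI)
    show "module sY" "module sX" by unfold_locales
    have eq: "(\<Sum>i<n k. sX (\<phi> k i (z + z')) (b k i)) = (\<Sum>i<n k. sX (\<phi> k i z + \<phi> k i z') (b k i))"
      "(\<Sum>i<n k. sX (\<phi> k i (sY c z)) (b k i)) = (\<Sum>i<n k. sX (c * \<phi> k i z) (b k i))" for z z' c
      by (auto intro!: sum.cong simp: module_hom.add[OF \<phi>h] module_hom.scale[OF \<phi>h])
    show "Sk k (z + z') = Sk k z + Sk k z'" for z z'
      unfolding Sk_def eq X.sum_scale_add by (rule X.scale_right_distrib)
    show "Sk k (sY c z) = sX c (Sk k z)" for c z
      unfolding Sk_def eq X.sum_scale_mult by (simp add: mult.commute)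
  qed
  have Skb: "norm (Sk k z) \<le> (C1 * C2) * (1 / 2) ^ k * norm z" for k z
  proof -
    have "norm (Sk k z) = (1 / 2) ^ k * norm (\<Sum>i<n k. sX (\<phi> k i z) (b k i))"
      by (simp add: Sk_def X.norm_scale norm_power norm_divide)
    also have "\<dots> \<le> (1 / 2) ^ k * (C1 * (C2 * norm z))"
      using C1 \<phi>_upper by (intro mult_left_mono order_trans[OF b_upper]) auto
    finally show ?thesis by (simp add: ac_simps)
  qed
  define S where "S z = (\<Sum>k. Sk k z)" for z
  note S = series_of_homs[OF X(1) Skh Skb, folded S_def]
  have Sbh: "bounded_hom sY sX (2 * (C1 * C2)) S" using S(2,3) by (simp add: bounded_hom_def S_def[abs_def])
  have Slin: "bounded_linear S" by (rule bounded_hom_bounded_linear[OF Y(1) X(1) Sbh])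

  have \<phi>Rk: "\<phi> l j (Rk k x) = (if l = k then 2 ^ k * d k j (u x) else 0)" if "j < n l" for l j k x
  proof -
    have "(\<Sum>i<n k. d k i (u x) * \<phi> l j (e k i)) = (\<Sum>i<n k. if l = k \<and> i = j then d k i (u x) else 0)"
      using that by (intro sum.cong refl) (simp add: bi)
    also have "\<dots> = (if l = k then d k j (u x) else 0)" using that by (cases "l = k") simp_all
    finally show ?thesis
      unfolding Rk_def module_hom.scale[OF \<phi>h[OF that]] Y.functional_sum_vector[OF \<phi>h[OF that]] by simp
  qed
  have SkRk: "Sk l (Rk k x) = (if l = k then T k x else 0)" for l k x
  proof (cases "l = k")
    case True
    have "(\<Sum>i<n k. sX (\<phi> k i (Rk k x)) (b k i)) = (\<Sum>i<n k. sX (2 ^ k * d k i (u x)) (b k i))"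
      by (intro sum.cong refl) (simp add: \<phi>Rk)
    then show ?thesis using True
      by (simp add: Sk_def X.sum_scale_mult T_def flip: power_mult_distrib)
  next
    case False
    have "(\<Sum>i<n l. sX (\<phi> l i (Rk k x)) (b l i)) = 0" using False by (intro sum.neutral) (simp add: \<phi>Rk)
    then show ?thesis using False by (simp add: Sk_def)
  qed
  have SRk: "S (Rk k x) = T k x" for k x
    unfolding S_def SkRk using sums_unique[OF sums_single[of k "\<lambda>_. T k x"]] by simp
  have SR0: "S (R0 x) = u x" for x
    using bounded_linear.suminf[OF Slin R0(1), of x] sums_unique[OF T_sums[of x]] by (simp add: R0_def SRk)

  have "S (y j) \<in> range u" for j
  proof -
    have "Sk k (y j) = 0" if "k \<notin> {..j}" for k
    proof -
      have "(\<Sum>i<n k. sX (\<phi> k i (y j)) (b k i)) = 0" using that \<phi>y by (intro sum.neutral) auto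
      then show ?thesis by (simp add: Sk_def)
    qed
    then have "S (y j) = (\<Sum>k\<le>j. Sk k (y j))" unfolding S_def by (intro suminf_finite) auto
    moreover have "(\<Sum>k\<le>j. Sk k (y j)) \<in> range u"
      unfolding Sk_def using rangeu b by (intro X.subspace_sum X.subspace_scale) auto
    ultimately show ?thesis by simp
  qed
  then have "\<forall>j. \<exists>x. u x = S (y j)" by (metis imageE)
  then obtain x0 where x0: "\<And>j. u (x0 j) = S (y j)" by metis
  \<comment> \<open>The part of \<open>y j\<close> in the kernel of \<open>S\<close>.\<close>
  define z where "z j = y j - R0 (x0 j)" for j
  define \<zeta> where "\<zeta> j = (1 / (1 + norm (z j))) *\<^sub>R z j" for j
  have pos: "0 < 1 + norm (z j)" for j by (simp add: add_pos_nonneg)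
  have \<zeta>1: "norm (\<zeta> j) \<le> 1" for j using pos[of j] by (simp add: \<zeta>_def)
  have S\<zeta>: "S (\<zeta> j) = 0" for j
    by (simp add: \<zeta>_def z_def module_hom.diff[OF S(2)] linear_cmul[OF bounded_linear.linear[OF Slin]] SR0 x0)

  \<comment> \<open>The weights of \<open>G\<close> decrease so fast that all later terms together are negligible against each term.\<close>
  define \<tau> where "\<tau> l = (1 / 2 :: real) ^ (l * l)" for l :: nat
  have \<tau>: "0 < \<tau> l" for l by (simp add: \<tau>_def)
  have \<tau>_le: "\<tau> l \<le> (1 / 2) ^ l" for l
    unfolding \<tau>_def by (rule power_decreasing) (cases l, auto)
  have \<tau>_fast: "\<tau> j \<le> \<tau> l * (1 / 2) ^ l * (1 / 2) ^ j" if "l < j" for l j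
  proof -
    obtain q where q: "j = Suc (l + q)" using less_imp_Suc_add[of l j] \<open>l < j\<close> by blast
    have "l * l + l + j \<le> j * j" unfolding q by (simp add: algebra_simps)
    then have "\<tau> j \<le> (1 / 2) ^ (l * l + l + j)" unfolding \<tau>_def by (rule power_decreasing) auto
    then show ?thesis by (simp add: \<tau>_def power_add)
  qed
  \<comment> \<open>\<open>R0\<close> is a norm limit of operators that are bounded in terms of \<open>u\<close>.\<close>
  have R0_small: "\<exists>M. \<forall>x. norm (R0 x) \<le> M * norm (u x) + \<epsilon> * norm (v x)" if \<epsilon>: "0 < \<epsilon>" for \<epsilon>
  proof -
    have "(\<lambda>N. 2 * (C2 * C1) * (1 / 2) ^ N) \<longlonglongrightarrow> 2 * (C2 * C1) * 0"
      by (intro tendsto_mult tendsto_const LIMSEQ_power_zero) simp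
    then have "eventually (\<lambda>N. 2 * (C2 * C1) * (1 / 2) ^ N < \<epsilon>) sequentially"
      using \<epsilon> by (intro order_tendstoD(2)) auto
    then obtain N where N: "2 * (C2 * C1) * (1 / 2) ^ N < \<epsilon>" by (auto simp: eventually_sequentially)
    have "\<exists>D. \<forall>x. norm (Rk k x) \<le> D * norm (u x)" for k
    proof -
      have "\<forall>i. \<exists>M. i < n k \<longrightarrow> X.functional M (d k i)" using d by blast
      from choice[OF this] obtain M where M: "\<And>i. i < n k \<Longrightarrow> X.functional (M i) (d k i)" by blast
      have "norm (Rk k x) \<le> 2 ^ k * (\<Sum>i<n k. M i * norm (e k i)) * norm (u x)" for x
      proof -
        have "norm (\<Sum>i<n k. sY (d k i (u x)) (e k i)) \<le> (\<Sum>i<n k. M i * norm (u x) * norm (e k i))"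
          using X.functional_bound[OF M] by (intro order_trans[OF norm_sum] sum_mono) (simp add: Y.norm_scale mult_right_mono)
        also have "\<dots> = (\<Sum>i<n k. M i * norm (e k i)) * norm (u x)"
          unfolding sum_distrib_right by (intro sum.cong refl) simp
        finally show ?thesis by (simp add: Rk_def Y.norm_scale norm_power mult.assoc)
      qed
      then show ?thesis by blast
    qed
    then obtain D where D: "\<And>k x. norm (Rk k x) \<le> D k * norm (u x)" by metis
    have "norm (R0 x) \<le> (\<Sum>k<N. D k) * norm (u x) + \<epsilon> * norm (v x)" for x
    proof -
      have eq: "R0 x = (\<Sum>k. Rk (k + N) x) + (\<Sum>k<N. Rk k x)"
        unfolding R0_def by (rule suminf_split_initial_segment[OF R0(1)])
      have "norm (\<Sum>k<N. Rk k x) \<le> (\<Sum>k<N. D k) * norm (u x)"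
        unfolding sum_distrib_right by (intro order_trans[OF norm_sum] sum_mono D)
      moreover have "norm (\<Sum>k. Rk (k + N) x) \<le> 2 * (C2 * C1 * (1 / 2) ^ N) * norm (v x)"
      proof (rule series_of_homs(3)[OF Y(1) Rkh])
        show "norm (Rk (k + N) x) \<le> C2 * C1 * (1 / 2) ^ N * (1 / 2) ^ k * norm (v x)" for k x
          using Rkb[of "k + N" x] by (simp add: power_add ac_simps)
      qed
      moreover have "2 * (C2 * C1 * (1 / 2) ^ N) * norm (v x) \<le> \<epsilon> * norm (v x)"
        using N by (intro mult_right_mono) auto
      ultimately show ?thesis unfolding eq using norm_triangle_ineq[of "\<Sum>k. Rk (k + N) x" "\<Sum>k<N. Rk k x"] by linarith
    qed
    then show ?thesis by blast
  qed
  have \<tau>2: "0 < (1 / 2) ^ l * \<tau> l" for l using \<tau> by simp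
  obtain w \<gamma> where \<gamma>: "\<And>l::nat. X.functional (2 * \<Lambda>X\<^sup>2) (\<gamma> l)" and \<gamma>w: "\<And>l. \<gamma> l (v (w l)) = 1" "\<And>j l. l < j \<Longrightarrow> \<gamma> l (v (w j)) = 0"
    and vw: "\<And>l. norm (v (w l)) \<le> 2" and Rw: "\<And>l. norm (R0 (w l)) \<le> (1 / 2) ^ l * \<tau> l"
    by (rule X.small_triangular_sequence[OF X(2,3) v u(1) K R0_small \<tau>2]) (assumption | rule that | blast)+
  define C3 where "C3 = 2 * \<Lambda>X\<^sup>2"
  have C3: "0 \<le> C3" by (simp add: C3_def)
  note \<gamma>h = X.functional_hom[OF \<gamma>]
  \<comment> \<open>Each index is taken infinitely often.\<close>
  define \<iota> where "\<iota> l = fst (prod_decode l)" for l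
  define Gl where "Gl l x = sY (\<gamma> l (v x)) (\<tau> l *\<^sub>R \<zeta> (\<iota> l))" for l x
  have Glh: "module_hom sE sY (Gl l)" for l
    unfolding module_hom_iff
  proof (intro conjI allI)
    show "module sE" "module sY" by unfold_locales
    show "Gl l (x + x') = Gl l x + Gl l x'" for x x'
      by (simp add: Gl_def module_hom.add[OF vh] module_hom.add[OF \<gamma>h] Y.scale_left_distrib)
    show "Gl l (sE c x) = sY c (Gl l x)" for c x
      by (simp add: Gl_def module_hom.scale[OF vh] module_hom.scale[OF \<gamma>h])
  qed
  have Gl_le: "norm (Gl l x) \<le> C3 * norm (v x) * \<tau> l" for l x
  proof -
    have "norm (Gl l x) = norm (\<gamma> l (v x)) * (\<tau> l * norm (\<zeta> (\<iota> l)))" using \<tau>[of l] by (simp add: Gl_def Y.norm_scale)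
    also have "\<dots> \<le> (C3 * norm (v x)) * (\<tau> l * 1)"
      using X.functional_bound[OF \<gamma>] \<zeta>1 \<tau>[of l] C3 by (intro mult_mono) (auto simp: C3_def)
    finally show ?thesis by simp
  qed
  have Glb: "norm (Gl l x) \<le> C3 * (1 / 2) ^ l * norm (v x)" for l x
  proof -
    have "C3 * norm (v x) * \<tau> l \<le> C3 * norm (v x) * (1 / 2) ^ l" using C3 \<tau>_le by (intro mult_left_mono) auto
    with Gl_le[of l x] show ?thesis by (simp add: ac_simps)
  qed
  define G where "G x = (\<Sum>l. Gl l x)" for x
  note G = series_of_homs[OF Y(1) Glh Glb, folded G_def]
  have SG: "S (G x) = 0" for x
  proof -
    have "S (Gl l x) = 0" for l
      by (simp add: Gl_def module_hom.scale[OF S(2)] linear_cmul[OF bounded_linear.linear[OF Slin]] S\<zeta>)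
    then show ?thesis using bounded_linear.suminf[OF Slin G(1), of x] by (simp add: G_def)
  qed

  define R where "R x = R0 x + G x" for x
  have Rh: "module_hom sE sY R"
    unfolding module_hom_iff
  proof (intro conjI allI)
    show "module sE" "module sY" by unfold_locales
    show "R (x + x') = R x + R x'" for x x' by (simp add: R_def module_hom.add[OF R0(2)] module_hom.add[OF G(2)])
    show "R (sE c x) = sY c (R x)" for c x
      by (simp add: R_def module_hom.scale[OF R0(2)] module_hom.scale[OF G(2)] Y.scale_right_distrib)
  qed
  have SR: "S (R x) = u x" for x by (simp add: R_def module_hom.add[OF S(2)] SR0 SG)
  define C where "C = 2 * (C2 * C1) + 2 * C3 + 2 * (C1 * C2)"
  have "0 < C1 * C2" using C1 C2 by simp
  then have C: "0 < C" using C3 by (simp add: C_def mult.commute add_pos_nonneg)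

  define D where "D = closure (range R)"
  have Dsub: "Y.subspace D"
    unfolding D_def using module_hom.subspace_image[OF Rh, of UNIV]
    by (intro Y.subspace_closure) (simp add: E.subspace_def)
  \<comment> \<open>At \<open>w l\<close> with \<open>\<iota> l = i\<close> the earlier terms of \<open>G\<close> vanish and the later ones are negligible, so \<open>R (w l) / \<tau> l\<close> is close to \<open>\<zeta> i\<close>.\<close>
  have \<zeta>D: "\<zeta> i \<in> D" for i
    unfolding D_def closure_approachable
  proof (intro allI impI)
    fix \<epsilon> :: real assume \<epsilon>: "0 < \<epsilon>"
    have "(\<lambda>l. (1 + 4 * C3) * (1 / 2) ^ l) \<longlonglongrightarrow> (1 + 4 * C3) * 0"
      by (intro tendsto_mult tendsto_const LIMSEQ_power_zero) simp
    then have "eventually (\<lambda>l. (1 + 4 * C3) * (1 / 2) ^ l < \<epsilon>) sequentially"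
      using \<epsilon> by (intro order_tendstoD(2)) auto
    then obtain j where j: "\<And>l. j \<le> l \<Longrightarrow> (1 + 4 * C3) * (1 / 2) ^ l < \<epsilon>" by (auto simp: eventually_sequentially)
    define l where "l = prod_encode (i, j)"
    have il: "\<iota> l = i" by (simp add: \<iota>_def l_def)
    have jl: "j \<le> l" unfolding l_def by (rule le_prod_encode_2)
    have "norm (G (w l) - \<tau> l *\<^sub>R \<zeta> i) \<le> 4 * C3 * (1 / 2) ^ l * \<tau> l"
    proof -
      have "(\<lambda>j. if j = l then Gl l (w l) else 0) sums Gl l (w l)" using sums_single[of l "\<lambda>_. Gl l (w l)"] by simp
      then have "(\<lambda>j. Gl j (w l) - (if j = l then Gl l (w l) else 0)) sums (G (w l) - Gl l (w l))"
        unfolding G_def by (intro sums_diff summable_sums G(1))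
      moreover have "Gl l (w l) = \<tau> l *\<^sub>R \<zeta> i" by (simp add: Gl_def \<gamma>w il)
      ultimately have sum: "(\<lambda>j. Gl j (w l) - (if j = l then Gl l (w l) else 0)) sums (G (w l) - \<tau> l *\<^sub>R \<zeta> i)" by simp
      have le: "norm (Gl j (w l) - (if j = l then Gl l (w l) else 0)) \<le> 2 * C3 * (1 / 2) ^ l * \<tau> l * (1 / 2) ^ j" for j
      proof -
        consider "j < l" | "j = l" | "l < j" by linarith
        then show ?thesis
        proof cases
          case 1
          then show ?thesis using \<gamma>w(2)[OF 1] C3 \<tau>[of l] by (simp add: Gl_def)
        next
          case 2
          then show ?thesis using C3 \<tau>[of l] by simp
        next
          case 3
          have "norm (Gl j (w l)) \<le> C3 * norm (v (w l)) * \<tau> j" by (rule Gl_le)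
          also have "\<dots> \<le> C3 * 2 * (\<tau> l * (1 / 2) ^ l * (1 / 2) ^ j)"
            using vw \<tau>_fast[OF 3] C3 \<tau>[of j] by (intro mult_mono) auto
          finally show ?thesis using 3 by (simp add: ac_simps)
        qed
      qed
      have geo: "(\<lambda>j. 2 * C3 * (1 / 2) ^ l * \<tau> l * (1 / 2) ^ j) sums (2 * C3 * (1 / 2) ^ l * \<tau> l * 2)"
        using sums_mult[OF geometric_sums[of "1 / 2 :: real"], of "2 * C3 * (1 / 2) ^ l * \<tau> l"] by simp
      have "norm (\<Sum>j. Gl j (w l) - (if j = l then Gl l (w l) else 0)) \<le> (\<Sum>j. 2 * C3 * (1 / 2) ^ l * \<tau> l * (1 / 2) ^ j)"
        by (rule norm_suminf_le[OF le sums_summable[OF geo]])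
      then show ?thesis using sums_unique[OF sum] sums_unique[OF geo] by simp
    qed
    then have "norm (R (w l) - \<tau> l *\<^sub>R \<zeta> i) \<le> (1 / 2) ^ l * \<tau> l + 4 * C3 * (1 / 2) ^ l * \<tau> l"
      using Rw[of l] norm_triangle_ineq[of "R0 (w l)" "G (w l) - \<tau> l *\<^sub>R \<zeta> i"] by (simp add: R_def algebra_simps)
    also have "\<dots> = \<tau> l * ((1 + 4 * C3) * (1 / 2) ^ l)" by (simp add: algebra_simps)
    also have "\<dots> < \<tau> l * \<epsilon>" using j[OF jl] \<tau>[of l] by (intro mult_strict_left_mono)
    finally have "norm ((1 / \<tau> l) *\<^sub>R (R (w l) - \<tau> l *\<^sub>R \<zeta> i)) < \<epsilon>" using \<tau>[of l] by (simp add: divide_less_eq mult.commute)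
    moreover have "(1 / \<tau> l) *\<^sub>R (R (w l) - \<tau> l *\<^sub>R \<zeta> i) = R (sE (of_real (1 / \<tau> l)) (w l)) - \<zeta> i"
      using \<tau>[of l] by (simp only: module_hom.scale[OF Rh] Y.scale_of_real) (simp add: scaleR_diff_right)
    ultimately show "\<exists>z\<in>range R. dist z (\<zeta> i) < \<epsilon>" by (auto simp: dist_norm)
  qed
  have GD: "G x \<in> D" for x
  proof -
    have "Gl l x \<in> D" for l
      unfolding Gl_def Y.scale_of_real[symmetric] using Dsub \<zeta>D by (intro Y.subspace_scale)
    then have mem: "(\<Sum>l<m. Gl l x) \<in> D" for m using Dsub by (intro Y.subspace_sum)
    have lim: "(\<lambda>m. \<Sum>l<m. Gl l x) \<longlonglongrightarrow> G x" unfolding G_def by (rule summable_LIMSEQ[OF G(1)])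
    have "closed D" by (simp add: D_def)
    then show ?thesis by (rule closed_sequentially[OF _ mem lim])
  qed
  have "y j \<in> D" for j
  proof -
    have "R (x0 j) \<in> D" unfolding D_def by (rule subsetD[OF closure_subset rangeI])
    then have "R0 (x0 j) \<in> D" using Y.subspace_diff[OF Dsub _ GD, of "R (x0 j)" "x0 j"] by (simp add: R_def)
    moreover have "z j = sY (of_real (1 + norm (z j))) (\<zeta> j)"
      using pos[of j] unfolding Y.scale_of_real by (simp add: \<zeta>_def)
    then have "z j \<in> D" using Y.subspace_scale[OF Dsub \<zeta>D, of "of_real (1 + norm (z j))" j] by (simp only:)
    ultimately have "z j + R0 (x0 j) \<in> D" by (intro Y.subspace_add[OF Dsub])
    then show ?thesis by (simp add: z_def)
  qed
  then have "closure (range y) \<subseteq> D" by (intro closure_minimal) (auto simp: D_def)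
  then have "D = UNIV" using sep by auto
  show thesis
  proof (rule that[of R C])
    show "closure (range R) = UNIV" using \<open>D = UNIV\<close> by (simp add: D_def)
    show "norm (R x) \<le> C * norm (v x)" for x
    proof -
      have "norm (R x) \<le> 2 * (C2 * C1) * norm (v x) + 2 * C3 * norm (v x)"
        unfolding R_def by (intro order_trans[OF norm_triangle_ineq] add_mono R0(3) G(3))
      also have "\<dots> \<le> C * norm (v x)"
        unfolding distrib_right[symmetric] using C1 C2 by (intro mult_right_mono) (auto simp: C_def)
      finally show ?thesis .
    qed
    show "norm (u x) \<le> C * norm (R x)" for x
    proof -
      have "norm (u x) \<le> 2 * (C1 * C2) * norm (R x)" using S(3)[of "R x"] by (simp add: SR)
      also have "\<dots> \<le> C * norm (R x)" using C1 C2 C3 by (intro mult_right_mono) (auto simp: C_def)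
      finally show ?thesis .
    qed
  qed (use Rh C in auto)
qed

section \<open>From the Banach-Mazur distance to bases\<close>

lemma (in scalar_normed_space) subspace_structure_simps [simp]:
  "carr (subspace_structure s V) = V" "nadd (subspace_structure s V) = (+)"
  "nscale (subspace_structure s V) = s" "nnorm (subspace_structure s V) = norm"
  by (simp_all add: subspace_structure_def)

lemma (in scalar_normed_space) ndist_subspace_structure:
  "x \<in> V \<Longrightarrow> y \<in> V \<Longrightarrow> ndist (subspace_structure s V) x y = dist x y"
  by (simp add: ndist_def scale_minus_left dist_norm)

lemma (in scalar_normed_space) Metric_space_subspace_structure: "Metric_space V (ndist (subspace_structure s V))"
proof
  fix x y z assume "x \<in> V" "y \<in> V" "z \<in> V"
  then show "ndist (subspace_structure s V) x z \<le> ndist (subspace_structure s V) x y + ndist (subspace_structure s V) y z"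
    by (simp add: ndist_subspace_structure dist_triangle)
next
  fix x y
  show "0 \<le> ndist (subspace_structure s V) x y" by (simp add: ndist_def)
  show "ndist (subspace_structure s V) x y = ndist (subspace_structure s V) y x"
    by (simp add: ndist_def scale_minus_left norm_minus_commute)
qed (simp add: ndist_subspace_structure)

lemma (in scalar_normed_space) ntopology_UNIV: "ntopology (subspace_structure s UNIV) = euclidean"
proof -
  have "ndist (subspace_structure s UNIV) = dist" by (auto simp: fun_eq_iff ndist_subspace_structure)
  then show ?thesis by (simp add: ntopology_def)
qed

context lp_exponent
begin

lemma ell_simps:
  "carr (ell p n :: ('k::real_or_complex, nat \<Rightarrow> 'k) normed_structure) = {f. \<forall>i\<ge>n. f i = 0}"
  "nadd (ell p n :: ('k, nat \<Rightarrow> 'k) normed_structure) = (\<lambda>f g i. f i + g i)"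
  "nscale (ell p n :: ('k, nat \<Rightarrow> 'k) normed_structure) = (\<lambda>c f i. c * f i)"
  "nnorm (ell p n :: ('k, nat \<Rightarrow> 'k) normed_structure) = lpn p {..<n}"
  by (simp_all add: ell_def lpn_def fun_eq_iff)

lemma ndist_ell:
  assumes "f \<in> carr (ell p n)" "g \<in> carr (ell p n)"
  shows "ndist (ell p n :: ('k::real_or_complex, nat \<Rightarrow> 'k) normed_structure) f g = lpn p {..<n} (\<lambda>i. f i - g i)"
  using assms by (simp add: ndist_def ell_simps)

lemma Metric_space_ell:
  "Metric_space (carr (ell p n)) (ndist (ell p n :: ('k::real_or_complex, nat \<Rightarrow> 'k) normed_structure))"
proof
  fix f g h :: "nat \<Rightarrow> 'k"
  show "0 \<le> ndist (ell p n) f g" by (simp add: ndist_def ell_simps)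
  show "ndist (ell p n) f g = ndist (ell p n) g f"
    by (simp add: ndist_def ell_simps) (auto intro!: lpn_cong simp: norm_minus_commute)
  assume f: "f \<in> carr (ell p n)" and g: "g \<in> carr (ell p n)"
  show "ndist (ell p n) f g = 0 \<longleftrightarrow> f = g"
  proof
    assume "ndist (ell p n) f g = 0"
    then have "lpn p {..<n} (\<lambda>i. f i - g i) = 0" using f g by (simp add: ndist_ell)
    then have "f i - g i = 0" if "i < n" for i using lpn_eq_0[of "{..<n}" "\<lambda>i. f i - g i" i] that by simp
    moreover have "f i = g i" if "\<not> i < n" for i using that f g by (simp add: ell_simps)
    ultimately show "f = g" by (auto simp: fun_eq_iff)
  qed (use f g in \<open>simp add: ndist_ell lpn_def\<close>)
  assume h: "h \<in> carr (ell p n)"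
  show "ndist (ell p n) f h \<le> ndist (ell p n) f g + ndist (ell p n) g h"
    using f g h lpn_triangle[of "{..<n}" "\<lambda>i. f i - g i" "\<lambda>i. g i - h i"] by (simp add: ndist_ell)
qed

end

context lp_space
begin

text \<open>
  Rescale the unit vectors by the norm of \<open>T\<close>. The product of the two operator norms is taken in the
  extended nonnegative reals, so it has to be excluded that one factor is \<open>0\<close> and the other one infinite;
  in positive dimension both factors are positive.
\<close>
lemma basis_of_isomorphism:
  fixes N :: "'x set" and T :: "'x \<Rightarrow> nat \<Rightarrow> 'k"
  assumes N: "subspace N"
    and T: "linear_homeomorphism (subspace_structure s N) (ell p n) T"
    and l: "operator_norm (subspace_structure s N) (ell p n) T *
      operator_norm (ell p n) (subspace_structure s N) (inv_into N T) < ennreal l" "1 \<le> l"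
  shows "\<exists>e. lp_basis p s l n e \<and> N \<subseteq> range (\<lambda>a. \<Sum>i<n. s (a i) (e i))"
proof -
  interpret MN: Metric_space N "ndist (subspace_structure s N)" by (rule Metric_space_subspace_structure)
  interpret ME: Metric_space "carr (ell p n)" "ndist (ell p n :: ('k, nat \<Rightarrow> 'k) normed_structure)" by (rule Metric_space_ell)
  have top: "topspace (ntopology (subspace_structure s N)) = N"
    "topspace (ntopology (ell p n :: ('k, nat \<Rightarrow> 'k) normed_structure)) = carr (ell p n)"
    by (simp_all add: ntopology_def)
  have hm: "homeomorphic_map (ntopology (subspace_structure s N)) (ntopology (ell p n)) T"
    and lin: "linear_between (subspace_structure s N) (ell p n) T"
    using T by (auto simp: linear_homeomorphism_def)
  have inj: "inj_on T N" using homeomorphic_imp_injective_map[OF hm] by (simp add: top)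
  have img: "T ` N = carr (ell p n)" using homeomorphic_imp_surjective_map[OF hm] by (simp add: top)
  define U where "U = inv_into N T"
  have U: "U a \<in> N" "T (U a) = a" if "a \<in> carr (ell p n)" for a
    using that img by (auto simp: U_def inv_into_into f_inv_into_f)
  have UT: "U (T x) = x" if "x \<in> N" for x using inj that by (simp add: U_def)
  have Tadd: "T (x + y) = (\<lambda>i. T x i + T y i)" if "x \<in> N" "y \<in> N" for x y
    using lin that by (simp add: linear_between_def ell_simps)
  have Tscale: "T (s c x) = (\<lambda>i. c * T x i)" if "x \<in> N" for c x
    using lin that by (simp add: linear_between_def ell_simps)
  have Tc: "T x \<in> carr (ell p n)" if "x \<in> N" for x using img that by blast
  have Uscale: "U (\<lambda>i. c * a i) = s c (U a)" if a: "a \<in> carr (ell p n)" for c a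
  proof -
    have "T (s c (U a)) = (\<lambda>i. c * a i)" using Tscale[OF U(1)[OF a]] U(2)[OF a] by simp
    then show ?thesis using UT[of "s c (U a)"] subspace_scale[OF N U(1)[OF a]] by simp
  qed
  show ?thesis
  proof (cases "n = 0")
    case True
    have "x = 0" if "x \<in> N" for x
    proof -
      have "T x = T 0" using Tc[OF that] Tc[OF subspace_0[OF N]] True by (simp add: ell_simps fun_eq_iff)
      then show ?thesis using inj that subspace_0[OF N] by (auto dest: inj_onD)
    qed
    then show ?thesis using True by (auto simp: lp_basis_def lpn_def)
  next
    case False
    define \<delta> where "\<delta> j = (\<lambda>i. if i = j then 1 else 0 :: 'k)" for j :: nat
    have \<delta>: "\<delta> j \<in> carr (ell p n)" if "j < n" for j using that by (simp add: \<delta>_def ell_simps)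
    have lpn\<delta>: "lpn p {..<n} (\<delta> j) = 1" if "j < n" for j using lpn_unit[OF that, where 'a='k] by (simp add: \<delta>_def)
    define A where "A = operator_norm (subspace_structure s N) (ell p n) T"
    define B where "B = operator_norm (ell p n) (subspace_structure s N) U"
    have Ale: "ennreal (lpn p {..<n} (T x)) \<le> A" if "x \<in> N" "norm x \<le> 1" for x
      unfolding A_def operator_norm_def using that by (intro SUP_upper2[of x]) (auto simp: ell_simps)
    have Ble: "ennreal (norm (U a)) \<le> B" if "a \<in> carr (ell p n)" "lpn p {..<n} a \<le> 1" for a
      unfolding B_def operator_norm_def using that by (intro SUP_upper2[of a]) (auto simp: ell_simps)
    have AB: "A * B < ennreal l" using l(1) by (simp add: A_def B_def U_def)
    have n0: "0 < n" using False by simp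
    let ?x = "U (\<delta> 0)"
    have x0: "0 < norm ?x"
    proof -
      have "?x \<noteq> 0"
      proof
        assume "?x = 0"
        then have "\<delta> 0 = T (s 0 0)" using U(2)[OF \<delta>[OF n0]] by simp
        then have "\<delta> 0 = (\<lambda>i. 0)" using Tscale[OF subspace_0[OF N], of 0] by simp
        then show False by (auto simp: \<delta>_def fun_eq_iff dest: spec[of _ 0])
      qed
      then show ?thesis by simp
    qed
    have "B \<noteq> 0"
      using Ble[OF \<delta>[OF n0]] lpn\<delta>[OF n0] x0 by (auto simp: ennreal_eq_0_iff)
    have "A \<noteq> 0"
    proof
      assume A0: "A = 0"
      let ?c = "of_real (1 / norm ?x) :: 'k"
      have "s ?c ?x \<in> N" by (rule subspace_scale[OF N U(1)[OF \<delta>[OF n0]]])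
      moreover have "norm (s ?c ?x) \<le> 1" using x0 by (simp add: norm_scale norm_divide)
      ultimately have "ennreal (lpn p {..<n} (T (s ?c ?x))) \<le> 0" using Ale A0 by metis
      then have "lpn p {..<n} (T (s ?c ?x)) \<le> 0" by (simp add: ennreal_eq_0_iff)
      moreover have "lpn p {..<n} (T (s ?c ?x)) = 1 / norm ?x"
        unfolding Tscale[OF U(1)[OF \<delta>[OF n0]]] U(2)[OF \<delta>[OF n0]] lpn_scale lpn\<delta>[OF n0] by (simp add: norm_divide)
      ultimately show False using x0 by simp
    qed
    have fin: "A \<noteq> top" "B \<noteq> top"
      using AB \<open>A \<noteq> 0\<close> \<open>B \<noteq> 0\<close> by (auto simp: ennreal_top_mult ennreal_mult_top)
    obtain \<alpha> \<beta> where \<alpha>: "0 \<le> \<alpha>" "A = ennreal \<alpha>" and \<beta>: "0 \<le> \<beta>" "B = ennreal \<beta>"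
      using fin by (metis ennreal_cases)
    have \<alpha>0: "0 < \<alpha>" using \<open>A \<noteq> 0\<close> \<alpha> by (cases "\<alpha> = 0") auto
    have \<alpha>\<beta>: "\<alpha> * \<beta> < l" using AB \<alpha> \<beta> l(2) by (simp flip: ennreal_mult add: ennreal_less_iff)
    have Tb: "lpn p {..<n} (T x) \<le> \<alpha> * norm x" if x: "x \<in> N" for x
    proof (cases "x = 0")
      case True
      then have "T x = (\<lambda>i. 0)" using Tscale[OF x, of 0] by simp
      then show ?thesis using True by (simp add: lpn_def)
    next
      case False
      let ?c = "of_real (1 / norm x) :: 'k"
      have "ennreal (lpn p {..<n} (T (s ?c x))) \<le> A"
        using False by (intro Ale subspace_scale[OF N x]) (simp add: norm_scale norm_divide)
      then have "lpn p {..<n} (T (s ?c x)) \<le> \<alpha>" using \<alpha> by simp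
      then have "1 / norm x * lpn p {..<n} (T x) \<le> \<alpha>" unfolding Tscale[OF x] lpn_scale by (simp add: norm_divide)
      then show ?thesis using False by (simp add: divide_le_eq)
    qed
    have Ub: "norm (U a) \<le> \<beta> * lpn p {..<n} a" if a: "a \<in> carr (ell p n)" for a
    proof (cases "lpn p {..<n} a = 0")
      case True
      have "a i = 0" for i using lpn_eq_0[OF True, of i] a by (cases "i < n") (auto simp: ell_simps)
      then have "a = (\<lambda>i. 0 * a i)" by auto
      then have "U a = s 0 (U a)" using Uscale[OF a, of 0] by simp
      then show ?thesis using True by simp
    next
      case False
      then have pos: "0 < lpn p {..<n} a" using lpn_nonneg[of "{..<n}" a] by linarith
      let ?c = "of_real (1 / lpn p {..<n} a) :: 'k"
      have "ennreal (norm (U (\<lambda>i. ?c * a i))) \<le> B"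
      proof (rule Ble)
        show "(\<lambda>i. ?c * a i) \<in> carr (ell p n)" using a by (simp add: ell_simps)
        show "lpn p {..<n} (\<lambda>i. ?c * a i) \<le> 1" unfolding lpn_scale using pos by (simp add: norm_divide)
      qed
      then have "norm (U (\<lambda>i. ?c * a i)) \<le> \<beta>" using \<beta> by simp
      then have "1 / lpn p {..<n} a * norm (U a) \<le> \<beta>" unfolding Uscale[OF a] norm_scale using pos by (simp add: norm_divide)
      then show ?thesis using pos by (simp add: divide_le_eq)
    qed
    define e where "e j = s (of_real \<alpha>) (U (\<delta> j))" for j
    have eN: "e j \<in> N" "T (e j) = (\<lambda>i. of_real \<alpha> * \<delta> j i)" if "j < n" for j
    proof -
      show "e j \<in> N" unfolding e_def using U(1)[OF \<delta>[OF that]] by (rule subspace_scale[OF N])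
      show "T (e j) = (\<lambda>i. of_real \<alpha> * \<delta> j i)" unfolding e_def Tscale[OF U(1)[OF \<delta>[OF that]]] U(2)[OF \<delta>[OF that]] ..
    qed
    have comb: "(\<Sum>j<m. s (a j) (e j)) \<in> N \<and> T (\<Sum>j<m. s (a j) (e j)) = (\<lambda>i. \<Sum>j<m. a j * T (e j) i)" if "m \<le> n" for m a
      using that
    proof (induction m)
      case 0
      have "T 0 = (\<lambda>i. 0)" using Tscale[OF subspace_0[OF N], of 0] by simp
      then show ?case using subspace_0[OF N] by simp
    next
      case (Suc m)
      then have IH: "(\<Sum>j<m. s (a j) (e j)) \<in> N" "T (\<Sum>j<m. s (a j) (e j)) = (\<lambda>i. \<Sum>j<m. a j * T (e j) i)" by auto
      have em: "e m \<in> N" using eN(1) Suc.prems by simp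
      have sm: "s (a m) (e m) \<in> N" by (rule subspace_scale[OF N em])
      show ?case using subspace_add[OF N IH(1) sm] Tadd[OF IH(1) sm] IH(2) Tscale[OF em, of "a m"] by simp
    qed
    have Tcomb: "T (\<Sum>j<n. s (a j) (e j)) = (\<lambda>i. if i < n then of_real \<alpha> * a i else 0)" for a
    proof -
      have "(\<Sum>j<n. a j * T (e j) i) = (\<Sum>j<n. if j = i then of_real \<alpha> * a j else 0)" for i
        by (intro sum.cong refl) (simp add: eN(2) \<delta>_def)
      then show ?thesis using comb[OF order_refl, of a] by (simp add: fun_eq_iff)
    qed
    have lpT: "lpn p {..<n} (T (\<Sum>j<n. s (a j) (e j))) = \<alpha> * lpn p {..<n} a" for a
    proof -
      have "lpn p {..<n} (T (\<Sum>j<n. s (a j) (e j))) = lpn p {..<n} (\<lambda>i. of_real \<alpha> * a i)"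
        unfolding Tcomb by (rule lpn_cong) simp
      then show ?thesis unfolding lpn_scale using \<alpha>(1) by simp
    qed
    have "lp_basis p s l n e"
      unfolding lp_basis_def
    proof (intro allI conjI)
      fix a :: "nat \<Rightarrow> 'k"
      let ?y = "\<Sum>j<n. s (a j) (e j)"
      have yN: "?y \<in> N" using comb[OF order_refl] by blast
      have "\<alpha> * lpn p {..<n} a \<le> \<alpha> * norm ?y" using Tb[OF yN] by (simp add: lpT)
      then have "lpn p {..<n} a \<le> 1 * norm ?y" using \<alpha>0 by simp
      also have "\<dots> \<le> l * norm ?y" using l(2) by (intro mult_right_mono) auto
      finally show "lpn p {..<n} a \<le> l * norm ?y" .
      have "norm ?y = norm (U (T ?y))" by (simp add: UT[OF yN])
      also have "\<dots> \<le> \<beta> * (\<alpha> * lpn p {..<n} a)" using Ub[OF Tc[OF yN]] by (simp add: lpT)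
      also have "\<dots> = \<alpha> * \<beta> * lpn p {..<n} a" by simp
      also have "\<dots> \<le> l * lpn p {..<n} a" using \<alpha>\<beta> by (intro mult_right_mono) auto
      finally show "norm ?y \<le> l * lpn p {..<n} a" .
    qed
    moreover have "x \<in> range (\<lambda>a. \<Sum>i<n. s (a i) (e i))" if x: "x \<in> N" for x
    proof -
      define a where "a i = T x i / of_real \<alpha>" for i
      let ?y = "\<Sum>j<n. s (a j) (e j)"
      have yN: "?y \<in> N" using comb[OF order_refl] by blast
      have "T ?y = T x" unfolding Tcomb using Tc[OF x] \<alpha>0 by (auto simp: a_def ell_simps fun_eq_iff)
      then have "?y = x" using inj yN x by (auto dest: inj_onD)
      then show ?thesis by (intro image_eqI[of _ _ a]) simp_all
    qed
    ultimately show ?thesis by blast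
  qed
qed

lemma Lp_property_of_script_L_space:
  assumes "script_L_space p s"
  obtains \<Lambda> where "Lp_property p s \<Lambda>"
proof -
  obtain l where l: "1 \<le> l" and ex: "\<And>M. subspace M \<and> finite_dimensional s M \<Longrightarrow>
       \<exists>N. subspace N \<and> finite_dimensional s N \<and> M \<subseteq> N \<and>
         banach_mazur (subspace_structure s N) (ell p (dim N) :: ('k, nat \<Rightarrow> 'k) normed_structure) \<le> ennreal l"
    using assms unfolding script_L_space_def by blast
  have "Lp_property p s (l + 1)"
    unfolding Lp_property_def
  proof (intro conjI allI impI)
    show "1 \<le> l + 1" using l by simp
    fix F :: "'x set" assume F: "finite F"
    have "subspace (span F) \<and> finite_dimensional s (span F)"
      using F by (auto simp: finite_dimensional_def subspace_span)
    from ex[OF this] obtain N where N: "subspace N" "span F \<subseteq> N"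
      "banach_mazur (subspace_structure s N) (ell p (dim N) :: ('k, nat \<Rightarrow> 'k) normed_structure) \<le> ennreal l" by blast
    have "ennreal l < ennreal (l + 1)" using l by (simp add: ennreal_less_iff)
    with N(3) have "banach_mazur (subspace_structure s N) (ell p (dim N) :: ('k, nat \<Rightarrow> 'k) normed_structure) < ennreal (l + 1)"
      by (rule le_less_trans)
    then obtain T where T: "linear_homeomorphism (subspace_structure s N) (ell p (dim N)) T"
      "operator_norm (subspace_structure s N) (ell p (dim N)) T *
        operator_norm (ell p (dim N)) (subspace_structure s N) (inv_into N T) < ennreal (l + 1)"
      unfolding banach_mazur_def INF_less_iff by auto
    obtain e where "lp_basis p s (l + 1) (dim N) e" "N \<subseteq> range (\<lambda>a. \<Sum>i<dim N. s (a i) (e i))"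
      using basis_of_isomorphism[OF N(1) T] l by auto
    moreover have "F \<subseteq> N" using N(2) span_superset by blast
    ultimately show "\<exists>n e. lp_basis p s (l + 1) n e \<and> F \<subseteq> range (\<lambda>a. \<Sum>i<n. s (a i) (e i))" by blast
  qed
  then show thesis by (rule that)
qed

end

section \<open>Local Banach spaces and the theorem\<close>

lemma seminormed_norm_of_hom:
  assumes "vector_space sE" "scalar_normed_space sY" "module_hom sE sY R"
  shows "seminormed sE (\<lambda>x. norm (R x))"
proof -
  interpret Y: scalar_normed_space sY by fact
  show ?thesis
    using assms by (simp add: seminormed_def seminormed_axioms_def seminorm_def module_hom.add module_hom.scale Y.norm_scale norm_triangle_ineq)
qed

text \<open>
  The space \<open>E\<close> with the seminorm \<open>\<parallel>R x\<parallel>\<close> is isometric, up to the kernel, to the range of \<open>R\<close>, so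
  its completion is the closure of this range.
\<close>
lemma local_banach_of_dense_range:
  fixes sY :: "'k::real_or_complex \<Rightarrow> 'y::banach \<Rightarrow> 'y" and sE :: "'k \<Rightarrow> 'e::ab_group_add \<Rightarrow> 'e"
  assumes E: "vector_space sE" and Y: "scalar_normed_space sY" and R: "module_hom sE sY R" "closure (range R) = UNIV"
  shows "linearly_homeomorphic (local_banach sE (\<lambda>x. norm (R x))) (subspace_structure sY UNIV)"
proof -
  interpret Y: scalar_normed_space sY by (rule Y)
  interpret r: seminormed sE "\<lambda>x. norm (R x)" by (rule seminormed_norm_of_hom[OF E Y R(1)])
  let ?r = "\<lambda>x. norm (R x)"
  have Cauchy: "seminorm_Cauchy ?r x \<longleftrightarrow> Cauchy (\<lambda>n. R (x n))" for x
    by (simp add: seminorm_Cauchy_def Cauchy_def dist_norm module_hom.diff[OF R(1)])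
  \<comment> \<open>The limit does not depend on the representing sequence.\<close>
  define \<Phi> where "\<Phi> A = lim (\<lambda>n. R ((SOME x. x \<in> A) n))" for A
  have \<Phi>: "(\<lambda>n. R (x n)) \<longlonglongrightarrow> \<Phi> (r.cls x)" if x: "seminorm_Cauchy ?r x" for x
  proof -
    have "x \<in> r.cls x" using x by (simp add: r.null_rel_iff)
    then have "(SOME x'. x' \<in> r.cls x) \<in> r.cls x" by (rule someI[of "\<lambda>x'. x' \<in> r.cls x"])
    then have "(x, SOME x'. x' \<in> r.cls x) \<in> null_rel ?r" by simp
    then have d: "(\<lambda>n. norm (R (x n - (SOME x'. x' \<in> r.cls x) n))) \<longlonglongrightarrow> 0" by (simp only: r.null_rel_iff)
    obtain y where y: "(\<lambda>n. R (x n)) \<longlonglongrightarrow> y" using x Cauchy_convergent unfolding Cauchy convergent_def by blast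
    have "(\<lambda>n. R (x n) - R (x n - (SOME x'. x' \<in> r.cls x) n)) \<longlonglongrightarrow> y - 0"
      by (intro tendsto_diff y tendsto_norm_zero_cancel[OF d])
    then have "(\<lambda>n. R ((SOME x'. x' \<in> r.cls x) n)) \<longlonglongrightarrow> y" by (simp add: module_hom.diff[OF R(1)])
    then have "\<Phi> (r.cls x) = y" unfolding \<Phi>_def by (rule limI)
    then show ?thesis using y by simp
  qed
  have "linear_between r.Ep (subspace_structure sY UNIV) \<Phi>"
    unfolding linear_between_def
  proof (intro conjI ballI allI)
    fix A B assume AB: "A \<in> carr r.Ep" "B \<in> carr r.Ep"
    obtain x where x: "seminorm_Cauchy ?r x" "A = r.cls x" using AB(1) by (rule r.carr_cases)
    obtain y where y: "seminorm_Cauchy ?r y" "B = r.cls y" using AB(2) by (rule r.carr_cases)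
    note xy = x y
    have "(\<lambda>n. R (x n) + R (y n)) \<longlonglongrightarrow> \<Phi> A + \<Phi> B" unfolding xy by (intro tendsto_add \<Phi> xy)
    moreover have "(\<lambda>n. R (x n) + R (y n)) \<longlonglongrightarrow> \<Phi> (nadd r.Ep A B)"
      using \<Phi>[OF r.Cauchy_add[OF xy(1,3)]] by (simp add: xy(2,4) r.nadd_cls[OF xy(1,3)] module_hom.add[OF R(1)])
    ultimately show "\<Phi> (nadd r.Ep A B) = nadd (subspace_structure sY UNIV) (\<Phi> A) (\<Phi> B)"
      using LIMSEQ_unique by (simp, blast)
  next
    fix c A assume "A \<in> carr r.Ep"
    then obtain x where x: "seminorm_Cauchy ?r x" "A = r.cls x" by (rule r.carr_cases)
    have "(\<lambda>n. sY c (R (x n))) \<longlonglongrightarrow> sY c (\<Phi> A)"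
      unfolding x(2) by (rule bounded_linear.tendsto[OF Y.bounded_linear_scale \<Phi>[OF x(1)]])
    moreover have "(\<lambda>n. sY c (R (x n))) \<longlonglongrightarrow> \<Phi> (nscale r.Ep c A)"
      using \<Phi>[OF r.Cauchy_scale[OF x(1)], of c] by (simp add: x(2) r.nscale_cls[OF x(1)] module_hom.scale[OF R(1)])
    ultimately show "\<Phi> (nscale r.Ep c A) = nscale (subspace_structure sY UNIV) c (\<Phi> A)"
      using LIMSEQ_unique by (simp, blast)
  qed simp
  moreover have "homeomorphic_map (ntopology r.Ep) (ntopology (subspace_structure sY UNIV)) \<Phi>"
  proof -
    interpret M12: Metric_space12 "carr r.Ep" "ndist r.Ep" UNIV dist
      by (intro Metric_space12.intro r.Metric_space_local_banach Met_TC.Metric_space_axioms)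
    have surj: "\<Phi> ` carr r.Ep = UNIV"
    proof -
      have "y \<in> \<Phi> ` carr r.Ep" for y :: 'y
      proof -
        have "y \<in> closure (range R)" using R(2) by simp
        then obtain b where b: "\<forall>n. b n \<in> range R" "b \<longlonglongrightarrow> y" unfolding closure_sequential by blast
        then have "\<forall>n. \<exists>x. b n = R x" by blast
        then obtain x where x: "\<And>n. b n = R (x n)" by metis
        have lim: "(\<lambda>n. R (x n)) \<longlonglongrightarrow> y" using b(2) unfolding x[symmetric] .
        then have C: "seminorm_Cauchy ?r x" unfolding Cauchy by (rule LIMSEQ_imp_Cauchy)
        have "\<Phi> (r.cls x) = y" using \<Phi>[OF C] lim by (rule LIMSEQ_unique)
        then show ?thesis using r.cls_in_carr[OF C] by blast
      qed
      then show ?thesis by blast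
    qed
    have iso: "dist (\<Phi> A) (\<Phi> B) = ndist r.Ep A B" if AB: "A \<in> carr r.Ep" "B \<in> carr r.Ep" for A B
    proof -
      obtain x where x: "seminorm_Cauchy ?r x" "A = r.cls x" using AB(1) by (rule r.carr_cases)
      obtain y where y: "seminorm_Cauchy ?r y" "B = r.cls y" using AB(2) by (rule r.carr_cases)
      note xy = x y
      have "(\<lambda>n. norm (R (x n) - R (y n))) \<longlonglongrightarrow> norm (\<Phi> A - \<Phi> B)"
        unfolding xy(2,4) by (intro tendsto_norm tendsto_diff \<Phi> xy)
      moreover have "(\<lambda>n. norm (R (x n) - R (y n))) \<longlonglongrightarrow> ndist r.Ep A B"
        using r.ndist_cls[OF xy(1,3)] by (simp add: xy(2,4) module_hom.diff[OF R(1)])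
      ultimately show ?thesis unfolding dist_norm by (rule LIMSEQ_unique)
    qed
    have "homeomorphic_map M12.M1.mtopology Met_TC.mtopology \<Phi>"
      by (rule M12.isometry_imp_homeomorphic_map[OF surj iso])
    then show ?thesis by (simp add: Y.ntopology_UNIV ntopology_def[of r.Ep])
  qed
  ultimately show ?thesis unfolding linearly_homeomorphic_def linear_homeomorphism_def by blast
qed

text \<open>
  Restricting an isomorphism of the local Banach space to \<open>E\<close> turns the seminorm into a norm
  pulled back along an operator with dense range, up to constants.
\<close>
lemma operator_of_local_banach:
  fixes sX :: "'k::real_or_complex \<Rightarrow> 'x::banach \<Rightarrow> 'x" and sE :: "'k \<Rightarrow> 'e::ab_group_add \<Rightarrow> 'e"
  assumes q: "seminormed sE q" and X: "scalar_normed_space sX"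
    and T: "linear_homeomorphism (local_banach sE q) (subspace_structure sX UNIV) T"
  defines "w \<equiv> \<lambda>x. T (local_embedding q x)"
  shows "module_hom sE sX w" "closure (range w) = UNIV" "\<exists>c>0. \<forall>x. q x \<le> c * norm (w x)"
    "continuous_map (ntopology (local_banach sE q)) euclidean T"
proof -
  interpret q: seminormed sE q by (rule q)
  interpret X: scalar_normed_space sX by (rule X)
  interpret M: Metric_space "carr q.Ep" "ndist q.Ep" by (rule q.Metric_space_local_banach)
  have lin: "linear_between q.Ep (subspace_structure sX UNIV) T"
    and hm: "homeomorphic_map (ntopology q.Ep) euclidean T"
    using T by (auto simp: linear_homeomorphism_def X.ntopology_UNIV)
  have tp: "ntopology q.Ep = M.mtopology" by (simp add: ntopology_def)
  show wh: "module_hom sE sX w"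
    unfolding module_hom_iff
  proof (intro conjI allI)
    show "module sE" "module sX" by unfold_locales
    show "w (x + y) = w x + w y" "w (sE c x) = sX c (w x)" for x y c
      using lin q.local_embedding_in_carr unfolding w_def q.local_embedding_linear by (simp_all add: linear_between_def)
  qed
  show cont: "continuous_map (ntopology q.Ep) euclidean T" by (rule homeomorphic_imp_continuous_map[OF hm])
  then have "continuous_map M.mtopology Met_TC.mtopology T" by (simp add: tp)
  then have ct: "\<exists>\<delta>>0. \<forall>B. B \<in> carr q.Ep \<and> ndist q.Ep A B < \<delta> \<longrightarrow> dist (T A) (T B) < \<epsilon>" if "A \<in> carr q.Ep" "0 < \<epsilon>" for A \<epsilon>
    using that unfolding M.metric_continuous_map[OF Met_TC.Metric_space_axioms] by blast
  have Tsurj: "T ` carr q.Ep = UNIV" using homeomorphic_imp_surjective_map[OF hm] by (simp add: tp)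
  show "closure (range w) = UNIV"
  proof -
    have "y \<in> closure (range w)" for y :: 'x
      unfolding closure_approachable
    proof (intro allI impI)
      fix \<epsilon> :: real assume \<epsilon>: "0 < \<epsilon>"
      have "y \<in> T ` carr q.Ep" using Tsurj by simp
      then obtain A where A: "A \<in> carr q.Ep" "T A = y" by blast
      obtain \<delta> where \<delta>: "0 < \<delta>" "\<And>B. B \<in> carr q.Ep \<and> ndist q.Ep A B < \<delta> \<Longrightarrow> dist (T A) (T B) < \<epsilon>"
        using ct[OF A(1) \<epsilon>] by blast
      obtain x where "ndist q.Ep A (local_embedding q x) < \<delta>" using q.local_embedding_dense[OF A(1) \<delta>(1)] by blast
      then have "dist (T A) (w x) < \<epsilon>" unfolding w_def using q.local_embedding_in_carr by (intro \<delta>(2)) auto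
      then show "\<exists>z\<in>range w. dist z y < \<epsilon>" using A(2) by (auto simp: dist_commute)
    qed
    then show ?thesis by blast
  qed
  show "\<exists>c>0. \<forall>x. q x \<le> c * norm (w x)"
  proof -
    obtain g where "homeomorphic_maps (ntopology q.Ep) euclidean T g" using hm homeomorphic_map_maps by blast
    then have g: "continuous_map euclidean (ntopology q.Ep) g" "\<And>A. A \<in> carr q.Ep \<Longrightarrow> g (T A) = A"
      by (auto simp: homeomorphic_maps_def tp)
    then have "continuous_map Met_TC.mtopology M.mtopology g" by (simp add: tp)
    then obtain \<delta> where \<delta>: "0 < \<delta>" "\<And>z. dist (w 0) z < \<delta> \<Longrightarrow> ndist q.Ep (g (w 0)) (g z) < 1"
      unfolding Met_TC.metric_continuous_map[OF M.Metric_space_axioms] by (metis UNIV_I zero_less_one)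
    have gw: "g (w x) = local_embedding q x" for x unfolding w_def by (intro g(2) q.local_embedding_in_carr)
    have small: "q x < 1" if "norm (w x) < \<delta>" for x
      using \<delta>(2)[of "w x"] that unfolding gw q.ndist_local_embedding
      by (simp add: module_hom.zero[OF wh] dist_norm q.p_minus_commute[of 0])
    have "q x \<le> 1 * (2 / \<delta> * norm (w x))" for x
    proof (rule homogeneous_bound[where sE = sE and f = q and g = "\<lambda>x. 2 / \<delta> * norm (w x)"])
      show "q (sE c x) = norm c * q x" for c x by (rule q.p_scale)
      show "2 / \<delta> * norm (w (sE c x)) = norm c * (2 / \<delta> * norm (w x))" for c x
        by (simp add: module_hom.scale[OF wh] X.norm_scale)
      show "0 \<le> 2 / \<delta> * norm (w x)" for x using \<delta>(1) by simp
      show "q x \<le> 1" if "2 / \<delta> * norm (w x) \<le> 1" for x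
      proof -
        have "norm (w x) \<le> \<delta> / 2" using that \<delta>(1) by (simp add: field_simps)
        then have "norm (w x) < \<delta>" using \<delta>(1) by linarith
        from small[OF this] show ?thesis by simp
      qed
    qed simp
    then show ?thesis using \<delta>(1) by (intro exI[of _ "2 / \<delta>"]) simp
  qed
qed

lemma bounded_operator_of_local_banach:
  fixes sX :: "'k::real_or_complex \<Rightarrow> 'x::banach \<Rightarrow> 'x" and sE :: "'k \<Rightarrow> 'e::ab_group_add \<Rightarrow> 'e"
  assumes q: "seminormed sE q" and X: "scalar_normed_space sX"
    and T: "linear_homeomorphism (local_banach sE q) (subspace_structure sX UNIV) T"
  shows "\<exists>c>0. \<forall>x. norm (T (local_embedding q x)) \<le> c * q x"
proof -
  interpret q: seminormed sE q by (rule q)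
  interpret X: scalar_normed_space sX by (rule X)
  interpret M: Metric_space "carr q.Ep" "ndist q.Ep" by (rule q.Metric_space_local_banach)
  define w where "w x = T (local_embedding q x)" for x
  note w = operator_of_local_banach[OF q X T, folded w_def]
  have wh: "module_hom sE sX w" using w(1) by (simp add: w_def[abs_def])
  have "continuous_map M.mtopology Met_TC.mtopology T" using w(4) by (simp add: ntopology_def)
  then obtain \<delta> where \<delta>: "0 < \<delta>"
    "\<And>B. B \<in> carr q.Ep \<and> ndist q.Ep (local_embedding q 0) B < \<delta> \<Longrightarrow> dist (w 0) (T B) < 1"
    unfolding M.metric_continuous_map[OF Met_TC.Metric_space_axioms] w_def
    using q.local_embedding_in_carr[of 0] zero_less_one by blast
  have small: "norm (w x) < 1" if "q x < \<delta>" for x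
  proof -
    have "dist (w 0) (w x) < 1"
      unfolding w_def[of x] using that
      by (intro \<delta>(2)) (simp add: q.local_embedding_in_carr q.ndist_local_embedding)
    then show ?thesis by (simp add: module_hom.zero[OF wh])
  qed
  have "norm (w x) \<le> 1 * (2 / \<delta> * q x)" for x
  proof (rule homogeneous_bound[where sE = sE and f = "\<lambda>x. norm (w x)" and g = "\<lambda>x. 2 / \<delta> * q x"])
    show "norm (w (sE c x)) = norm c * norm (w x)" for c x by (simp add: module_hom.scale[OF wh] X.norm_scale)
    show "2 / \<delta> * q (sE c x) = norm c * (2 / \<delta> * q x)" for c x by (simp add: q.p_scale)
    show "0 \<le> 2 / \<delta> * q x" for x using \<delta>(1) q.p_nonneg[of x] by simp
    show "norm (w x) \<le> 1" if "2 / \<delta> * q x \<le> 1" for x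
    proof -
      have "q x \<le> \<delta> / 2" using that \<delta>(1) by (simp add: field_simps)
      then have "q x < \<delta>" using \<delta>(1) by linarith
      from small[OF this] show ?thesis by simp
    qed
  qed simp
  then show ?thesis using \<delta>(1) by (intro exI[of _ "2 / \<delta>"]) (simp add: w_def)
qed

lemma continuous_seminorm_dominated:
  fixes r P :: "'e::{real_vector, topological_ab_group_add} \<Rightarrow> real"
  assumes r: "seminormed s r" and P: "continuous_seminorm s P" and le: "\<And>x. r x \<le> M * P x"
  shows "continuous_seminorm s r"
proof -
  interpret r: seminormed s r by (rule r)
  interpret P: seminormed s P using P r unfolding seminormed_def seminormed_axioms_def continuous_seminorm_def by blast
  have "(r \<longlongrightarrow> r x) (at x)" for x
  proof -
    have "continuous_on UNIV P" using P by (simp add: continuous_seminorm_def)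
    moreover have "continuous_on UNIV (\<lambda>y. y - x)" by (intro continuous_on_diff continuous_on_id continuous_on_const)
    ultimately have "continuous_on UNIV (\<lambda>y. P (y - x))" by (rule continuous_on_compose2) simp
    then have "((\<lambda>y. P (y - x)) \<longlongrightarrow> P (x - x)) (at x)" unfolding continuous_on_def by blast
    then have "((\<lambda>y. M * P (y - x)) \<longlongrightarrow> M * 0) (at x)" by (intro tendsto_mult tendsto_const) simp
    moreover have "norm (r y - r x) \<le> M * P (y - x)" for y
      using r.p_diff[of y x] le[of "y - x"] by simp
    ultimately have "((\<lambda>y. r y - r x) \<longlongrightarrow> 0) (at x)"
      by (intro Lim_null_comparison[of "\<lambda>y. r y - r x" "\<lambda>y. M * P (y - x)"]) simp_all
    then show ?thesis by (rule LIM_zero_cancel)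
  qed
  then show ?thesis using r.seminorm unfolding continuous_seminorm_def continuous_on_def by simp
qed

theorem corollary2p16:
  fixes p :: real
    and sX :: "'k::real_or_complex \<Rightarrow> 'x::banach \<Rightarrow> 'x"
    and sY :: "'k \<Rightarrow> 'y::banach \<Rightarrow> 'y"
    and sE :: "'k \<Rightarrow> 'e::{real_vector, topological_ab_group_add} \<Rightarrow> 'e"
    and A :: "'i set" and P :: "'i \<Rightarrow> 'e \<Rightarrow> real"
  assumes "1 < p"
    and "scalar_normed_space sX" and "separable_space (euclidean :: 'x topology)"
    and "\<not> finite_dimensional sX UNIV" and "script_L_space p sX"
    and "locally_convex_space sE" and "schwartz_space sE"
    and "defining_system sE A P"
    and "\<forall>\<alpha>\<in>A. linearly_homeomorphic (local_banach sE (P \<alpha>)) (subspace_structure sX UNIV)"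
    and "scalar_normed_space sY" and "separable_space (euclidean :: 'y topology)"
    and "\<not> finite_dimensional sY UNIV" and "script_L_space p sY"
  shows "\<exists>(B :: ('e \<Rightarrow> real) set) (Q :: ('e \<Rightarrow> real) \<Rightarrow> 'e \<Rightarrow> real). defining_system sE B Q \<and>
    (\<forall>\<beta>\<in>B. linearly_homeomorphic (local_banach sE (Q \<beta>)) (subspace_structure sY UNIV))"
proof -
  note X = assms(2) and Y = assms(10)
  interpret X: scalar_normed_space sX by (rule X)
  interpret Y: scalar_normed_space sY by (rule Y)
  have E: "vector_space sE" using assms(6) by (simp add: locally_convex_space_def)
  have lpX: "lp_space p sX" and lpY: "lp_space p sY"
    using assms(1) X Y by (simp_all add: lp_space_def lp_exponent_def)
  obtain \<Lambda>X where LX: "Lp_property p sX \<Lambda>X" by (rule lp_space.Lp_property_of_script_L_space[OF lpX assms(5)])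
  obtain \<Lambda>Y where LY: "Lp_property p sY \<Lambda>Y" by (rule lp_space.Lp_property_of_script_L_space[OF lpY assms(13)])
  obtain D :: "'y set" where D: "countable D" "closure D = UNIV"
    using assms(11) unfolding separable_space_def by auto
  then have "D \<noteq> {}" by auto
  then have sep: "closure (range (from_nat_into D)) = UNIV" using D by (simp add: range_from_nat_into)
  have sn: "seminormed sE q" if "continuous_seminorm sE q" for q
    using that E by (simp add: seminormed_def seminormed_axioms_def continuous_seminorm_def)
  define B where "B = {r. continuous_seminorm sE r \<and> linearly_homeomorphic (local_banach sE r) (subspace_structure sY UNIV)}"
  have "\<exists>r\<in>B. \<exists>C. \<forall>x. q x \<le> C * r x" if q: "continuous_seminorm sE q" for q
  proof -
    obtain \<alpha> C0 where \<alpha>: "\<alpha> \<in> A" "\<And>x. q x \<le> C0 * P \<alpha> x" using assms(8) q unfolding defining_system_def by blast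
    have P\<alpha>: "continuous_seminorm sE (P \<alpha>)" using assms(8) \<alpha>(1) by (simp add: defining_system_def)
    obtain q1 where q1: "continuous_seminorm sE q1" "\<And>x. P \<alpha> x \<le> q1 x"
      "compact_operator (local_banach sE q1) (local_banach sE (P \<alpha>)) (canonical_map (P \<alpha>))"
      using assms(7) P\<alpha> unfolding schwartz_space_def by blast
    obtain \<beta> C1 where \<beta>: "\<beta> \<in> A" "\<And>x. q1 x \<le> C1 * P \<beta> x" using assms(8) q1(1) unfolding defining_system_def by blast
    have P\<beta>: "continuous_seminorm sE (P \<beta>)" using assms(8) \<beta>(1) by (simp add: defining_system_def)
    interpret \<alpha>: seminormed sE "P \<alpha>" by (rule sn[OF P\<alpha>])
    interpret \<beta>: seminormed sE "P \<beta>" by (rule sn[OF P\<beta>])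
    interpret q1: seminormed sE q1 by (rule sn[OF q1(1)])
    obtain T\<alpha> T\<beta> where T\<alpha>: "linear_homeomorphism (local_banach sE (P \<alpha>)) (subspace_structure sX UNIV) T\<alpha>"
      and T\<beta>: "linear_homeomorphism (local_banach sE (P \<beta>)) (subspace_structure sX UNIV) T\<beta>"
      using assms(9) \<alpha>(1) \<beta>(1) unfolding linearly_homeomorphic_def by blast
    define u where "u x = T\<alpha> (local_embedding (P \<alpha>) x)" for x
    define v where "v x = T\<beta> (local_embedding (P \<beta>) x)" for x
    note u = operator_of_local_banach[OF sn[OF P\<alpha>] X T\<alpha>, folded u_def]
    note v = operator_of_local_banach[OF sn[OF P\<beta>] X T\<beta>, folded v_def]
    have uh: "module_hom sE sX u" "closure (range u) = UNIV" using u(1,2) by (simp_all add: u_def[abs_def])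
    have vh: "module_hom sE sX v" "closure (range v) = UNIV" using v(1,2) by (simp_all add: v_def[abs_def])
    obtain cu where cu: "0 < cu" "\<And>x. P \<alpha> x \<le> cu * norm (u x)" using u(3) by blast
    obtain cv where cv: "0 < cv" "\<And>x. P \<beta> x \<le> cv * norm (v x)" using v(3) by blast
    obtain bv where bv: "0 < bv" "\<And>x. norm (v x) \<le> bv * P \<beta> x"
      using bounded_operator_of_local_banach[OF sn[OF P\<beta>] X T\<beta>] unfolding v_def by blast
    \<comment> \<open>Compactness is known on the unit ball of \<open>q1\<close>, which contains the unit ball of \<open>v\<close> shrunk by \<open>\<kappa>\<close>.\<close>
    define \<kappa> where "\<kappa> = max 1 (\<bar>C1\<bar> * cv)"
    have \<kappa>: "0 < \<kappa>" by (simp add: \<kappa>_def)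
    have q1v: "q1 x \<le> \<kappa> * norm (v x)" for x
    proof -
      have "q1 x \<le> C1 * P \<beta> x" by (rule \<beta>)
      also have "\<dots> \<le> \<bar>C1\<bar> * P \<beta> x" using \<beta>.p_nonneg[of x] by (intro mult_right_mono) auto
      also have "\<dots> \<le> \<bar>C1\<bar> * (cv * norm (v x))" using cv(2) by (intro mult_left_mono) auto
      also have "\<dots> = (\<bar>C1\<bar> * cv) * norm (v x)" by simp
      also have "\<dots> \<le> \<kappa> * norm (v x)" by (intro mult_right_mono) (auto simp: \<kappa>_def)
      finally show ?thesis .
    qed
    obtain K0 where K0: "compactin (ntopology (local_banach sE (P \<alpha>))) K0"
      "canonical_map (P \<alpha>) ` {x \<in> carr (local_banach sE q1). nnorm (local_banach sE q1) x \<le> 1} \<subseteq> K0"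
      using q1(3) unfolding compact_operator_def by blast
    have "compactin euclidean (T\<alpha> ` K0)" using K0(1) u(4) by (rule image_compactin)
    then have "compact (T\<alpha> ` K0)" by simp
    then have K: "compact ((\<lambda>x. \<kappa> *\<^sub>R x) ` T\<alpha> ` K0)" by (rule compact_scaling)
    have uK1: "u x \<in> T\<alpha> ` K0" if "q1 x \<le> 1" for x
    proof -
      have "local_embedding q1 x \<in> {x \<in> carr (local_banach sE q1). nnorm (local_banach sE q1) x \<le> 1}"
        using that by (simp add: q1.local_embedding_in_carr q1.local_embedding_isometric)
      then have "canonical_map (P \<alpha>) (local_embedding q1 x) \<in> K0" using K0(2) by blast
      then have "local_embedding (P \<alpha>) x \<in> K0"
        using \<alpha>.canonical_map_local_embedding[OF sn[OF q1(1)] q1(2)] by simp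
      then show ?thesis by (simp add: u_def)
    qed
    have uK: "u x \<in> (\<lambda>x. \<kappa> *\<^sub>R x) ` T\<alpha> ` K0" if "norm (v x) \<le> 1" for x
    proof -
      have "q1 (sE (of_real (1 / \<kappa>)) x) = q1 x / \<kappa>" using \<kappa> by (simp add: q1.p_scale norm_divide)
      also have "\<dots> \<le> norm (v x)" using q1v[of x] \<kappa> by (simp add: divide_le_eq mult.commute)
      finally have "q1 (sE (of_real (1 / \<kappa>)) x) \<le> 1" using that by linarith
      then have "u (sE (of_real (1 / \<kappa>)) x) \<in> T\<alpha> ` K0" by (rule uK1)
      moreover have "u x = \<kappa> *\<^sub>R u (sE (of_real (1 / \<kappa>)) x)"
        using \<kappa> by (simp only: module_hom.scale[OF uh(1)] X.scale_of_real) simp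
      ultimately show ?thesis by blast
    qed
    obtain R C where R: "module_hom sE sY R" "0 < C" "\<And>x. norm (R x) \<le> C * norm (v x)" "\<And>x. norm (u x) \<le> C * norm (R x)"
      "closure (range R) = UNIV"
      by (rule dense_range_operator[OF assms(1) X LX assms(4) Y LY assms(12) sep uh vh K uK]) (assumption | rule that | blast)+
    let ?r = "\<lambda>x. norm (R x)"
    have "continuous_seminorm sE ?r"
    proof (rule continuous_seminorm_dominated[OF seminormed_norm_of_hom[OF E Y R(1)] P\<beta>])
      show "norm (R x) \<le> C * bv * P \<beta> x" for x
        using order_trans[OF R(3)[of x] mult_left_mono[OF bv(2)[of x]]] R(2) by (simp add: mult.assoc)
    qed
    then have "?r \<in> B" using local_banach_of_dense_range[OF E Y R(1,5)] by (simp add: B_def)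
    moreover have "q x \<le> \<bar>C0\<bar> * (cu * C) * norm (R x)" for x
    proof -
      have "q x \<le> C0 * P \<alpha> x" by (rule \<alpha>)
      also have "\<dots> \<le> \<bar>C0\<bar> * P \<alpha> x" using \<alpha>.p_nonneg[of x] by (intro mult_right_mono) auto
      also have "\<dots> \<le> \<bar>C0\<bar> * (cu * norm (u x))" using cu(2) by (intro mult_left_mono) auto
      also have "\<dots> \<le> \<bar>C0\<bar> * (cu * (C * norm (R x)))" using cu(1) R(4) by (intro mult_left_mono) auto
      finally show ?thesis by (simp add: mult.assoc)
    qed
    ultimately show ?thesis by (intro bexI[of _ ?r] exI[of _ "\<bar>C0\<bar> * (cu * C)"]) auto
  qed
  then have "defining_system sE B (\<lambda>r. r)" unfolding defining_system_def by (simp add: B_def)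
  then show ?thesis by (intro exI[of _ B] exI[of _ "\<lambda>r. r"]) (simp add: B_def)
qed

end
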